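(* Let $L\ge1$, let $\gamma,\theta,\zeta,\mu_1,\dots,\mu_L$ be generic complex parameters, and let $\mathcal{Z}(\boldsymbol\lambda)=\langle\bar0|\mathcal{B}(\lambda_1)\cdots\mathcal{B}(\lambda_L)|0\rangle$ be the partition function defined in the context. Then there is a constant $\Omega_L$ independent of $\boldsymbol\lambda=(\lambda_1,\dots,\lambda_L)$ such that for generic $\boldsymbol\lambda$ \[ \mathcal{Z}(\boldsymbol\lambda)=\Omega_L\,[\gamma]^L f'(0)^L\oint_{\Gamma_{\boldsymbol\lambda}^{\times L}}\frac{d^Lz}{(2\pi\mathrm{i})^L}\,\frac{\prod_{i\ne j}[z_i-z_j]}{\prod_{i,j=1}^L[z_i-\lambda_j]}\prod_{1\le i<j\le L}[z_i-\mu_j,\,z_i+\mu_j+\gamma]\prod_{l=1}^L\frac{[2z_l]}{[2z_l+\gamma]}\,m_l(z_1,\dots,z_l), \] where each $z_i$ is integrated over $\Gamma_{\boldsymbol\lambda}$, consisting of small counter-clockwise loops enclosing only the poles of the integrand at $\lambda_j$, $1\le j\le L$, and \[ \begin{aligned} m_l(z_1,\dots,z_l)={}&[z_l+\zeta]\frac{[\theta+\zeta-z_l,\,\theta+l\gamma+z_l-\mu_l]}{[\theta+\zeta+z_l,\,\theta+(l-1)\gamma]}[z_l+\mu_l+\gamma]\prod_{j=1}^{l-1}[z_l-\mu_j+\gamma,\,z_l+\mu_j+\gamma]\frac{[z_j-z_l+\gamma,\,z_j+z_l]}{[z_j-z_l,\,z_j+z_l+\gamma]}\\ &-[z_l-\zeta+\gamma]\frac{[\theta+\zeta+z_l+\gamma,\,\theta+(l-1)\gamma-z_l-\mu_l]}{[\theta+\zeta+z_l,\,\theta+(l-1)\gamma]}[z_l-\mu_l]\prod_{j=1}^{l-1}[z_l-\mu_j,\,z_l+\mu_j]\frac{[z_l-z_j+\gamma,\,z_l+z_j+2\gamma]}{[z_l-z_j,\,z_l+z_j+\gamma]}.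 \end{aligned} \]
   Context: Fix $\tau\in\mathbb{C}$ with $\operatorname{Im}\tau>0$ and let $f(\lambda)=\sum_{n\ge0}(-1)^n e^{\mathrm{i}n(n+1)\pi\tau}\sinh((2n+1)\lambda)$ (equivalently $-\tfrac{\mathrm{i}}{2}e^{-\mathrm{i}\pi\tau/4}\vartheta_1(\mathrm{i}\lambda|\tau)$). Write $[x]:=f(x)$ and $[x_1,\dots,x_k]:=f(x_1)\cdots f(x_k)$. Let $V=\mathbb{C}^2$ with basis $e_\pm$ and $he_\pm=\pm e_\pm$. Define $R(\lambda,\theta)\in\mathrm{End}(V\otimes V)$ by its matrix in the ordered basis $(e_+\otimes e_+,e_+\otimes e_-,e_-\otimes e_+,e_-\otimes e_-)$: $R=\begin{pmatrix}a_+&0&0&0\\0&b_+&c_+&0\\0&c_-&b_-&0\\0&0&0&a_-\end{pmatrix}$ with $a_\pm=[\lambda+\gamma]$, $b_\pm=[\lambda][\theta\mp\gamma]/[\theta]$, $c_\pm=[\theta\mp\lambda][\gamma]/[\theta]$. Let $V_0\cong V$ and $W=V_1\otimes\cdots\otimes V_L$, $V_j\cong V$; subscripts denote tensor factors acted on, $h_i$ is $h$ on $V_i$, and a dynamical argument $\theta-\gamma\sum_{i\in S}h_i$ means $\theta$ replaced by this diagonal operator on the factors $V_i$, $i\in S$. $R_{0j}$ is $R$ on $V_0\otimes V_j$ and $R_{j0}$ is $R$ on $V_j\otimes V_0$ (first leg $V_j$). Define $T_0(\lambda,\theta)=R_{01}(\lambda-\mu_1,\theta-\gamma\sum_{i=2}^Lh_i)R_{02}(\lambda-\mu_2,\theta-\gamma\sum_{i=3}^Lh_i)\cdots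 R_{0L}(\lambda-\mu_L,\theta)$ and $\bar T_0(\lambda,\theta)=R_{L0}(\lambda+\mu_L,\theta)R_{L-1,0}(\lambda+\mu_{L-1},\theta-\gamma h_L)\cdots R_{10}(\lambda+\mu_1,\theta-\gamma\sum_{i=2}^Lh_i)$. Let $K_0(\lambda,\theta)=\mathrm{diag}([\zeta+\lambda][\theta+\zeta-\lambda]/[\theta+\zeta+\lambda],\,[\zeta-\lambda])$ on $V_0$, and $\mathcal{T}_0(\lambda)=T_0(\lambda,\theta)K_0(\lambda,\theta)\bar T_0(\lambda,\theta)$. Define $\mathcal{B}(\lambda)\in\mathrm{End}(W)$ by $\mathcal{T}_0(\lambda)(e_-\otimes w)=e_+\otimes\mathcal{B}(\lambda)w+e_-\otimes(\cdots)$. Let $|0\rangle=e_+^{\otimes L}$ and for $v\in W$ let $\langle\bar0|v$ be the coefficient of $e_-^{\otimes L}$ in $v$. The partition function is $\mathcal{Z}(\lambda_1,\dots,\lambda_L)=\langle\bar0|\mathcal{B}(\lambda_1)\cdots\mathcal{B}(\lambda_L)|0\rangle$. *)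

theory Defs
  imports "HOL-Complex_Analysis.Complex_Analysis"
begin

definition tf :: "complex \<Rightarrow> complex \<Rightarrow> complex" where
  "tf tau x = (\<Sum>n. (-1)^n * exp (\<i> * of_nat (n * (n + 1)) * of_real pi * tau)
                      * sinh (of_nat (2 * n + 1) * x))"

text \<open>Spin values: True encodes e_+ (h = 1), False encodes e_- (h = -1).\<close>
definition hval :: "bool \<Rightarrow> complex" where
  "hval b = (if b then 1 else -1)"

text \<open>Matrix entries of R(lambda,theta): Rmat .. out inp = coefficient of out in R(inp).
  Pairs are (first leg, second leg).\<close>
definition Rmat :: "complex \<Rightarrow> complex \<Rightarrow> complex \<Rightarrow> complex \<Rightarrow> bool \<times> bool \<Rightarrow> bool \<times> bool \<Rightarrow> complex" where
  "Rmat tau g lam th out inp =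
     (if out = inp \<and> fst out = snd out then tf tau (lam + g)
      else if out = (True, False) \<and> inp = (True, False) then tf tau lam * tf tau (th - g) / tf tau th
      else if out = (True, False) \<and> inp = (False, True) then tf tau (th - lam) * tf tau g / tf tau th
      else if out = (False, True) \<and> inp = (True, False) then tf tau (th + lam) * tf tau g / tf tau th
      else if out = (False, True) \<and> inp = (False, True) then tf tau lam * tf tau (th + g) / tf tau th
      else 0)"

text \<open>Operators on an n-fold tensor product of C^2, given by matrix elements
  (output configuration, input configuration); configurations are bool lists of length n.\<close>
type_synonym cop = "bool list \<Rightarrow> bool list \<Rightarrow> complex"

definition opmul :: "nat \<Rightarrow> cop \<Rightarrow> cop \<Rightarrow> cop" where
  "opmul n A B = (\<lambda>x y. \<Sum>z\<in>{z :: bool list. length z = n}. A x z * B z y)"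

definition opid :: cop where
  "opid = (\<lambda>x y. if x = y then 1 else 0)"

primrec opprod :: "nat \<Rightarrow> cop list \<Rightarrow> cop" where
  "opprod n [] = opid"
| "opprod n (A # As) = opmul n A (opprod n As)"

text \<open>R acting on factors p (first leg) and q (second leg) of an n-fold product, with dynamical
  argument theta - gamma * sum_{i in S} h_i (S disjoint from {p,q}).\<close>
definition Rop :: "complex \<Rightarrow> complex \<Rightarrow> nat \<Rightarrow> nat \<Rightarrow> nat \<Rightarrow> nat set \<Rightarrow> complex \<Rightarrow> complex \<Rightarrow> cop" where
  "Rop tau g n p q S lam th = (\<lambda>x y.
     if (\<forall>i<n. i \<noteq> p \<and> i \<noteq> q \<longrightarrow> x ! i = y ! i)
     then Rmat tau g lam (th - g * (\<Sum>i\<in>S. hval (y ! i))) (x ! p, x ! q) (y ! p, y ! q)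
     else 0)"

text \<open>Site 0 is the auxiliary space V_0, sites 1..L are V_1..V_L.\<close>
definition Tmono :: "complex \<Rightarrow> complex \<Rightarrow> nat \<Rightarrow> (nat \<Rightarrow> complex) \<Rightarrow> complex \<Rightarrow> complex \<Rightarrow> cop" where
  "Tmono tau g L mu lam th =
     opprod (L + 1) (map (\<lambda>k. Rop tau g (L + 1) 0 k {k + 1..L} (lam - mu k) th) [1..<L + 1])"

definition Tbar :: "complex \<Rightarrow> complex \<Rightarrow> nat \<Rightarrow> (nat \<Rightarrow> complex) \<Rightarrow> complex \<Rightarrow> complex \<Rightarrow> cop" where
  "Tbar tau g L mu lam th =
     opprod (L + 1) (map (\<lambda>k. Rop tau g (L + 1) k 0 {k + 1..L} (lam + mu k) th) (rev [1..<L + 1]))"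

definition Kop :: "complex \<Rightarrow> complex \<Rightarrow> complex \<Rightarrow> complex \<Rightarrow> cop" where
  "Kop tau ze lam th = (\<lambda>x y. if x = y then
       (if x ! 0 then tf tau (ze + lam) * tf tau (th + ze - lam) / tf tau (th + ze + lam)
        else tf tau (ze - lam))
     else 0)"

definition Tdouble :: "complex \<Rightarrow> complex \<Rightarrow> complex \<Rightarrow> complex \<Rightarrow> nat \<Rightarrow> (nat \<Rightarrow> complex) \<Rightarrow> complex \<Rightarrow> cop" where
  "Tdouble tau g ze th L mu lam =
     opmul (L + 1) (opmul (L + 1) (Tmono tau g L mu lam th) (Kop tau ze lam th)) (Tbar tau g L mu lam th)"

definition Bop :: "complex \<Rightarrow> complex \<Rightarrow> complex \<Rightarrow> complex \<Rightarrow> nat \<Rightarrow> (nat \<Rightarrow> complex) \<Rightarrow> complex \<Rightarrow> cop" where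
  "Bop tau g ze th L mu lam = (\<lambda>u w. Tdouble tau g ze th L mu lam (True # u) (False # w))"

definition Zpart :: "complex \<Rightarrow> complex \<Rightarrow> complex \<Rightarrow> complex \<Rightarrow> nat \<Rightarrow> (nat \<Rightarrow> complex) \<Rightarrow> (nat \<Rightarrow> complex) \<Rightarrow> complex" where
  "Zpart tau g ze th L mu lam =
     opprod L (map (\<lambda>j. Bop tau g ze th L mu (lam j)) [1..<L + 1]) (replicate L False) (replicate L True)"

definition mfun :: "complex \<Rightarrow> complex \<Rightarrow> complex \<Rightarrow> complex \<Rightarrow> (nat \<Rightarrow> complex) \<Rightarrow> nat \<Rightarrow> (nat \<Rightarrow> complex) \<Rightarrow> complex" where
  "mfun tau g ze th mu l z =
     tf tau (z l + ze) * (tf tau (th + ze - z l) * tf tau (th + of_nat l * g + z l - mu l))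
       / (tf tau (th + ze + z l) * tf tau (th + (of_nat l - 1) * g))
       * tf tau (z l + mu l + g)
       * (\<Prod>j\<in>{1..<l}. tf tau (z l - mu j + g) * tf tau (z l + mu j + g)
            * (tf tau (z j - z l + g) * tf tau (z j + z l)) / (tf tau (z j - z l) * tf tau (z j + z l + g)))
   - tf tau (z l - ze + g) * (tf tau (th + ze + z l + g) * tf tau (th + (of_nat l - 1) * g - z l - mu l))
       / (tf tau (th + ze + z l) * tf tau (th + (of_nat l - 1) * g))
       * tf tau (z l - mu l)
       * (\<Prod>j\<in>{1..<l}. tf tau (z l - mu j) * tf tau (z l + mu j)
            * (tf tau (z l - z j + g) * tf tau (z l + z j + 2 * g)) / (tf tau (z l - z j) * tf tau (z l + z j + g)))"

definition integrand :: "complex \<Rightarrow> complex \<Rightarrow> complex \<Rightarrow> complex \<Rightarrow> nat \<Rightarrow> (nat \<Rightarrow> complex) \<Rightarrow> (nat \<Rightarrow> complex) \<Rightarrow> (nat \<Rightarrow> complex) \<Rightarrow> complex" where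
  "integrand tau g ze th L mu lam z =
     (\<Prod>i\<in>{1..L}. \<Prod>j\<in>{1..L} - {i}. tf tau (z i - z j))
     / (\<Prod>i\<in>{1..L}. \<Prod>j\<in>{1..L}. tf tau (z i - lam j))
     * (\<Prod>i\<in>{1..L}. \<Prod>j\<in>{i<..L}. tf tau (z i - mu j) * tf tau (z i + mu j + g))
     * (\<Prod>l\<in>{1..L}. tf tau (2 * z l) / tf tau (2 * z l + g) * mfun tau g ze th mu l z)"

primrec mint :: "((complex \<Rightarrow> complex) \<Rightarrow> complex) \<Rightarrow> nat \<Rightarrow> ((nat \<Rightarrow> complex) \<Rightarrow> complex) \<Rightarrow> complex" where
  "mint C 0 F = F (\<lambda>_. 0)"
| "mint C (Suc k) F = C (\<lambda>w. mint C k (\<lambda>z. F (z(Suc k := w))))"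

definition Gamma_int :: "nat \<Rightarrow> (nat \<Rightarrow> complex) \<Rightarrow> real \<Rightarrow> (complex \<Rightarrow> complex) \<Rightarrow> complex" where
  "Gamma_int L lam r g = (\<Sum>j\<in>{1..L}. contour_integral (circlepath (lam j) r) g)"

definition Zint :: "complex \<Rightarrow> complex \<Rightarrow> complex \<Rightarrow> complex \<Rightarrow> nat \<Rightarrow> (nat \<Rightarrow> complex) \<Rightarrow> (nat \<Rightarrow> complex) \<Rightarrow> real \<Rightarrow> complex" where
  "Zint tau g ze th L mu lam r =
     mint (Gamma_int L lam r) L (integrand tau g ze th L mu lam) / (2 * of_real pi * \<i>) ^ L"

end

theory Submission
  imports Defs
begin

text \<open>
  The residues at the simple poles turn the multiple integral into a sum over the orderings of the
  spectral parameters, and splitting off the variable attached to the last site turns that sum into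
  a recursion. The partition function satisfies the same recursion. As a function of the last
  inhomogeneity \<open>m\<close>, multiplied by \<open>[ze + m][th + ze - m]\<close>, it is a theta function of degree \<open>2L + 2\<close>,
  so it is determined by its values at \<open>m = lam k\<close>, \<open>m = - lam k - g\<close>, where the lattice with
  \<open>L\<close> sites reduces to one with \<open>L - 1\<close> sites, together with its zeros \<open>m = ze\<close> and \<open>m = - th - ze\<close>.

  The reduction works because the spin on the outermost site flips exactly once; it is needed for
  an arbitrary site and an arbitrary row. Symmetry in the inhomogeneities follows from the dynamical
  Yang-Baxter equation. Symmetry in the spectral parameters follows, without the reflection
  equation, by interpolation in the top and in the bottom row: these give invariance under
  permutations of the other \<open>L - 1\<close> parameters, which for \<open>L \<ge> 3\<close> generate all permutations, and
  \<open>L = 2\<close> is settled by an evenness argument.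
\<close>

text \<open>The sinh series gives no access to the zeros of \<open>tf\<close>, so it cannot serve as
  a divisor. Euler's power series supplies \<open>phi\<close>, a theta function of degree one whose
  zeros are provably simple and exactly the period lattice; the interpolation principle divides by
  translates of \<open>phi\<close>, and the zeros of \<open>tf\<close> are recovered from it
  afterwards. Interpolation requires entire functions. Hence the boundary matrix is multiplied by
  \<open>br (th + ze + l)\<close>, its only denominator depending on the spectral parameter, and
  this factor is removed again when \<open>Zpart\<close> is identified with \<open>Z\<close>. In a
  spectral parameter the sites provide \<open>2 * L\<close> nodes while the degree is
  \<open>2 * L + 2\<close>; the missing nodes \<open>0\<close> and \<open>\<i> * pi / 2\<close> are
  points where a double row collapses to a scalar by unitarity. Peeling off the top or the bottom
  row leaves \<open>L - 1\<close> rows to permute, which says nothing for \<open>L = 2\<close>;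
  there an inhomogeneity is reflected, which links peeling from the top with peeling from the
  bottom. Auxiliary genericity is removed by moving parameters along a line.\<close>

section \<open>Entire power series and the two halves of the theta series\<close>

lemma ratio_zero_summable:
  fixes c :: "nat \<Rightarrow> complex"
  assumes r: "\<And>n. norm (c (Suc n)) \<le> K * b ^ n * norm (c n)" and b: "0 \<le> b" "b < 1"
  shows "summable (\<lambda>n. c n * y ^ n)"
proof -
  have "(\<lambda>n. K * norm y * b ^ n) \<longlonglongrightarrow> K * norm y * 0"
    by (intro tendsto_mult tendsto_const LIMSEQ_power_zero) (use b in auto)
  then have "eventually (\<lambda>n. K * norm y * b ^ n < 1/2) sequentially"
    by (intro order_tendstoD(2)) auto
  then obtain N where N: "\<And>n. n \<ge> N \<Longrightarrow> K * norm y * b ^ n < 1/2"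
    by (auto simp: eventually_sequentially)
  show ?thesis
  proof (rule summable_ratio_test[of "1/2" N])
    fix n assume n: "n \<ge> N"
    have "norm (c (Suc n) * y ^ Suc n) = norm (c (Suc n)) * norm y * norm y ^ n"
      by (simp add: norm_mult norm_power)
    also have "\<dots> \<le> (K * b ^ n * norm (c n)) * norm y * norm y ^ n"
      by (intro mult_right_mono r) auto
    also have "\<dots> = (K * norm y * b ^ n) * norm (c n * y ^ n)"
      by (simp add: norm_mult norm_power)
    also have "\<dots> \<le> 1/2 * norm (c n * y ^ n)"
      by (intro mult_right_mono less_imp_le[OF N[OF n]]) auto
    finally show "norm (c (Suc n) * y ^ Suc n) \<le> 1/2 * norm (c n * y ^ n)" .
  qed auto
qed

lemma everywhere_summable_holomorphic:
  fixes c :: "nat \<Rightarrow> complex"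
  assumes "\<And>y. summable (\<lambda>n. c n * y ^ n)"
  shows "(\<lambda>y. \<Sum>n. c n * y ^ n) holomorphic_on UNIV"
  unfolding holomorphic_on_def field_differentiable_def
  using termdiffs_strong_converges_everywhere[OF assms] by auto

text \<open>A partial theta function. Writing \<open>sinh\<close> through exponentials splits
  \<open>tf\<close> into two one-sided halves, which are ordinary power series in
  \<open>exp (2 * x)\<close> and \<open>exp (- (2 * x))\<close>.\<close>

definition half_theta :: "complex \<Rightarrow> complex \<Rightarrow> complex" where
  "half_theta q y = (\<Sum>n. ((-1) ^ n * q ^ (n * (n + 1))) * y ^ n)"

lemma half_theta_summable:
  fixes q y :: complex
  assumes "norm q < 1"
  shows "summable (\<lambda>n. ((-1) ^ n * q ^ (n * (n + 1))) * y ^ n)"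
proof (rule ratio_zero_summable[where K = 1 and b = "norm q"])
  fix n
  have e: "Suc n * (Suc n + 1) = n + (n + 2) + n * (n + 1)" by simp
  have "norm ((-1) ^ Suc n * q ^ (Suc n * (Suc n + 1))) =
      norm q ^ n * norm q ^ (n + 2) * norm q ^ (n * (n + 1))"
    by (simp only: e power_add norm_mult norm_power) simp
  also have "\<dots> \<le> norm q ^ n * 1 * norm q ^ (n * (n + 1))"
    using assms by (intro mult_right_mono mult_left_mono power_le_one) auto
  finally show "norm ((-1) ^ Suc n * q ^ (Suc n * (Suc n + 1))) \<le>
      1 * norm q ^ n * norm ((-1) ^ n * q ^ (n * (n + 1)))"
    by (simp add: norm_mult norm_power)
qed (use assms in auto)

lemma half_theta_holomorphic: "norm q < 1 \<Longrightarrow> half_theta q holomorphic_on UNIV"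
  unfolding half_theta_def by (intro everywhere_summable_holomorphic half_theta_summable)

text \<open>An index shift suffices, since (n + 1)(n + 2) = n(n + 1) + 2n + 2. The leading term
  \<open>1\<close> remains, so a half series alone is not quasi-periodic.\<close>

lemma half_theta_shift:
  assumes "norm q < 1"
  shows "half_theta q y = 1 - q\<^sup>2 * y * half_theta q (q\<^sup>2 * y)"
proof -
  let ?a = "\<lambda>n. ((-1) ^ n * q ^ (n * (n + 1))) * y ^ n"
  have "?a (Suc n) = - q\<^sup>2 * y * (((-1) ^ n * q ^ (n * (n + 1))) * (q\<^sup>2 * y) ^ n)" for n
  proof -
    have e: "Suc n * (Suc n + 1) = 2 + 2 * n + n * (n + 1)" by simp
    show ?thesis by (simp only: e power_add power_mult power_mult_distrib power_Suc) simp
  qed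
  then have "(\<Sum>n. ?a (Suc n)) = - q\<^sup>2 * y * half_theta q (q\<^sup>2 * y)"
    unfolding half_theta_def
    by (simp only:) (rule suminf_mult[OF half_theta_summable[OF assms]])
  also have "(\<Sum>n. ?a (Suc n)) = half_theta q y - 1"
    using suminf_split_head[OF half_theta_summable[OF assms, of y]] unfolding half_theta_def by simp
  finally show ?thesis by (simp add: algebra_simps)
qed

section \<open>Quasi-periodic entire functions\<close>

locale upper_half =
  fixes tau :: complex
  assumes Im_tau: "Im tau > 0"
begin

lemma norm_nome_less_1: "norm (exp (\<i> * of_real pi * tau)) < 1"
  using Im_tau by simp

lemma tf_eq_half_theta:
  defines "q \<equiv> exp (\<i> * of_real pi * tau)"
  shows "tf tau x = (exp x * half_theta q (exp (2 * x)) - exp (-x) * half_theta q (exp (- (2 * x)))) / 2"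
proof -
  have q: "norm q < 1" using norm_nome_less_1 by (simp add: q_def)
  let ?a = "\<lambda>n. (-1) ^ n * q ^ (n * (n + 1))"
  have e1: "exp (of_nat (2 * n + 1) * y) = exp y * exp (2 * y) ^ n" for n and y :: complex
    by (simp add: exp_of_nat_mult[symmetric] exp_add[symmetric] algebra_simps)
  have "(-1)^n * exp (\<i> * of_nat (n * (n + 1)) * of_real pi * tau) * sinh (of_nat (2 * n + 1) * x)
     = exp x / 2 * (?a n * exp (2 * x) ^ n) - exp (-x) / 2 * (?a n * exp (- (2 * x)) ^ n)" for n
  proof -
    have "exp (\<i> * of_nat (n * (n + 1)) * of_real pi * tau) = exp (of_nat (n * (n + 1)) * (\<i> * of_real pi * tau))"
      by (simp add: algebra_simps)
    also have "\<dots> = q ^ (n * (n + 1))"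
      unfolding q_def by (rule exp_of_nat_mult)
    finally have e2: "exp (\<i> * of_nat (n * (n + 1)) * of_real pi * tau) = q ^ (n * (n + 1))" .
    have e3: "exp (- (of_nat (2 * n + 1) * x)) = exp (-x) * exp (- (2 * x)) ^ n"
      using e1[of n "-x"] by simp
    show ?thesis
      by (simp only: e2 sinh_field_def e3 e1) (simp add: field_simps)
  qed
  then have "tf tau x = (\<Sum>n. exp x / 2 * (?a n * exp (2 * x) ^ n) - exp (-x) / 2 * (?a n * exp (- (2 * x)) ^ n))"
    unfolding tf_def by simp
  also have "\<dots> = exp x / 2 * half_theta q (exp (2 * x)) - exp (-x) / 2 * half_theta q (exp (- (2 * x)))"
    unfolding half_theta_def
    by (subst suminf_diff[symmetric])
       (intro summable_mult half_theta_summable q | simp only: suminf_mult[OF half_theta_summable[OF q]])+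
  finally show ?thesis by (simp add: field_simps)
qed

lemma tf_minus [simp]: "tf tau (-x) = - tf tau x"
  unfolding tf_eq_half_theta by (simp add: field_simps)

lemma tf_0 [simp]: "tf tau 0 = 0"
  using tf_minus[of 0] by simp

text \<open>Modulo the period lattice, \<open>-s\<close> is the sum of the zeros.\<close>
definition theta_fun :: "nat \<Rightarrow> complex \<Rightarrow> (complex \<Rightarrow> complex) \<Rightarrow> bool" where
  "theta_fun N s g \<longleftrightarrow> g holomorphic_on UNIV \<and>
     (\<forall>x. g (x + \<i> * pi) = (-1) ^ N * g x) \<and>
     (\<forall>x. g (x + \<i> * pi * tau) = (-1) ^ N * exp (- (of_nat N * (\<i> * pi * tau) + 2 * of_nat N * x + 2 * s)) * g x)"

lemma theta_fun_tf:
  shows "theta_fun 1 0 (tf tau)"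
proof -
  define q where "q = exp (\<i> * of_real pi * tau)"
  have q: "norm q < 1" using norm_nome_less_1 by (simp add: q_def)
  have [simp]: "q \<noteq> 0" by (simp add: q_def)
  note eq = tf_eq_half_theta[folded q_def]
  have "(\<lambda>x. half_theta q (exp (a * x))) holomorphic_on UNIV" for a
    using holomorphic_on_compose_gen[OF _ half_theta_holomorphic[OF q], of "\<lambda>x. exp (a * x)" UNIV]
    by (auto simp: o_def intro!: holomorphic_intros)
  from this[of 2] this[of "-2"] have "tf tau holomorphic_on UNIV"
    unfolding eq[abs_def] by (auto intro!: holomorphic_intros)
  moreover have "tf tau (x + \<i> * pi) = - tf tau x" for x
  proof -
    have "exp (2 * (x + \<i> * pi)) = exp (2 * x)" "exp (- (2 * (x + \<i> * pi))) = exp (- (2 * x))"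
      by (simp_all add: exp_eq distrib_left) (rule exI[of _ 1] exI[of _ "-1"], simp)+
    moreover have "exp (x + \<i> * pi) = - exp x" "exp (- (x + \<i> * pi)) = - exp (-x)"
      by (simp_all add: exp_add exp_diff exp_minus)
    ultimately show ?thesis unfolding eq by (simp add: field_simps)
  qed
  moreover have "tf tau (x + \<i> * pi * tau) = - exp (- (\<i> * pi * tau + 2 * x)) * tf tau x" for x
  proof -
    define y where "y = exp x"
    have [simp]: "y \<noteq> 0" by (simp add: y_def)
    have e1: "exp (x + \<i> * pi * tau) = q * y" "exp (2 * x) = y\<^sup>2"
      by (simp_all add: q_def y_def exp_add exp_double)
    have e2: "exp (2 * (x + \<i> * pi * tau)) = q\<^sup>2 * y\<^sup>2"
      by (simp only: exp_double e1 power_mult_distrib)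
    have e3: "exp (\<i> * pi * tau + 2 * x) = q * y\<^sup>2"
      by (simp only: exp_add e1) (simp add: q_def)
    note e = e1 e2 e3 exp_minus
    \<comment> \<open>The leading terms \<open>1\<close> of the two halves enter the shifted
      difference with opposite signs and equal weights, so they cancel and a pure multiplier
      remains.\<close>
    have 1: "half_theta q (y\<^sup>2) = 1 - q\<^sup>2 * y\<^sup>2 * half_theta q (q\<^sup>2 * y\<^sup>2)"
      by (rule half_theta_shift[OF q])
    have 2: "half_theta q (1 / (q\<^sup>2 * y\<^sup>2)) = 1 - 1 / y\<^sup>2 * half_theta q (1 / y\<^sup>2)"
      using half_theta_shift[OF q, of "1 / (q\<^sup>2 * y\<^sup>2)"] by (simp add: field_simps)
    show ?thesis
      unfolding eq e y_def[symmetric] inverse_eq_divide 1 2 by (simp add: field_simps power2_eq_square)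
  qed
  ultimately show ?thesis unfolding theta_fun_def by simp
qed

lemma theta_fun_holomorphic: "theta_fun N s g \<Longrightarrow> g holomorphic_on UNIV"
  by (simp add: theta_fun_def)

lemma theta_fun_mult:
  "theta_fun N s g \<Longrightarrow> theta_fun M t h \<Longrightarrow> theta_fun (N + M) (s + t) (\<lambda>x. g x * h x)"
  unfolding theta_fun_def
  by (auto intro!: holomorphic_intros simp: power_add algebra_simps exp_add[symmetric] mult_exp_exp)

lemma theta_fun_0: "theta_fun N s (\<lambda>x. 0)"
  unfolding theta_fun_def by auto

lemma theta_fun_const: "theta_fun 0 0 (\<lambda>x. c)"
  unfolding theta_fun_def by auto

lemma theta_fun_add:
  "theta_fun N s g \<Longrightarrow> theta_fun N s h \<Longrightarrow> theta_fun N s (\<lambda>x. g x + h x)"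
  unfolding theta_fun_def by (auto intro!: holomorphic_intros simp: algebra_simps)

lemma theta_fun_diff:
  "theta_fun N s g \<Longrightarrow> theta_fun N s h \<Longrightarrow> theta_fun N s (\<lambda>x. g x - h x)"
  unfolding theta_fun_def by (auto intro!: holomorphic_intros simp: algebra_simps)

lemma theta_fun_cmult: "theta_fun N s g \<Longrightarrow> theta_fun N s (\<lambda>x. c * g x)"
  unfolding theta_fun_def by (auto intro!: holomorphic_intros)

lemma theta_fun_sum:
  "(\<And>i. i \<in> A \<Longrightarrow> theta_fun N s (g i)) \<Longrightarrow> theta_fun N s (\<lambda>x. \<Sum>i\<in>A. g i x)"
  by (induction A rule: infinite_finite_induct) (auto intro: theta_fun_0 theta_fun_add)

lemma theta_fun_tf_plus:
  shows "theta_fun 1 a (\<lambda>x. tf tau (x + a))"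
proof -
  have h: "tf tau holomorphic_on UNIV" using theta_fun_tf by (simp add: theta_fun_def)
  have "tf tau (x + \<i> * pi + a) = - tf tau (x + a)" for x
    using theta_fun_tf unfolding theta_fun_def by (simp add: add.assoc add.commute[of _ a] flip: add.assoc)
  moreover have "tf tau (x + \<i> * pi * tau + a) = - exp (- (\<i> * pi * tau + 2 * (x + a))) * tf tau (x + a)" for x
  proof -
    have "x + \<i> * pi * tau + a = (x + a) + \<i> * pi * tau" by simp
    then show ?thesis using theta_fun_tf unfolding theta_fun_def by (simp only:) simp
  qed
  moreover have "(\<lambda>x. tf tau (x + a)) holomorphic_on UNIV"
    using holomorphic_on_compose_gen[OF _ h, of "\<lambda>x. x + a" UNIV] by (force simp: o_def intro!: holomorphic_intros)
  moreover have "- exp (- (\<i> * pi * tau + 2 * (x + a))) = (-1) ^ 1 * exp (- (of_nat 1 * (\<i> * pi * tau) + 2 * of_nat 1 * x + 2 * a))" for x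
    by (simp add: algebra_simps)
  ultimately show ?thesis unfolding theta_fun_def by (simp only:) simp
qed

lemma theta_fun_tf_minus:
  shows "theta_fun 1 (-a) (\<lambda>x. tf tau (a - x))"
proof -
  have "(\<lambda>x. tf tau (a - x)) = (\<lambda>x. (-1) * tf tau (x + (-a)))"
    using tf_minus[of "_ - a"] by (auto simp: fun_eq_iff)
  then show ?thesis using theta_fun_cmult[OF theta_fun_tf_plus] by metis
qed

text \<open>The translations admitting a nowhere vanishing holomorphic multiplier form a group, and
  both periods belong to it. The explicit multiplier is forgotten: transporting zeros and their
  simplicity needs no more.\<close>

lemma theta_fun_lattice_shift:
  assumes "theta_fun N s g"
  shows "\<exists>e. (\<forall>x. e x \<noteq> 0) \<and> e holomorphic_on UNIV \<and>
    (\<forall>x. g (x + of_int m * (\<i> * pi) + of_int k * (\<i> * pi * tau)) = e x * g x)"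
proof -
  let ?P = "\<lambda>w. \<exists>e. (\<forall>x. e x \<noteq> 0) \<and> e holomorphic_on UNIV \<and> (\<forall>x. g (x + w) = e x * g x)"
  have add: "?P (v + w)" if "?P v" "?P w" for v w
  proof -
    from that obtain d e where d: "\<forall>x. d x \<noteq> 0" "d holomorphic_on UNIV" "\<forall>x. g (x + v) = d x * g x"
      and e: "\<forall>x. e x \<noteq> 0" "e holomorphic_on UNIV" "\<forall>x. g (x + w) = e x * g x" by blast
    have "(\<lambda>x. e (x + v)) holomorphic_on UNIV"
      using holomorphic_on_compose_gen[OF _ e(2), of "\<lambda>x. x + v" UNIV] by (force simp: o_def intro!: holomorphic_intros)
    moreover have "g (x + (v + w)) = e (x + v) * d x * g x" for x
      using d(3) e(3) by (metis add.assoc mult.assoc)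
    ultimately show ?thesis using d(1,2) e(1)
      by (intro exI[of _ "\<lambda>x. e (x + v) * d x"] conjI holomorphic_on_mult allI) simp_all
  qed
  have neg: "?P (-w)" if "?P w" for w
  proof -
    from that obtain e where e: "\<forall>x. e x \<noteq> 0" "e holomorphic_on UNIV" "\<forall>x. g (x + w) = e x * g x" by blast
    have "(\<lambda>x. e (x - w)) holomorphic_on UNIV"
      using holomorphic_on_compose_gen[OF _ e(2), of "\<lambda>x. x - w" UNIV] by (force simp: o_def intro!: holomorphic_intros)
    moreover have "g (x - w) = inverse (e (x - w)) * g x" for x
      using e(3)[rule_format, of "x - w"] e(1)[rule_format, of "x - w"] by simp
    ultimately show ?thesis using e(1)
      by (intro exI[of _ "\<lambda>x. inverse (e (x - w))"] conjI holomorphic_on_inverse allI) simp_all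
  qed
  have nat: "?P (of_nat n * w)" if "?P w" for w n
  proof (induction n)
    case 0 show ?case by (intro exI[of _ "\<lambda>_. 1"]) simp
  next
    case (Suc n) from add[OF that Suc] show ?case by (simp add: algebra_simps)
  qed
  have int: "?P (of_int n * w)" if "?P w" for w n
  proof (cases "n \<ge> 0")
    case True then show ?thesis using nat[OF that, of "nat n"] by simp
  next
    case False then show ?thesis using neg[OF nat[OF that, of "nat (-n)"]] by simp
  qed
  have "?P (\<i> * pi)"
    using assms unfolding theta_fun_def by (intro exI[of _ "\<lambda>_. (-1) ^ N"]) auto
  moreover have "?P (\<i> * pi * tau)"
    using assms unfolding theta_fun_def
    by (intro exI[of _ "\<lambda>x. (-1) ^ N * exp (- (of_nat N * (\<i> * pi * tau) + 2 * of_nat N * x + 2 * s))"])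
       (auto intro!: holomorphic_intros)
  ultimately have "?P (of_int m * (\<i> * pi) + of_int k * (\<i> * pi * tau))"
    by (intro add int)
  then show ?thesis by (simp only: add.assoc)
qed

end

section \<open>An entire function with explicit zeros\<close>

primrec qpoch_coeff :: "complex \<Rightarrow> nat \<Rightarrow> complex" where
  "qpoch_coeff Q 0 = 1"
| "qpoch_coeff Q (Suc n) = - (Q ^ n) / (1 - Q ^ Suc n) * qpoch_coeff Q n"

text \<open>The entire function \<open>\<Prod>n. 1 - Q ^ n * y\<close>, given by Euler's power series.\<close>
definition qpoch :: "complex \<Rightarrow> complex \<Rightarrow> complex" where
  "qpoch Q y = (\<Sum>n. qpoch_coeff Q n * y ^ n)"

context
  fixes Q :: complex
  assumes Q: "norm Q < 1"
begin

lemma qpoch_power_ne_1: "1 - Q ^ Suc n \<noteq> 0"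
proof
  assume "1 - Q ^ Suc n = 0"
  then have "norm (Q ^ Suc n) = 1" by simp
  moreover have "norm (Q ^ Suc n) \<le> norm Q"
    using Q by (simp add: norm_mult norm_power mult_left_le power_le_one)
  ultimately show False using Q by simp
qed

lemma qpoch_summable: "summable (\<lambda>n. qpoch_coeff Q n * y ^ n)"
proof (rule ratio_zero_summable[where K = "1 / (1 - norm Q)" and b = "norm Q"])
  fix n
  have "norm (Q ^ Suc n) \<le> norm Q"
    using Q by (simp add: norm_mult norm_power mult_left_le power_le_one)
  then have "1 - norm Q \<le> norm (1 - Q ^ Suc n)"
    using norm_triangle_ineq2[of 1 "Q ^ Suc n"] by simp
  then have "norm Q ^ n / norm (1 - Q ^ Suc n) \<le> norm Q ^ n / (1 - norm Q)"
    using Q qpoch_power_ne_1[of n] by (intro divide_left_mono mult_pos_pos) auto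
  from mult_right_mono[OF this norm_ge_zero[of "qpoch_coeff Q n"]]
  show "norm (qpoch_coeff Q (Suc n)) \<le> 1 / (1 - norm Q) * norm Q ^ n * norm (qpoch_coeff Q n)"
    by (simp add: norm_mult norm_divide norm_power del: power_Suc)
qed (use Q in auto)

lemma qpoch_holomorphic: "qpoch Q holomorphic_on UNIV"
  unfolding qpoch_def by (intro everywhere_summable_holomorphic qpoch_summable)

lemma qpoch_0 [simp]: "qpoch Q 0 = 1"
  unfolding qpoch_def by (simp add: powser_zero)

text \<open>Compared coefficient by coefficient, this equation is precisely the recursion that
  defines \<open>qpoch_coeff\<close>.\<close>

lemma qpoch_shift: "qpoch Q y = (1 - y) * qpoch Q (Q * y)"
proof -
  let ?c = "qpoch_coeff Q"
  have rec: "?c (Suc n) = Q ^ Suc n * ?c (Suc n) - Q ^ n * ?c n" for n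
    using qpoch_power_ne_1[of n] by (simp add: field_simps del: power_Suc)
  have s: "summable (\<lambda>n. ?c n * (Q * y) ^ n)" by (rule qpoch_summable)
  have "(\<Sum>n. ?c (Suc n) * y ^ Suc n) = (\<Sum>n. ?c (Suc n) * (Q * y) ^ Suc n - y * (?c n * (Q * y) ^ n))"
    by (subst rec) (simp add: algebra_simps)
  also have "\<dots> = (\<Sum>n. ?c (Suc n) * (Q * y) ^ Suc n) - (\<Sum>n. y * (?c n * (Q * y) ^ n))"
    using s summable_Suc_iff[of "\<lambda>n. ?c n * (Q * y) ^ n"]
    by (intro suminf_diff[symmetric] summable_mult) blast+
  also have "\<dots> = (qpoch Q (Q * y) - 1) - y * qpoch Q (Q * y)"
    using suminf_split_head[OF s] suminf_mult[OF s, of y] by (simp only: qpoch_def) simp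
  also have "(\<Sum>n. ?c (Suc n) * y ^ Suc n) = qpoch Q y - 1"
    using suminf_split_head[OF qpoch_summable[of y]] by (simp only: qpoch_def) simp
  finally show ?thesis by (simp add: algebra_simps)
qed

text \<open>The functional equation passes a zero at \<open>y\<close> on to \<open>Q * y\<close>
  unless the factor \<open>1 - y\<close> vanishes. If no factor ever vanished, there would be zeros
  tending to 0, where the value is 1. No infinite product is needed.\<close>

lemma qpoch_eq_0:
  assumes "qpoch Q y = 0"
  shows "\<exists>n. Q ^ n * y = 1"
proof (rule ccontr)
  assume ne: "\<not> ?thesis"
  have zero: "qpoch Q (Q ^ n * y) = 0" for n
  proof (induction n)
    case (Suc n)
    then show ?case using qpoch_shift[of "Q ^ n * y"] ne by (auto simp: mult.assoc)
  qed (use assms in simp)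
  have "isCont (qpoch Q) 0"
    using qpoch_holomorphic holomorphic_on_imp_continuous_on continuous_on_eq_continuous_at open_UNIV by blast
  moreover have "(\<lambda>n. Q ^ n * y) \<longlonglongrightarrow> 0"
    using tendsto_mult_right[OF LIMSEQ_power_zero[OF Q], of y] by simp
  ultimately have "(\<lambda>n. qpoch Q (Q ^ n * y)) \<longlonglongrightarrow> qpoch Q 0"
    by (rule isCont_tendsto_compose)
  then show False using zero by (simp add: LIMSEQ_const_iff)
qed

end

lemma entire_eventually_nonzero:
  assumes "w holomorphic_on UNIV" "w b \<noteq> 0"
  shows "eventually (\<lambda>x. w x \<noteq> 0) (at a)"
  using non_zero_neighbour_alt[OF assms(1) open_UNIV connected_UNIV _ _ assms(2)]
  by (auto elim: eventually_mono)

text \<open>The device for dropping auxiliary genericity: an identity whose proof divides by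
  something holds near the exceptional point and passes to it by continuity.\<close>

lemma eq_if_eventually_eq:
  fixes u v :: "complex \<Rightarrow> complex"
  assumes "u holomorphic_on UNIV" "v holomorphic_on UNIV" "eventually (\<lambda>x. u x = v x) (at a)"
  shows "u a = v a"
proof -
  have "u \<midarrow>a\<rightarrow> u a" "v \<midarrow>a\<rightarrow> v a"
    using assms(1,2) holomorphic_on_imp_continuous_on continuous_on_eq_continuous_at open_UNIV isCont_def
    by blast+
  moreover from this(2) have "u \<midarrow>a\<rightarrow> v a"
    using assms(3) by (metis (mono_tags, lifting) Lim_transform_eventually eventually_mono)
  ultimately show ?thesis using LIM_unique by blast
qed

lemma holomorphic_UNIV_compose:
  assumes "g holomorphic_on UNIV" "p holomorphic_on UNIV"
  shows "(\<lambda>x. g (p x)) holomorphic_on UNIV"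
  using holomorphic_on_compose_gen[OF assms(2,1)] by (auto simp: o_def)

section \<open>Zeros, division and the interpolation principle\<close>

context upper_half
begin

definition lattice :: "complex set" where
  "lattice = {of_int m * (\<i> * pi) + of_int k * (\<i> * pi * tau) | m k. True}"

lemma zero_in_lattice: "0 \<in> lattice"
  unfolding lattice_def by (auto intro!: exI[of _ 0])

lemma theta_fun_lattice_zero:
  assumes "theta_fun N s g" "g p = 0" "w \<in> lattice"
  shows "g (p + w) = 0"
proof -
  obtain m k where w: "w = of_int m * (\<i> * pi) + of_int k * (\<i> * pi * tau)"
    using assms(3) unfolding lattice_def by blast
  obtain e where "\<And>x. g (x + w) = e x * g x"
    using theta_fun_lattice_shift[OF assms(1), of m k] unfolding w add.assoc by blast
  then show ?thesis using assms(2) by simp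
qed

lemma tf_lattice: "w \<in> lattice \<Longrightarrow> tf tau w = 0"
  using theta_fun_lattice_zero[OF theta_fun_tf tf_0] by simp

text \<open>Up to a constant this is the given theta function, but with zeros that can be read off.\<close>
definition phi :: "complex \<Rightarrow> complex" where
  "phi x = exp (-x) * qpoch (exp (2 * (\<i> * pi * tau))) (exp (2 * x))
     * qpoch (exp (2 * (\<i> * pi * tau))) (exp (2 * (\<i> * pi * tau)) * exp (- (2 * x)))"

lemma norm_nome2: "norm (exp (2 * (\<i> * pi * tau))) < 1"
  using Im_tau by simp

text \<open>With \<open>y = exp (2 * x)\<close>, the shift by \<open>\<i> * pi * tau\<close> removes
  the factor \<open>1 - y\<close> from the one product and adds \<open>1 - 1 / y\<close> to the
  other; their quotient is the monomial \<open>- 1 / y\<close>.\<close>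

lemma theta_fun_phi: "theta_fun 1 0 phi"
proof -
  define w where "w = \<i> * pi * tau"
  define Q where "Q = exp (2 * w)"
  have Q: "norm Q < 1" using norm_nome2 by (simp add: Q_def w_def)
  note eq = phi_def[folded w_def, folded Q_def]
  have [simp]: "Q \<noteq> 0" by (simp add: Q_def)
  have hol: "phi holomorphic_on UNIV"
    unfolding eq[abs_def]
    by (intro holomorphic_on_mult holomorphic_UNIV_compose[OF qpoch_holomorphic[OF Q]] holomorphic_intros)
  have 1: "phi (x + \<i> * pi) = - phi x" for x
  proof -
    have "exp (2 * (x + \<i> * pi)) = exp (2 * x)"
      by (simp add: exp_eq distrib_left)
    moreover have "exp (x + \<i> * pi) = - exp x" by (simp add: exp_add)
    ultimately show ?thesis unfolding eq exp_minus by simp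
  qed
  have 2: "phi (x + w) = - exp (- (w + 2 * x)) * phi x" for x
  proof -
    define y where "y = exp (2 * x)"
    have [simp]: "y \<noteq> 0" by (simp add: y_def)
    have e: "exp (2 * (x + w)) = Q * y" "exp (x + w) = exp x * exp w" "exp (w + 2 * x) = exp w * y"
      by (simp_all add: Q_def y_def exp_add distrib_left)
    have q1: "qpoch Q (inverse y) = (1 - inverse y) * qpoch Q (Q * inverse y)" and
      q2: "qpoch Q y = (1 - y) * qpoch Q (Q * y)"
      by (rule qpoch_shift[OF Q])+
    have "Q * inverse (Q * y) = inverse y" by simp
    then show ?thesis
      unfolding eq exp_minus e y_def[symmetric] by (simp only: q1 q2) (simp add: field_simps)
  qed
  show ?thesis unfolding theta_fun_def using hol 1 2 by (simp add: w_def)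
qed

lemma phi_eq_0:
  assumes "phi x = 0"
  shows "x \<in> lattice"
proof -
  define w where "w = \<i> * pi * tau"
  define Q where "Q = exp (2 * w)"
  have Q: "norm Q < 1" using norm_nome2 by (simp add: Q_def w_def)
  have "qpoch Q (exp (2 * x)) = 0 \<or> qpoch Q (Q * exp (- (2 * x))) = 0"
    using assms by (simp add: phi_def Q_def w_def)
  then obtain n where "Q ^ n * exp (2 * x) = 1 \<or> Q ^ n * (Q * exp (- (2 * x))) = 1"
    using qpoch_eq_0[OF Q] by blast
  then obtain k :: int where "exp (2 * (x + of_int k * w)) = 1"
  proof
    assume a: "Q ^ n * exp (2 * x) = 1"
    show ?thesis
      by (rule that[of "int n"]) (use a in \<open>simp add: Q_def exp_of_nat_mult[symmetric] mult_exp_exp algebra_simps\<close>)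
  next
    assume a: "Q ^ n * (Q * exp (- (2 * x))) = 1"
    have "exp (2 * (x + of_int (- (int n + 1)) * w)) = inverse (Q ^ n * (Q * exp (- (2 * x))))"
      by (simp add: Q_def exp_of_nat_mult[symmetric] mult_exp_exp exp_minus[symmetric] algebra_simps)
    then show ?thesis using that[of "- (int n + 1)"] a by simp
  qed
  then obtain m :: int where "Re (2 * (x + of_int k * w)) = 0" "Im (2 * (x + of_int k * w)) = of_int (2 * m) * pi"
    unfolding exp_eq_1 by blast
  then have "2 * (x + of_int k * w) = 2 * of_int m * (\<i> * pi)"
    by (simp add: complex_eq_iff)
  then have "x + of_int k * w = of_int m * (\<i> * pi)" by (simp only: mult.assoc mult_cancel_left) simp
  then have "x = of_int m * (\<i> * pi) + of_int (-k) * (\<i> * pi * tau)"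
    by (simp add: w_def algebra_simps)
  then show ?thesis unfolding lattice_def by blast
qed

lemma phi_lattice: "x \<in> lattice \<Longrightarrow> phi x = 0"
  using theta_fun_lattice_zero[OF theta_fun_phi, of 0 x] qpoch_shift[OF norm_nome2, of 1]
  by (simp add: phi_def)

lemma theta_fun_lattice_deriv:
  assumes g: "theta_fun N s g" and "g p = 0" "deriv g p \<noteq> 0" "w \<in> lattice"
  shows "deriv g (p + w) \<noteq> 0"
proof -
  obtain m k where w: "w = of_int m * (\<i> * pi) + of_int k * (\<i> * pi * tau)"
    using assms(4) unfolding lattice_def by blast
  obtain e where e: "\<And>x. e x \<noteq> 0" "e holomorphic_on UNIV" "\<And>x. g (x + w) = e x * g x"
    using theta_fun_lattice_shift[OF g, of m k] unfolding w add.assoc by blast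
  have d: "(h has_field_derivative deriv h x) (at x)" if "h holomorphic_on UNIV" for h :: "complex \<Rightarrow> complex" and x
    using holomorphic_derivI[OF that open_UNIV] by simp
  note gd = d[OF theta_fun_holomorphic[OF g]]
  have "((\<lambda>x. e x * g x) has_field_derivative (deriv e p * g p + deriv g p * e p)) (at p)"
    by (rule DERIV_mult[OF d[OF e(2)] gd])
  moreover have "((\<lambda>x. g (x + w)) has_field_derivative deriv g (p + w)) (at p)"
    using DERIV_shift gd by blast
  ultimately have "deriv g (p + w) = deriv e p * g p + deriv g p * e p"
    unfolding e(3) using DERIV_unique by blast
  then show ?thesis using assms(2,3) e(1) by simp
qed

text \<open>Splitting off the single factor \<open>1 - exp (2 * x)\<close> that vanishes at 0 shows
  a simple zero there; the lattice shift carries simplicity to the other lattice points.\<close>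

lemma deriv_phi_ne_0: "x \<in> lattice \<Longrightarrow> deriv phi x \<noteq> 0"
proof -
  define Q where "Q = exp (2 * (\<i> * pi * tau))"
  have Q: "norm Q < 1" using norm_nome2 by (simp add: Q_def)
  define r where "r x = exp (-x) * qpoch Q (Q * exp (2 * x)) * qpoch Q (Q * exp (- (2 * x)))" for x
  have r: "r holomorphic_on UNIV"
    unfolding r_def
    by (intro holomorphic_on_mult holomorphic_UNIV_compose[OF qpoch_holomorphic[OF Q]] holomorphic_intros)
  have "phi = (\<lambda>x. (1 - exp (2 * x)) * r x)"
  proof
    fix x show "phi x = (1 - exp (2 * x)) * r x"
      unfolding phi_def r_def Q_def[symmetric] by (subst qpoch_shift[OF Q, of "exp (2 * x)"]) simp
  qed
  moreover have "((\<lambda>x. (1 - exp (2 * x)) * r x) has_field_derivative (- 2 * r 0)) (at 0)"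
  proof -
    have "(r has_field_derivative deriv r 0) (at 0)"
      by (rule holomorphic_derivI[OF r open_UNIV]) simp
    then have "((\<lambda>x. (1 - exp (2 * x)) * r x) has_field_derivative
        ((0 - exp (2 * 0) * (2 * 1)) * r 0 + deriv r 0 * (1 - exp (2 * 0)))) (at 0)"
      by (intro DERIV_mult DERIV_diff DERIV_const DERIV_chain2[OF DERIV_exp] DERIV_cmult DERIV_ident)
    then show ?thesis by simp
  qed
  ultimately have "deriv phi 0 = - 2 * r 0" by (simp add: DERIV_imp_deriv)
  moreover have "r 0 \<noteq> 0"
  proof
    assume "r 0 = 0"
    then obtain n where "Q ^ n * Q = 1" using qpoch_eq_0[OF Q, of Q] by (auto simp: r_def)
    then show False using qpoch_power_ne_1[OF Q, of n] by (simp add: mult.commute)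
  qed
  moreover have "phi 0 = 0" using phi_lattice[OF zero_in_lattice] .
  ultimately show "x \<in> lattice \<Longrightarrow> deriv phi x \<noteq> 0"
    using theta_fun_lattice_deriv[OF theta_fun_phi, of 0] by simp
qed

text \<open>By quasi-periodicity a zero \<open>p\<close> repeats along the translated lattice, which
  is exactly the zero set of \<open>phi (x - p)\<close>, and those zeros are simple. So the quotient
  is entire, and comparing multipliers moves the sum parameter from \<open>s\<close> to
  \<open>s + p\<close>.\<close>

lemma theta_fun_divide:
  assumes g: "theta_fun (Suc N) s g" and p: "g p = 0"
  obtains h where "theta_fun N (s + p) h" "\<And>x. g x = h x * phi (x - p)"
proof -
  define ps where "ps x = phi (x - p)" for x
  have phol: "ps holomorphic_on UNIV"
    unfolding ps_def by (intro holomorphic_UNIV_compose[OF theta_fun_holomorphic[OF theta_fun_phi]] holomorphic_intros)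
  note ghol = theta_fun_holomorphic[OF g]
  have dps: "deriv ps x = deriv phi (x - p)" for x
  proof (rule DERIV_imp_deriv)
    have "(phi has_field_derivative deriv phi (x - p)) (at (x + - p))"
      using holomorphic_derivI[OF theta_fun_holomorphic[OF theta_fun_phi] open_UNIV] by simp
    from DERIV_shift[THEN iffD1, OF this] show "(ps has_field_derivative deriv phi (x - p)) (at x)"
      by (simp add: ps_def[abs_def])
  qed
  have zero: "g x = 0" "deriv ps x \<noteq> 0" if "ps x = 0" for x
  proof -
    have l: "x - p \<in> lattice" using that phi_eq_0 by (simp add: ps_def)
    show "g x = 0" using theta_fun_lattice_zero[OF g p l] by simp
    show "deriv ps x \<noteq> 0" using deriv_phi_ne_0[OF l] by (simp add: dps)
  qed
  have psne: "\<exists>b. ps b \<noteq> 0"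
  proof -
    have "ps p = 0" using phi_lattice[OF zero_in_lattice] by (simp add: ps_def)
    then have "deriv ps p \<noteq> 0" using zero by blast
    then show ?thesis by (metis deriv_const ext)
  qed
  then obtain b where b: "ps b \<noteq> 0" by blast
  \<comment> \<open>At a zero of the divisor the value is the quotient of derivatives, which fills
    the removable singularity.\<close>
  define h where "h x = (if ps x = 0 then deriv g x / deriv ps x else g x / ps x)" for x
  have gh: "g x = h x * ps x" for x using zero by (auto simp: h_def)
  have hhol: "h holomorphic_on UNIV"
  proof -
    have "h field_differentiable at x" for x
    proof -
      define g1 where "g1 z = (if z = x then deriv g x else (g z - g x) / (z - x))" for z
      define p1 where "p1 z = (if z = x then deriv ps x else (ps z - ps x) / (z - x))" for z
      have g1: "g1 holomorphic_on UNIV" and p1: "p1 holomorphic_on UNIV"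
        unfolding g1_def p1_def by (intro pole_lemma ghol phol; simp)+
      have ev: "eventually (\<lambda>z. ps z \<noteq> 0) (at x)"
        by (rule entire_eventually_nonzero[OF phol b])
      show ?thesis
      proof (cases "ps x = 0")
        case True
        have "eventually (\<lambda>z. h z = g1 z / p1 z) (nhds x)"
          unfolding eventually_nhds_conv_at
          using True zero[OF True]
          by (auto simp: h_def g1_def p1_def intro!: eventually_mono[OF ev])
        moreover have "(\<lambda>z. g1 z / p1 z) field_differentiable at x"
          using g1 p1 zero(2)[OF True]
          by (intro field_differentiable_divide) (auto simp: p1_def[of x] holomorphic_on_def)
        ultimately show ?thesis
          by (auto simp: field_differentiable_def DERIV_cong_ev[OF refl _ refl])
      next
        case False
        have "isCont ps x"
          using phol holomorphic_on_imp_continuous_on continuous_on_eq_continuous_at open_UNIV by blast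
        then have "eventually (\<lambda>z. ps z \<noteq> 0) (nhds x)"
          using False ev by (simp add: eventually_nhds_conv_at)
        then have "eventually (\<lambda>z. h z = g z / ps z) (nhds x)"
          by (rule eventually_mono) (simp add: h_def)
        moreover have "(\<lambda>z. g z / ps z) field_differentiable at x"
          using ghol phol False by (intro field_differentiable_divide) (auto simp: holomorphic_on_def)
        ultimately show ?thesis
          by (auto simp: field_differentiable_def DERIV_cong_ev[OF refl _ refl])
      qed
    qed
    then show ?thesis by (simp add: holomorphic_on_def)
  qed
  \<comment> \<open>The multipliers of the quotient are found after multiplying by
    \<open>ps\<close>; this permits cancelling \<open>ps\<close> even at its zeros.\<close>
  have cancel: "u = v" if "u holomorphic_on UNIV" "v holomorphic_on UNIV" "\<And>x. u x * ps x = v x * ps x" for u v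
  proof
    fix x show "u x = v x"
      by (rule eq_if_eventually_eq[OF that(1,2)])
         (use that(3) in \<open>auto intro!: eventually_mono[OF entire_eventually_nonzero[OF phol b]]\<close>)
  qed
  define w where "w = \<i> * pi * tau"
  have ps1: "ps (x + \<i> * pi) = - ps x" for x
  proof -
    have "x + \<i> * pi - p = x - p + \<i> * pi" by simp
    then show ?thesis using theta_fun_phi[unfolded theta_fun_def] by (simp only: ps_def) simp
  qed
  have ps2: "ps (x + w) = - exp (- (w + 2 * (x - p))) * ps x" for x
  proof -
    have "x + w - p = x - p + w" by simp
    then show ?thesis using theta_fun_phi[unfolded theta_fun_def, folded w_def] by (simp only: ps_def) simp
  qed
  have g1: "g (x + \<i> * pi) = (-1) ^ Suc N * g x" for x using g by (simp add: theta_fun_def)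
  have g2: "g (x + w) = (-1) ^ Suc N * exp (- (of_nat (Suc N) * w + 2 * of_nat (Suc N) * x + 2 * s)) * g x" for x
    using g unfolding theta_fun_def w_def by blast
  have h1: "(\<lambda>x. h (x + \<i> * pi)) = (\<lambda>x. (-1) ^ N * h x)"
  proof (rule cancel)
    fix x show "h (x + \<i> * pi) * ps x = (-1) ^ N * h x * ps x"
      using g1[of x] unfolding gh ps1 by simp
  qed (intro holomorphic_UNIV_compose[OF hhol] holomorphic_intros hhol)+
  have h2: "(\<lambda>x. h (x + w)) = (\<lambda>x. (-1) ^ N * exp (- (of_nat N * w + 2 * of_nat N * x + 2 * (s + p))) * h x)"
  proof (rule cancel)
    fix x
    have e: "exp (- (of_nat (Suc N) * w + 2 * of_nat (Suc N) * x + 2 * s)) =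
      exp (- (w + 2 * (x - p))) * exp (- (of_nat N * w + 2 * of_nat N * x + 2 * (s + p)))"
      by (simp add: mult_exp_exp algebra_simps)
    show "h (x + w) * ps x = (-1) ^ N * exp (- (of_nat N * w + 2 * of_nat N * x + 2 * (s + p))) * h x * ps x"
      using g2[of x] unfolding gh ps2 e by (simp add: mult.assoc)
  qed (intro holomorphic_UNIV_compose[OF hhol] holomorphic_intros hhol)+
  have "theta_fun N (s + p) h"
    unfolding theta_fun_def using hhol fun_cong[OF h1] fun_cong[OF h2, unfolded w_def] by blast
  then show ?thesis using that gh by (simp add: ps_def)
qed

text \<open>A suitable exponential factor makes the modulus doubly periodic, so by Liouville's
  theorem \<open>h\<close> is a multiple of an exponential. A nonzero exponential has these two
  multipliers only if \<open>s\<close> is a lattice point, where \<open>tf\<close> vanishes.\<close>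

lemma theta_fun_degree_0:
  assumes h: "theta_fun 0 s h" and s: "tf tau s \<noteq> 0"
  shows "h x = 0"
proof -
  define w where "w = \<i> * pi * tau"
  have rew: "Re w = - pi * Im tau" by (simp add: w_def)
  then have rew0: "Re w \<noteq> 0" using Im_tau by simp
  note hol = theta_fun_holomorphic[OF h]
  have h1: "h (x + \<i> * pi) = h x" for x using h by (simp add: theta_fun_def)
  have h2: "h (x + w) = exp (- (2 * s)) * h x" for x using h by (simp add: theta_fun_def w_def)
  \<comment> \<open>Being real, \<open>a\<close> leaves the modulus unchanged along
    \<open>\<i> * pi\<close>; its value compensates the modulus of \<open>exp (- (2 * s))\<close>
    along \<open>w\<close>.\<close>
  define a where "a = 2 * Re s / Re w"
  define k where "k x = exp (of_real a * x) * h x" for x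
  have k1: "norm (k (x + \<i> * pi)) = norm (k x)" for x
    by (simp add: k_def h1 norm_mult)
  have "a * Re w = 2 * Re s"
    using rew0 by (simp add: a_def)
  then have k2: "norm (k (x + w)) = norm (k x)" for x
    by (simp add: k_def h2 norm_mult distrib_left mult_exp_exp)
  have nat: "norm (k (x + of_nat n * v)) = norm (k x)" if "\<And>x. norm (k (x + v)) = norm (k x)" for x v n
  proof (induction n)
    case (Suc n)
    have "norm (k (x + of_nat (Suc n) * v)) = norm (k (x + of_nat n * v + v))" by (simp add: algebra_simps)
    then show ?case using that Suc by simp
  qed simp
  have int: "norm (k (x + of_int n * v)) = norm (k x)" if "\<And>x. norm (k (x + v)) = norm (k x)" for x v n
  proof (cases "n \<ge> 0")
    case True then show ?thesis using nat[OF that, of x "nat n"] by simp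
  next
    case False then show ?thesis using nat[OF that, of "x + of_int n * v" "nat (-n)"] by simp
  qed
  have khol: "k holomorphic_on UNIV" unfolding k_def by (intro holomorphic_intros hol)
  define C where "C = (\<lambda>(u, v). of_real u * (\<i> * pi) + of_real v * w) ` ({0..1} \<times> {0..1::real})"
  have "compact C" unfolding C_def
    by (intro compact_continuous_image continuous_intros compact_Times) (auto intro!: continuous_intros simp: case_prod_beta)
  then have "compact (k ` C)"
    using khol holomorphic_on_imp_continuous_on continuous_on_subset by (intro compact_continuous_image) blast+
  then obtain B where B: "\<And>x. x \<in> C \<Longrightarrow> norm (k x) \<le> B"
    using compact_imp_bounded bounded_iff by (metis imageI)
  have "norm (k x) \<le> B" for x
  proof -
    define v where "v = Re x / Re w"
    define u where "u = (Im x - v * Im w) / pi"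
    have x: "x = of_real u * (\<i> * pi) + of_real v * w"
      using rew0 by (simp add: complex_eq_iff u_def v_def)
    define y where "y = of_real (frac u) * (\<i> * pi) + of_real (frac v) * w"
    have "x = y + of_int \<lfloor>v\<rfloor> * w + of_int \<lfloor>u\<rfloor> * (\<i> * pi)"
      unfolding x y_def frac_def by (simp add: algebra_simps)
    then have "norm (k x) = norm (k y)" using int[OF k1] int[OF k2] by simp
    moreover have "y \<in> C" unfolding C_def y_def
      by (rule image_eqI[of _ _ "(frac u, frac v)"]) (auto simp: frac_ge_0 less_imp_le[OF frac_lt_1])
    ultimately show ?thesis using B by simp
  qed
  then have "bounded (range k)" by (auto simp: bounded_iff)
  from Liouville_theorem[OF khol this] obtain c where c: "\<And>x. k x = c"
    unfolding constant_on_def by blast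
  have hc: "h x = exp (- (of_real a * x)) * c" for x
    using c[of x] by (simp add: k_def exp_minus field_simps)
  show ?thesis
  proof (rule ccontr)
    assume "h x \<noteq> 0"
    then have c0: "c \<noteq> 0" using hc by auto
    \<comment> \<open>Periodicity along \<open>\<i> * pi\<close> forces \<open>a\<close> to be an
      even integer, after which the multiplier along \<open>w\<close> places \<open>s\<close> in the
      lattice.\<close>
    have "exp (- (of_real a * (\<i> * pi))) = 1"
      using h1[of 0] c0 unfolding hc by simp
    then obtain n :: int where "- (a * pi) = of_int (2 * n) * pi" by (auto simp: exp_eq_1)
    then have a: "a = of_int (- 2 * n)" by (metis mult_minus_left mult_right_cancel minus_minus pi_neq_zero of_int_minus mult_minus_left)
    have "exp (- (of_real a * w)) = exp (- (2 * s))"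
      using h2[of 0] c0 unfolding hc by simp
    then obtain m :: int where "- (of_real a * w) = - (2 * s) + of_int (2 * m) * (\<i> * pi)"
      unfolding exp_eq by (auto simp: mult_ac)
    then have "2 * s = 2 * (of_int m * (\<i> * pi) + of_int (-n) * (\<i> * pi * tau))"
      unfolding a w_def by (simp add: algebra_simps)
    then have "s = of_int m * (\<i> * pi) + of_int (-n) * (\<i> * pi * tau)"
      unfolding mult_cancel_left by simp
    then have "s \<in> lattice" unfolding lattice_def by blast
    then show False using tf_lattice s by blast
  qed
qed

text \<open>Dividing out the prescribed zeros one at a time ends in degree 0 with parameter
  \<open>s + sum_list ps\<close>. Conditions stated through \<open>tf\<close> are strong enough
  because \<open>tf\<close> vanishes on the lattice; only this inclusion is used.\<close>

lemma theta_fun_interpolation: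
  assumes "theta_fun N s g" "length ps = N" "\<forall>p\<in>set ps. g p = 0"
    "sorted_wrt (\<lambda>p q. tf tau (p - q) \<noteq> 0) ps" "tf tau (s + sum_list ps) \<noteq> 0"
  shows "g x = 0"
  using assms
proof (induction ps arbitrary: N s g x)
  case Nil
  then show ?case using theta_fun_degree_0 by auto
next
  case (Cons p ps)
  then obtain M where N: "N = Suc M" by (cases N) auto
  obtain h where h: "theta_fun M (s + p) h" "\<And>x. g x = h x * phi (x - p)"
    using theta_fun_divide[of M s g p] Cons.prems(1,3) N by auto
  have "h x = 0" for x
  proof (rule Cons.IH[OF h(1)])
    show "\<forall>q\<in>set ps. h q = 0"
    proof
      fix q assume q: "q \<in> set ps"
      have "phi (q - p) \<noteq> 0"
      proof
        assume "phi (q - p) = 0"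
        then have "tf tau (q - p) = 0" using phi_eq_0 tf_lattice by blast
        then have "tf tau (p - q) = 0" using tf_minus[of "q - p"] by simp
        then show False using Cons.prems(4) q by simp
      qed
      then show "h q = 0" using h(2)[of q] Cons.prems(3) q by simp
    qed
  qed (use Cons.prems N in \<open>auto simp: add.assoc\<close>)
  then show ?case using h(2) by simp
qed

lemma tf_holomorphic: "tf tau holomorphic_on UNIV"
  by (rule theta_fun_holomorphic[OF theta_fun_tf])


lemma theta_fun_eqI:
  "theta_fun N s h \<Longrightarrow> N = N' \<Longrightarrow> s = s' \<Longrightarrow> (\<And>x. h' x = h x) \<Longrightarrow> theta_fun N' s' h'"
  by (metis ext)

lemma theta_fun_tf_plusI: "(\<And>x. p x = x + a) \<Longrightarrow> theta_fun 1 a (\<lambda>x. tf tau (p x))"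
  using theta_fun_tf_plus by simp

lemma theta_fun_tf_minusI: "(\<And>x. p x = - a - x) \<Longrightarrow> theta_fun 1 a (\<lambda>x. tf tau (p x))"
  using theta_fun_tf_minus[of "-a"] by simp

lemma theta_fun_cmult2: "theta_fun N s h \<Longrightarrow> theta_fun N s (\<lambda>x. h x * c)"
  using theta_fun_cmult[of N s h c] by (simp add: mult.commute)

lemma theta_fun_divide_const: "theta_fun N s h \<Longrightarrow> theta_fun N s (\<lambda>x. h x / c)"
  using theta_fun_cmult2[of N s h "inverse c"] by (simp add: divide_inverse)

end

section \<open>Fay's identity\<close>

text \<open>That \<open>tf\<close> is not identically zero is assumed here and never derived from
  its series: if it were, every \<open>R\<close> would vanish, and the theorem treats that case on
  its own.\<close>

locale nonzero_theta = upper_half +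
  assumes tf_nonzero: "\<exists>b. tf tau b \<noteq> 0"
begin

lemma tf_affine_nonzero:
  assumes "a \<noteq> 0"
  shows "eventually (\<lambda>x. tf tau (a * x + c) \<noteq> 0) (at y)"
proof -
  obtain b where b: "tf tau b \<noteq> 0" using tf_nonzero by blast
  have "(\<lambda>x. tf tau (a * x + c)) holomorphic_on UNIV"
    by (intro holomorphic_UNIV_compose[OF tf_holomorphic] holomorphic_intros)
  moreover have "tf tau (a * ((b - c) / a) + c) \<noteq> 0" using b assms by simp
  ultimately show ?thesis by (rule entire_eventually_nonzero)
qed

text \<open>Fay's three-term identity, parametrised without half sums.\<close>
lemma fay:
  "tf tau (W + s + t) * tf tau (s - t) * tf tau (W + r) * tf tau r
   - tf tau (W + s + r) * tf tau (s - r) * tf tau (W + t) * tf tau t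
   + tf tau (W + s) * tf tau s * tf tau (W + t + r) * tf tau (t - r) = 0"
proof -
  define F where "F t s = tf tau (W + s + t) * tf tau (s - t) * tf tau (W + r) * tf tau r
   - tf tau (W + s + r) * tf tau (s - r) * tf tau (W + t) * tf tau t
   + tf tau (W + s) * tf tau s * tf tau (W + t + r) * tf tau (t - r)" for s t
  \<comment> \<open>In \<open>s\<close> the expression has degree 2 and sum parameter
    \<open>W\<close>, and it vanishes at \<open>t\<close> and \<open>r\<close>. The two hypotheses
    are the distinctness of these nodes and the sum condition; continuation in \<open>t\<close>
    removes them.\<close>
  have generic: "F t s = 0" if "tf tau (t - r) \<noteq> 0" "tf tau (W + t + r) \<noteq> 0" for t
  proof -
    have 1: "theta_fun 2 W (\<lambda>s. tf tau (W + s + a) * tf tau (s - a))" for a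
      by (rule theta_fun_eqI[OF theta_fun_mult[OF theta_fun_tf_plus[of "W + a"] theta_fun_tf_plus[of "- a"]]])
         (simp_all add: algebra_simps)
    have 2: "theta_fun 2 W (\<lambda>s. tf tau (W + s) * tf tau s)" using 1[of 0] by simp
    have F: "theta_fun 2 W (F t)"
      unfolding F_def by (intro theta_fun_add theta_fun_diff theta_fun_cmult2 1 2)
    have "tf tau (r - t) = - tf tau (t - r)" using tf_minus[of "t - r"] by simp
    then have "F t t = 0" "F t r = 0" by (simp_all add: F_def algebra_simps)
    then show ?thesis
      using that by (intro theta_fun_interpolation[OF F, of "[t, r]"]) (auto simp: algebra_simps)
  qed
  have "F t s = 0"
  proof (rule eq_if_eventually_eq[of "\<lambda>t. F t s" "\<lambda>_. 0"])
    show "(\<lambda>t. F t s) holomorphic_on UNIV" unfolding F_def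
      by (intro holomorphic_intros holomorphic_UNIV_compose[OF tf_holomorphic])
    show "eventually (\<lambda>t. F t s = 0) (at t)"
      using tf_affine_nonzero[OF one_neq_zero, of "-r" t] tf_affine_nonzero[OF one_neq_zero, of "W + r" t]
      by eventually_elim (rule generic, simp_all add: algebra_simps)
  qed auto
  then show ?thesis by (simp add: F_def)
qed

end

section \<open>Dynamical Yang-Baxter equation and unitarity\<close>

lemma Rmat_simps:
  "Rmat tau g x t (True, True) (True, True) = tf tau (x + g)"
  "Rmat tau g x t (False, False) (False, False) = tf tau (x + g)"
  "Rmat tau g x t (True, False) (True, False) = tf tau x * tf tau (t - g) / tf tau t"
  "Rmat tau g x t (True, False) (False, True) = tf tau (t - x) * tf tau g / tf tau t"
  "Rmat tau g x t (False, True) (True, False) = tf tau (t + x) * tf tau g / tf tau t"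
  "Rmat tau g x t (False, True) (False, True) = tf tau x * tf tau (t + g) / tf tau t"
  "Rmat tau g x t (True, True) (True, False) = 0" "Rmat tau g x t (True, True) (False, True) = 0"
  "Rmat tau g x t (True, True) (False, False) = 0" "Rmat tau g x t (False, False) (True, False) = 0"
  "Rmat tau g x t (False, False) (False, True) = 0" "Rmat tau g x t (False, False) (True, True) = 0"
  "Rmat tau g x t (True, False) (True, True) = 0" "Rmat tau g x t (True, False) (False, False) = 0"
  "Rmat tau g x t (False, True) (True, True) = 0" "Rmat tau g x t (False, True) (False, False) = 0"
  by (simp_all add: Rmat_def)

lemma hval_simps [simp]: "hval True = 1" "hval False = -1"
  by (simp_all add: hval_def)

text \<open>Matrix elements of R12(u, t - g h3) R13(u + v, t) R23(v, t - g h1). Each shift can be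
  read off an external spin because the corresponding factor leaves that leg unchanged;
  \<open>yb_right\<close> is the product in the opposite order.\<close>

definition yb_left :: "complex \<Rightarrow> complex \<Rightarrow> complex \<Rightarrow> complex \<Rightarrow> complex \<Rightarrow> bool \<Rightarrow> bool \<Rightarrow> bool \<Rightarrow> bool \<Rightarrow> bool \<Rightarrow> bool \<Rightarrow> complex" where
  "yb_left tau g u v t o1 o2 o3 i1 i2 i3 =
     (\<Sum>a1\<in>UNIV. \<Sum>a2\<in>UNIV. \<Sum>b3\<in>UNIV. Rmat tau g u (t - g * hval o3) (o1, o2) (a1, a2)
        * Rmat tau g (u + v) t (a1, o3) (i1, b3) * Rmat tau g v (t - g * hval i1) (a2, b3) (i2, i3))"

definition yb_right :: "complex \<Rightarrow> complex \<Rightarrow> complex \<Rightarrow> complex \<Rightarrow> complex \<Rightarrow> bool \<Rightarrow> bool \<Rightarrow> bool \<Rightarrow> bool \<Rightarrow> bool \<Rightarrow> bool \<Rightarrow> complex" where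
  "yb_right tau g u v t o1 o2 o3 i1 i2 i3 =
     (\<Sum>b1\<in>UNIV. \<Sum>b2\<in>UNIV. \<Sum>a3\<in>UNIV. Rmat tau g v t (o2, o3) (b2, a3)
        * Rmat tau g (u + v) (t - g * hval b2) (o1, a3) (b1, i3) * Rmat tau g u t (b1, b2) (i1, i2))"

context nonzero_theta
begin

text \<open>Turning over all spins is the same as negating the dynamical parameter, which halves the
  case analysis for the Yang-Baxter equation.\<close>

lemma Rmat_flip: "Rmat tau g x t (\<not> a, \<not> b) (\<not> c, \<not> d) = Rmat tau g x (- t) (a, b) (c, d)"
proof -
  have m: "tf tau (- t - y) = - tf tau (t + y)" "tf tau (y - t) = - tf tau (t - y)" for y
    using tf_minus[of "t + y"] tf_minus[of "t - y"] by simp_all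
  show ?thesis by (cases a; cases b; cases c; cases d) (simp_all add: Rmat_simps m)
qed

lemma sum_bool_flip: "(\<Sum>a\<in>UNIV. F (\<not> a)) = (\<Sum>a\<in>UNIV. F a :: complex)"
  by (simp add: UNIV_bool add.commute)

lemma yb_flip:
  "yb_left tau g u v t (\<not> o1) (\<not> o2) (\<not> o3) (\<not> i1) (\<not> i2) (\<not> i3) = yb_left tau g u v (- t) o1 o2 o3 i1 i2 i3"
  "yb_right tau g u v t (\<not> o1) (\<not> o2) (\<not> o3) (\<not> i1) (\<not> i2) (\<not> i3) = yb_right tau g u v (- t) o1 o2 o3 i1 i2 i3"
proof -
  have h: "t - g * hval (\<not> c) = - (- t - g * hval c)" for c by (cases c) auto
  show "yb_left tau g u v t (\<not> o1) (\<not> o2) (\<not> o3) (\<not> i1) (\<not> i2) (\<not> i3) = yb_left tau g u v (- t) o1 o2 o3 i1 i2 i3"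
    unfolding yb_left_def
    by (subst (1 2 3) sum_bool_flip[symmetric]) (simp only: Rmat_flip h minus_minus)
  show "yb_right tau g u v t (\<not> o1) (\<not> o2) (\<not> o3) (\<not> i1) (\<not> i2) (\<not> i3) = yb_right tau g u v (- t) o1 o2 o3 i1 i2 i3"
    unfolding yb_right_def
    by (subst (1 2 3) sum_bool_flip[symmetric]) (simp only: Rmat_flip h minus_minus)
qed

text \<open>Weight conservation leaves a three by three block for one down spin. Two of its entries
  agree by commuting factors; the other seven are instances of Fay's identity, the central one
  needing two of them.\<close>

lemma yang_baxter_one_minus:
  assumes t: "tf tau t \<noteq> 0" "tf tau (t - g) \<noteq> 0"
  shows "yb_left tau g u v t True True False True True False = yb_right tau g u v t True True False True True False"
    "yb_left tau g u v t True True False True False True = yb_right tau g u v t True True False True False True"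
    "yb_left tau g u v t True True False False True True = yb_right tau g u v t True True False False True True"
    "yb_left tau g u v t True False True True True False = yb_right tau g u v t True False True True True False"
    "yb_left tau g u v t True False True True False True = yb_right tau g u v t True False True True False True"
    "yb_left tau g u v t True False True False True True = yb_right tau g u v t True False True False True True"
    "yb_left tau g u v t False True True True True False = yb_right tau g u v t False True True True True False"
    "yb_left tau g u v t False True True True False True = yb_right tau g u v t False True True True False True"
    "yb_left tau g u v t False True True False True True = yb_right tau g u v t False True True False True True"
  unfolding yb_left_def yb_right_def
  subgoal using t by (simp add: UNIV_bool Rmat_simps algebra_simps)
  subgoal using t fay[of "t - g - u - 2 * v" "g + u + v" "u + v" "v"]
    by (simp add: UNIV_bool Rmat_simps divide_simps) (simp add: algebra_simps, algebra)
  subgoal using t fay[of "t - g - u - 2 * v" "g + u + v" "g + v" "v"]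
    by (simp add: UNIV_bool Rmat_simps divide_simps) (simp add: algebra_simps, algebra)
  subgoal using t fay[of "2 * g + u - t" "t + v - g" "t - g" "t - g - u"]
    by (simp add: UNIV_bool Rmat_simps divide_simps) (simp add: algebra_simps, algebra)
  subgoal using t fay[of "0" "t" "t - g" "g"] fay[of "v - u" "t + u" "t - g - v" "u"]
    by (simp add: UNIV_bool Rmat_simps divide_simps) (simp add: algebra_simps, algebra)
  subgoal using t fay[of "t - 2 * g - u - v" "g + u + v" "g + v" "g"]
    by (simp add: UNIV_bool Rmat_simps divide_simps) (simp add: algebra_simps, algebra)
  subgoal using t fay[of "v - u" "t + u - g" "g + u" "u"]
    by (simp add: UNIV_bool Rmat_simps divide_simps) (simp add: algebra_simps, algebra)
  subgoal using t fay[of "g - u" "t + u - g" "u + v" "u"]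
    by (simp add: UNIV_bool Rmat_simps divide_simps) (simp add: algebra_simps, algebra)
  subgoal using t by (simp add: UNIV_bool Rmat_simps algebra_simps)
  done

lemma yang_baxter:
  assumes t: "tf tau t \<noteq> 0" "tf tau (t - g) \<noteq> 0" "tf tau (t + g) \<noteq> 0"
  shows "yb_left tau g u v t o1 o2 o3 i1 i2 i3 = yb_right tau g u v t o1 o2 o3 i1 i2 i3"
proof -
  \<comment> \<open>The block with two down spins is the flipped one at \<open>- t\<close>, so
    \<open>t + g\<close> plays the part that \<open>t - g\<close> has for one down spin.\<close>
  have t': "tf tau (- t) \<noteq> 0" "tf tau (- t - g) \<noteq> 0"
    using t tf_minus[of "t + g"] by simp_all
  note plus = yang_baxter_one_minus[OF t(1,2)]
  note minus = yang_baxter_one_minus[OF t', folded yb_flip, simplified simp_thms not_True_eq_False not_False_eq_True]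
  have z: "yb_left tau g u v t o1 o2 o3 i1 i2 i3 = yb_right tau g u v t o1 o2 o3 i1 i2 i3"
    if "hval o1 + hval o2 + hval o3 \<noteq> hval i1 + hval i2 + hval i3 \<or> (o1 = o2 \<and> o2 = o3)"
    using that unfolding yb_left_def yb_right_def
    by (cases o1; cases o2; cases o3; cases i1; cases i2; cases i3) (simp_all add: UNIV_bool Rmat_simps)
  show ?thesis
  proof (cases "hval o1 + hval o2 + hval o3 \<noteq> hval i1 + hval i2 + hval i3 \<or> (o1 = o2 \<and> o2 = o3)")
    case False
    then show ?thesis
      by (cases o1; cases o2; cases o3; cases i1; cases i2; cases i3; simp add: plus minus)
  qed (rule z)
qed

text \<open>The diagonal entries of the middle block are Fay's identity with \<open>W = 0\<close>.
  The second factor has its legs exchanged, as in the returning half of a double row.\<close>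

lemma Rmat_unitarity:
  assumes t: "tf tau t \<noteq> 0"
  shows "(\<Sum>c\<in>UNIV. \<Sum>s\<in>UNIV. Rmat tau g x t (a, s') (c, s) * Rmat tau g (- x) t (s, c) (s'', b))
     = (if a = b \<and> s' = s'' then tf tau (g + x) * tf tau (g - x) else 0)"
proof -
  have m: "tf tau (x - t) = - tf tau (t - x)" using tf_minus[of "t - x"] by simp
  have f: "tf tau t * tf tau t * (tf tau (g + x) * tf tau (g - x)) =
      tf tau (t + x) * tf tau (t - x) * tf tau g * tf tau g - tf tau (t + g) * tf tau (t - g) * tf tau x * tf tau x"
    using fay[of 0 t g x] by (simp add: algebra_simps)
  show ?thesis
    by (cases a; cases s'; cases b; cases s''; (simp add: UNIV_bool Rmat_simps add.commute[of x g])?;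
        (insert f t, simp add: divide_simps)?; (simp add: algebra_simps)?)
qed

end

section \<open>Spin configurations and operator products\<close>

definition hsum :: "bool list \<Rightarrow> complex" where
  "hsum u = sum_list (map hval u)"

lemma hsum_simps [simp]: "hsum [] = 0" "hsum (s # u) = hval s + hsum u" "hsum (u @ v) = hsum u + hsum v"
  by (simp_all add: hsum_def)

lemma hsum_replicate: "hsum (replicate n s) = of_nat n * hval s"
  by (induction n) (simp_all add: algebra_simps)

lemma hsum_int: "\<exists>k::int. hsum u = of_int k \<and> \<bar>k\<bar> \<le> int (length u)"
proof (induction u)
  case (Cons s u)
  then obtain k :: int where "hsum u = of_int k" "\<bar>k\<bar> \<le> int (length u)" by blast
  then show ?case by (intro exI[of _ "(if s then 1 else -1) + k"]) auto
qed auto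

text \<open>The extremal weight spaces are one-dimensional. This is what collapses sums over
  intermediate configurations to a single term.\<close>

lemma hsum_eq_replicate:
  assumes "length u = n" "hsum u = of_nat n * hval s"
  shows "u = replicate n s"
proof -
  have "Re (hsum u) * Re (hval s) < real (length u) \<or> u = replicate (length u) s" for u
  proof (induction u)
    case (Cons t u)
    have "Re (hsum (replicate (length u) s)) * Re (hval s) = real (length u)"
      by (cases s) (simp_all add: hsum_replicate)
    then show ?case using Cons by (cases t; cases s) auto
  qed simp
  from this[of u] show ?thesis using assms by (cases s) auto
qed

lemma finite_cfg [simp]: "finite {z :: bool list. length z = n}"
  using finite_lists_length_eq[of "UNIV :: bool set" n] by simp

lemma sum_cfg_Suc:
  fixes F :: "bool list \<Rightarrow> complex"
  shows "(\<Sum>z\<in>{z. length z = Suc n}. F z) = (\<Sum>z\<in>{z. length z = n}. F (True # z) + F (False # z))"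
proof -
  have e: "{z. length z = Suc n} = (#) True ` {z. length z = n} \<union> (#) False ` {z. length z = n}"
    by (auto simp: length_Suc_conv image_iff)
  have "(\<Sum>z\<in>{z. length z = Suc n}. F z) = (\<Sum>z\<in>(#) True ` {z. length z = n}. F z) + (\<Sum>z\<in>(#) False ` {z. length z = n}. F z)"
    unfolding e by (intro sum.union_disjoint) auto
  also have "\<dots> = (\<Sum>z\<in>{z. length z = n}. F (True # z)) + (\<Sum>z\<in>{z. length z = n}. F (False # z))"
    by (simp add: sum.reindex inj_on_def)
  finally show ?thesis by (simp add: sum.distrib)
qed

lemma opmul_id_left: "length x = n \<Longrightarrow> opmul n opid B x y = B x y"
  unfolding opmul_def opid_def by (simp add: if_distrib[of "\<lambda>a. a * _"] sum.delta cong: if_cong)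

lemma opmul_id_right: "length y = n \<Longrightarrow> opmul n A opid x y = A x y"
  unfolding opmul_def opid_def by (simp add: if_distrib[of "\<lambda>a. _ * a"] sum.delta' cong: if_cong)

lemma opmul_assoc: "opmul n (opmul n A B) C = opmul n A (opmul n B C)"
proof (intro ext)
  fix x y
  have "opmul n (opmul n A B) C x y = (\<Sum>z\<in>{z. length z = n}. \<Sum>w\<in>{z. length z = n}. A x w * (B w z * C z y))"
    unfolding opmul_def by (simp add: sum_distrib_right mult.assoc)
  also have "\<dots> = opmul n A (opmul n B C) x y"
    unfolding opmul_def by (subst sum.swap) (simp add: sum_distrib_left)
  finally show "opmul n (opmul n A B) C x y = opmul n A (opmul n B C) x y" .
qed

lemma opprod_append: "length x = n \<Longrightarrow> opprod n (As @ Bs) x y = opmul n (opprod n As) (opprod n Bs) x y"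
proof (induction As arbitrary: x)
  case Nil then show ?case by (simp add: opmul_id_left)
next
  case (Cons A As)
  have "opprod n ((A # As) @ Bs) x y = opmul n A (opmul n (opprod n As) (opprod n Bs)) x y"
    unfolding append_Cons opprod.simps by (simp add: opmul_def[of n A] Cons.IH)
  then show ?case by (simp add: opmul_assoc)
qed

lemma Rmat_weight: "hval a + hval b \<noteq> hval c + hval d \<Longrightarrow> Rmat tau g x t (a, b) (c, d) = 0"
  by (cases a; cases b; cases c; cases d) (simp_all add: Rmat_simps)

section \<open>The double-row monodromy matrix\<close>

locale sos = nonzero_theta +
  fixes g th ze :: complex
begin

abbreviation br :: "complex \<Rightarrow> complex" where "br \<equiv> tf tau"
abbreviation R :: "complex \<Rightarrow> complex \<Rightarrow> bool \<times> bool \<Rightarrow> bool \<times> bool \<Rightarrow> complex" where "R \<equiv> Rmat tau g"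

text \<open>Matrix elements of the double-row monodromy matrix for a general diagonal \<open>K\<close>-matrix: the first
  inhomogeneity belongs to the outermost site, and \<open>a\<close>, \<open>b\<close> are the auxiliary spins.\<close>
primrec dbl :: "(complex \<Rightarrow> bool \<Rightarrow> complex) \<Rightarrow> complex list \<Rightarrow> complex \<Rightarrow> bool \<Rightarrow> bool list \<Rightarrow> bool \<Rightarrow> bool list \<Rightarrow> complex" where
  "dbl K [] l a u' b u = (if a = b \<and> u' = [] \<and> u = [] then K l a else 0)"
| "dbl K (m # ms) l a u' b u = (case u' of [] \<Rightarrow> 0 | s' # v' \<Rightarrow> (case u of [] \<Rightarrow> 0 | s # v \<Rightarrow>
     \<Sum>c\<in>UNIV. \<Sum>d\<in>UNIV. \<Sum>t\<in>UNIV. R (l - m) (th - g * hsum v') (a, s') (c, t)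
       * dbl K ms l c v' d v * R (l + m) (th - g * hsum v) (t, d) (s, b)))"

lemma dbl_length: "length u' \<noteq> length ms \<or> length u \<noteq> length ms \<Longrightarrow> dbl K ms l a u' b u = 0"
proof (induction ms arbitrary: a u' b u)
  case (Cons m ms)
  then show ?case by (cases u'; cases u) auto
qed auto

lemma dbl_weight: "hval a + hsum u' \<noteq> hval b + hsum u \<Longrightarrow> dbl K ms l a u' b u = 0"
proof (induction ms arbitrary: a u' b u)
  case (Cons m ms)
  show ?case
  proof (cases u'; cases u)
    fix s' v' s v assume e: "u' = s' # v'" "u = s # v"
    have "R (l - m) (th - g * hsum v') (a, s') (c, t) * dbl K ms l c v' d v * R (l + m) (th - g * hsum v) (t, d) (s, b) = 0" for c d t
    proof (cases "hval a + hval s' = hval c + hval t \<and> hval t + hval d = hval s + hval b")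
      case True
      have "hval c + hsum v' \<noteq> hval d + hsum v"
      proof
        assume "hval c + hsum v' = hval d + hsum v"
        with True have "hval a + (hval s' + hsum v') = hval b + (hval s + hsum v)" by algebra
        then show False using Cons.prems by (simp add: e)
      qed
      then show ?thesis using Cons.IH by simp
    qed (use Rmat_weight in auto)
    then show ?thesis unfolding e dbl.simps list.case by (simp only: sum.neutral_const)
  qed auto
qed auto

text \<open>The given boundary matrix times \<open>br (th + ze + l)\<close>, which makes all matrix
  elements entire in the spectral parameter \<open>l\<close>.\<close>

definition Kred :: "complex \<Rightarrow> bool \<Rightarrow> complex" where
  "Kred l a = (if a then br (ze + l) * br (th + ze - l) else br (ze - l) * br (th + ze + l))"

abbreviation D :: "complex list \<Rightarrow> complex \<Rightarrow> bool \<Rightarrow> bool list \<Rightarrow> bool \<Rightarrow> bool list \<Rightarrow> complex" where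
  "D \<equiv> dbl Kred"

definition B :: "complex list \<Rightarrow> complex \<Rightarrow> cop" where
  "B ms l = (\<lambda>u' u. D ms l True u' False u)"

definition P :: "complex list \<Rightarrow> complex list \<Rightarrow> cop" where
  "P ms ls = opprod (length ms) (map (B ms) ls)"

definition Z :: "complex list \<Rightarrow> complex list \<Rightarrow> complex" where
  "Z ls ms = P ms ls (replicate (length ms) False) (replicate (length ms) True)"

lemma P_Cons: "P ms (l # ls) u' u = (\<Sum>v\<in>{v. length v = length ms}. B ms l u' v * P ms ls v u)"
  by (simp add: P_def opmul_def)

lemma P_snoc:
  assumes "length u' = length ms" "length u = length ms"
  shows "P ms (ls @ [l]) u' u = (\<Sum>v\<in>{v. length v = length ms}. P ms ls u' v * B ms l v u)"
proof -
  have "P ms (ls @ [l]) u' u = opmul (length ms) (P ms ls) (opmul (length ms) (B ms l) opid) u' u"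
    using opprod_append[of u' "length ms" "map (B ms) ls" "[B ms l]" u] assms by (simp add: P_def)
  also have "\<dots> = (\<Sum>v\<in>{v. length v = length ms}. P ms ls u' v * B ms l v u)"
    using assms by (simp add: opmul_def[of _ "P ms ls"] opmul_id_right)
  finally show ?thesis .
qed

lemma B_weight: "hsum u' \<noteq> hsum u - 2 \<Longrightarrow> B ms l u' u = 0"
  unfolding B_def by (rule dbl_weight) (auto simp: algebra_simps)

lemma P_weight: "hsum u' \<noteq> hsum u - 2 * of_nat (length ls) \<Longrightarrow> P ms ls u' u = 0"
proof (induction ls arbitrary: u')
  case Nil then show ?case by (auto simp: P_def opid_def)
next
  case (Cons l ls)
  have "B ms l u' v * P ms ls v u = 0" for v
  proof (cases "hsum u' = hsum v - 2")
    case True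
    have "hsum v \<noteq> hsum u - 2 * of_nat (length ls)"
    proof
      assume "hsum v = hsum u - 2 * of_nat (length ls)"
      with True have "hsum u' = hsum u - 2 * of_nat (length (l # ls))" by (simp add: algebra_simps)
      then show False using Cons.prems by simp
    qed
    then show ?thesis using Cons.IH by simp
  qed (simp add: B_weight)
  then show ?case unfolding P_Cons by (simp only: sum.neutral_const)
qed

text \<open>The weight of at most \<open>n\<close> spins is an integer of absolute value at most
  \<open>n\<close>, so this covers every dynamical denominator \<open>br (th - g * hsum u)\<close>
  for such configurations.\<close>

definition admissible :: "nat \<Rightarrow> bool" where
  "admissible n \<longleftrightarrow> (\<forall>k::int. \<bar>k\<bar> \<le> int n \<longrightarrow> br (th + of_int k * g) \<noteq> 0)"

lemma admissible_mono: "admissible n \<Longrightarrow> m \<le> n \<Longrightarrow> admissible m"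
  unfolding admissible_def by auto

lemma admissible_hsum:
  assumes "admissible n" "length u \<le> n"
  shows "br (th - g * hsum u) \<noteq> 0"
proof -
  obtain k :: int where "hsum u = of_int k" "\<bar>k\<bar> \<le> int (length u)" using hsum_int by blast
  then show ?thesis using assms(1)[unfolded admissible_def, rule_format, of "-k"] assms(2) by (simp add: mult.commute)
qed

subsection \<open>Quasi-periodicity in the spectral parameters\<close>

text \<open>One formula serves all entries: \<open>hval a - hval c\<close> detects an exchange
  entry, \<open>hval a * hval s\<close> separates the diagonal types, and entries violating weight
  conservation are zero and fit any sum parameter.\<close>

lemma theta_fun_R_out:
  "theta_fun 1 (g * (1 + hval a * hval s) / 2 - t * (hval a - hval c) / 2 + k) (\<lambda>x. R (x + k) t (a, s) (c, d))"
proof -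
  have 1: "theta_fun 1 (g + k) (\<lambda>x. br (x + k + g))" by (rule theta_fun_tf_plusI) simp
  have 2: "theta_fun 1 k (\<lambda>x. br (x + k) * c1 / c2)" for c1 c2
    by (intro theta_fun_divide_const theta_fun_cmult2 theta_fun_tf_plusI) simp
  have 3: "theta_fun 1 (- t + k) (\<lambda>x. br (t - (x + k)) * c1 / c2)" for c1 c2
    by (intro theta_fun_divide_const theta_fun_cmult2 theta_fun_tf_minusI) simp
  have 4: "theta_fun 1 (t + k) (\<lambda>x. br (t + (x + k)) * c1 / c2)" for c1 c2
    by (intro theta_fun_divide_const theta_fun_cmult2 theta_fun_tf_plusI) simp
  show ?thesis
    using 1 2 3 4 theta_fun_0
    by (cases a; cases s; cases c; cases d) (simp_all add: Rmat_simps)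
qed

lemma theta_fun_R_in:
  "theta_fun 1 (g * (1 + hval b * hval s) / 2 - t * (hval b - hval d) / 2 + k) (\<lambda>x. R (x + k) t (c, d) (s, b))"
proof -
  have 1: "theta_fun 1 (g + k) (\<lambda>x. br (x + k + g))" by (rule theta_fun_tf_plusI) simp
  have 2: "theta_fun 1 k (\<lambda>x. br (x + k) * c1 / c2)" for c1 c2
    by (intro theta_fun_divide_const theta_fun_cmult2 theta_fun_tf_plusI) simp
  have 3: "theta_fun 1 (- t + k) (\<lambda>x. br (t - (x + k)) * c1 / c2)" for c1 c2
    by (intro theta_fun_divide_const theta_fun_cmult2 theta_fun_tf_minusI) simp
  have 4: "theta_fun 1 (t + k) (\<lambda>x. br (t + (x + k)) * c1 / c2)" for c1 c2
    by (intro theta_fun_divide_const theta_fun_cmult2 theta_fun_tf_plusI) simp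
  show ?thesis
    using 1 2 3 4 theta_fun_0
    by (cases b; cases s; cases c; cases d) (simp_all add: Rmat_simps)
qed

text \<open>The intermediate spins \<open>c\<close> and \<open>d\<close> cancel between neighbouring
  factors, so the sum parameter depends on the external spins alone and all summands lie in the same
  space of theta functions.\<close>

lemma theta_fun_D:
  "theta_fun (2 * length ms + 2)
     (g * (of_nat (length ms) + (hval a * hsum u' + hval b * hsum u) / 2) - th * (hval a + hval b) / 2)
     (\<lambda>l. D ms l a u' b u)"
proof (induction ms arbitrary: a u' b u)
  case Nil
  have 1: "theta_fun 2 (- th) (\<lambda>l. br (ze + l) * br (th + ze - l))"
    by (rule theta_fun_eqI[OF theta_fun_mult[OF theta_fun_tf_plus[of ze] theta_fun_tf_minus[of "th + ze"]]])
       (simp_all add: add.commute)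
  have 2: "theta_fun 2 th (\<lambda>l. br (ze - l) * br (th + ze + l))"
    by (rule theta_fun_eqI[OF theta_fun_mult[OF theta_fun_tf_minus[of ze] theta_fun_tf_plus[of "th + ze"]]])
       (simp_all add: add.commute add.left_commute)
  show ?case
  proof (cases "u' = [] \<and> u = []")
    case True
    then show ?thesis using 1 2 theta_fun_0
      by (cases a; cases b) (simp_all add: Kred_def numeral_2_eq_2)
  next
    case False
    then have "(\<lambda>l. D [] l a u' b u) = (\<lambda>_. 0)" by auto
    then show ?thesis by (simp only: theta_fun_0)
  qed
next
  case (Cons m ms)
  show ?case
  proof (cases u'; cases u)
    fix s' v' s v assume e: "u' = s' # v'" "u = s # v"
    let ?S = "g * (of_nat (length (m # ms)) + (hval a * hsum u' + hval b * hsum u) / 2) - th * (hval a + hval b) / 2"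
    have "theta_fun (2 * length (m # ms) + 2) ?S (\<lambda>l. R (l - m) (th - g * hsum v') (a, s') (c, t)
       * D ms l c v' d v * R (l + m) (th - g * hsum v) (t, d) (s, b))" for c d t
    proof (rule theta_fun_eqI[OF theta_fun_mult[OF theta_fun_mult[OF theta_fun_R_out[where k = "- m" and d = t] Cons.IH] theta_fun_R_in[where k = m and c = t]]])
      show "g * (1 + hval a * hval s') / 2 - (th - g * hsum v') * (hval a - hval c) / 2 + - m +
        (g * (of_nat (length ms) + (hval c * hsum v' + hval d * hsum v) / 2) - th * (hval c + hval d) / 2) +
        (g * (1 + hval b * hval s) / 2 - (th - g * hsum v) * (hval b - hval d) / 2 + m) = ?S"
        unfolding e by (simp add: field_simps)
    qed simp_all
    then show ?thesis unfolding e dbl.simps list.case by (intro theta_fun_sum)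
  qed (simp_all add: theta_fun_0)
qed

text \<open>For auxiliary spins up and down the terms in \<open>th\<close> cancel, and the weight
  drop by 2 makes the remaining parameter independent of the configurations.\<close>

lemma theta_fun_B: "theta_fun (2 * length ms + 2) (g * (of_nat (length ms) - 1)) (\<lambda>l. B ms l u' u)"
proof (cases "hsum u' = hsum u - 2")
  case True
  show ?thesis unfolding B_def
    by (rule theta_fun_eqI[OF theta_fun_D]) (simp_all add: True)
qed (simp add: B_weight theta_fun_0)

text \<open>When \<open>K\<close> is scalar and the returning \<open>R\<close> is, up to the factor
  \<open>e\<close>, the inverse direction of the outgoing one, unitarity contracts the double row
  from the inside out. Off-diagonal elements then vanish, which yields two zeros of \<open>B\<close>
  not attached to any site.\<close>

lemma D_reflection_point:
  assumes adm: "admissible (length ms)" and K: "Kred l True = Kred l False"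
    and R: "\<And>m t p q. R (l + m) t p q = e * R (- (l - m)) t p q"
  shows "\<exists>C. \<forall>a u' b u. D ms l a u' b u = (if a = b \<and> u' = u \<and> length u = length ms then C else 0)"
  using adm
proof (induction ms)
  case Nil
  have "Kred l a = Kred l True" for a using K by (cases a) auto
  then show ?case by (intro exI[of _ "Kred l True"]) auto
next
  case (Cons m ms)
  then obtain C where C: "\<And>a u' b u. D ms l a u' b u = (if a = b \<and> u' = u \<and> length u = length ms then C else 0)"
    using admissible_mono by (metis length_Cons le_add2 plus_1_eq_Suc)
  let ?C = "e * C * (br (g + (l - m)) * br (g - (l - m)))"
  have "D (m # ms) l a u' b u = (if a = b \<and> u' = u \<and> length u = length (m # ms) then ?C else 0)" for a u' b u
  proof (cases u'; cases u)
    fix s' v' s v assume uu: "u' = s' # v'" "u = s # v"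
    show ?thesis
    proof (cases "v' = v \<and> length v = length ms")
      case True
      have t: "br (th - g * hsum v) \<noteq> 0"
        by (rule admissible_hsum[OF Cons.prems]) (use True in simp)
      have "D (m # ms) l a u' b u = e * C * (\<Sum>c\<in>UNIV. \<Sum>t\<in>UNIV. R (l - m) (th - g * hsum v) (a, s') (c, t)
         * R (- (l - m)) (th - g * hsum v) (t, c) (s, b))"
        unfolding uu using True by (simp add: C R UNIV_bool algebra_simps)
      also have "\<dots> = (if a = b \<and> s' = s then ?C else 0)"
        by (subst Rmat_unitarity[OF t]) simp
      finally show ?thesis using True unfolding uu by auto
    qed (auto simp: uu C)
  qed auto
  then show ?case by blast
qed

lemma B_zero:
  assumes "admissible (length ms)"
  shows "B ms 0 u' u = 0" "B ms (\<i> * pi / 2) u' u = 0"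
proof -
  have "\<exists>C. \<forall>a u' b u. D ms 0 a u' b u = (if a = b \<and> u' = u \<and> length u = length ms then C else 0)"
    by (rule D_reflection_point[OF assms, of _ 1]) (simp_all add: Kred_def)
  then show "B ms 0 u' u = 0" by (auto simp: B_def)
  have p: "br (x + \<i> * pi) = - br x" for x
    using theta_fun_tf by (simp add: theta_fun_def)
  have K: "Kred (\<i> * pi / 2) True = Kred (\<i> * pi / 2) False"
    using p[of "ze - \<i> * pi / 2"] p[of "th + ze - \<i> * pi / 2"] by (simp add: Kred_def algebra_simps)
  \<comment> \<open>Both arguments differ by the antiperiod \<open>\<i> * pi\<close>; every entry
    contains it an odd number of times, hence the sign \<open>-1\<close>.\<close>
  have "R (\<i> * pi / 2 + m) t q r = (-1) * R (- (\<i> * pi / 2 - m)) t q r" for m t q r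
  proof -
    have e: "br (\<i> * pi / 2 + x) = - br (- (\<i> * pi / 2) + x)" for x
      using p[of "- (\<i> * pi / 2) + x"] by (simp add: algebra_simps)
    have e2: "br (x - (\<i> * pi / 2)) = - br (x + (\<i> * pi / 2))" for x
      using p[of "x - (\<i> * pi / 2)"] by (simp add: algebra_simps)
    obtain a b c d where q: "q = (a, b)" "r = (c, d)" by (cases q; cases r)
    show ?thesis unfolding q using e[of m] e[of "m + g"] e[of "t + m"] e2[of "t - m"]
      by (cases a; cases b; cases c; cases d) (simp_all add: Rmat_simps algebra_simps)
  qed
  then have "\<exists>C. \<forall>a u' b u. D ms (\<i> * pi / 2) a u' b u = (if a = b \<and> u' = u \<and> length u = length ms then C else 0)"
    by (intro D_reflection_point[OF assms K, of "-1"])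
  then show "B ms (\<i> * pi / 2) u' u = 0" by (auto simp: B_def)
qed

end

lemma sum_bool_pair: "(\<Sum>a\<in>UNIV. \<Sum>b\<in>UNIV. F a b) = (\<Sum>p\<in>(UNIV :: (bool \<times> bool) set). F (fst p) (snd p) :: complex)"
  unfolding UNIV_Times_UNIV[symmetric] sum.cartesian_product by (simp add: case_prod_beta)

lemma sum_pair: "(\<Sum>p\<in>(UNIV :: (bool \<times> bool) set). F p) = F (True, True) + F (True, False) + F (False, True) + (F (False, False) :: complex)"
  using sum_bool_pair[of "\<lambda>a b. F (a, b)"] by (simp add: UNIV_bool add_ac)

lemma regroup_sums:
  fixes A E G :: "bool \<Rightarrow> bool \<Rightarrow> complex" and B F :: "bool \<Rightarrow> bool \<Rightarrow> bool \<Rightarrow> complex"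
  shows "(\<Sum>c\<in>UNIV. \<Sum>d\<in>UNIV. \<Sum>r\<in>UNIV. A c r * (\<Sum>c'\<in>UNIV. \<Sum>d'\<in>UNIV. \<Sum>r'\<in>UNIV. B c c' r' * E c' d' * F r' d' d) * G r d)
    = (\<Sum>c'\<in>UNIV. \<Sum>d'\<in>UNIV. \<Sum>r\<in>UNIV. \<Sum>r'\<in>UNIV. (\<Sum>c\<in>UNIV. A c r * B c c' r') * E c' d' * (\<Sum>d\<in>UNIV. F r' d' d * G r d))"
proof -
  define t where "t c d r c' d' r' = A c r * (B c c' r' * E c' d' * F r' d' d) * G r d" for c d r c' d' r'
  have "(\<Sum>c\<in>UNIV. A c r * B c c' r') * E c' d' * (\<Sum>d\<in>UNIV. F r' d' d * G r d) = (\<Sum>c\<in>UNIV. \<Sum>d\<in>UNIV. t c d r c' d' r')" for r c' d' r'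
    unfolding t_def sum_distrib_left sum_distrib_right by (subst sum.swap) (simp add: mult_ac)
  moreover have "A c r * (\<Sum>c'\<in>UNIV. \<Sum>d'\<in>UNIV. \<Sum>r'\<in>UNIV. B c c' r' * E c' d' * F r' d' d) * G r d
      = (\<Sum>c'\<in>UNIV. \<Sum>d'\<in>UNIV. \<Sum>r'\<in>UNIV. t c d r c' d' r')" for c d r
    unfolding t_def sum_distrib_left sum_distrib_right ..
  ultimately show ?thesis by (simp only:) (simp add: UNIV_bool add_ac)
qed

text \<open>The operator \<open>Rm\<close> is carried past the right half, where it becomes
  \<open>Rc\<close>, across the scalar \<open>d\<close>, and past the left half. Both exchange
  relations must share the same \<open>Rc\<close>.\<close>

lemma exchange_sums:
  fixes X Y' :: "'a \<Rightarrow> complex" and Rm :: "'a \<Rightarrow> complex"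
  assumes 1: "\<And>r. (\<Sum>s\<in>A. Y r s * Rm s) = (\<Sum>q\<in>A. Rc r q * Y' q)"
    and 2: "\<And>q. (\<Sum>r\<in>A. X r * Rc r q) = (\<Sum>p\<in>A. Rp p * X' p q)"
  shows "(\<Sum>s\<in>A. (\<Sum>r\<in>A. X r * d * Y r s) * Rm s) = (\<Sum>p\<in>A. Rp p * (\<Sum>q\<in>A. X' p q * d * Y' q))"
proof -
  have "(\<Sum>s\<in>A. (\<Sum>r\<in>A. X r * d * Y r s) * Rm s) = (\<Sum>r\<in>A. X r * d * (\<Sum>s\<in>A. Y r s * Rm s))"
    unfolding sum_distrib_left sum_distrib_right by (subst sum.swap) (simp add: mult_ac)
  also have "\<dots> = (\<Sum>q\<in>A. d * Y' q * (\<Sum>r\<in>A. X r * Rc r q))"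
    unfolding 1 unfolding sum_distrib_left sum_distrib_right by (subst sum.swap) (simp add: mult_ac)
  also have "\<dots> = (\<Sum>p\<in>A. Rp p * (\<Sum>q\<in>A. X' p q * d * Y' q))"
    unfolding 2 unfolding sum_distrib_left sum_distrib_right by (subst sum.swap) (simp add: mult_ac)
  finally show ?thesis .
qed

context sos
begin

subsection \<open>Analyticity in the parameters\<close>

lemma br_holomorphic: "k holomorphic_on UNIV \<Longrightarrow> (\<lambda>x. br (k x)) holomorphic_on UNIV"
  by (rule holomorphic_UNIV_compose[OF tf_holomorphic])

lemma R_holomorphic: "k holomorphic_on UNIV \<Longrightarrow> (\<lambda>x. R (k x) t p q) holomorphic_on UNIV"
  by (cases p; cases q; case_tac a; case_tac b; case_tac aa; case_tac ba)
     (auto simp: Rmat_simps divide_inverse intro!: holomorphic_intros br_holomorphic)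

lemma D_holomorphic:
  assumes "\<And>p. p \<in> set ps \<Longrightarrow> p holomorphic_on UNIV" "l holomorphic_on UNIV"
  shows "(\<lambda>x. D (map (\<lambda>p. p x) ps) (l x) a u' b u) holomorphic_on UNIV"
  using assms(1)
proof (induction ps arbitrary: a u' b u)
  case Nil
  have "(\<lambda>x. Kred (l x) a) holomorphic_on UNIV" using assms(2)
    by (cases a) (auto simp: Kred_def intro!: holomorphic_intros br_holomorphic)
  moreover have "(\<lambda>x. D (map (\<lambda>p. p x) []) (l x) a u' b u) = (if a = b \<and> u' = [] \<and> u = [] then (\<lambda>x. Kred (l x) a) else (\<lambda>_. 0))"
    by auto
  ultimately show ?case by (simp only: split: if_split) auto
next
  case (Cons p ps)
  then show ?case using assms(2)
    by (cases u'; cases u) (auto simp: intro!: holomorphic_intros R_holomorphic)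
qed

lemma P_holomorphic:
  assumes "\<And>p. p \<in> set ps \<Longrightarrow> p holomorphic_on UNIV" "\<And>q. q \<in> set qs \<Longrightarrow> q holomorphic_on UNIV"
  shows "(\<lambda>x. P (map (\<lambda>p. p x) ps) (map (\<lambda>q. q x) qs) u' u) holomorphic_on UNIV"
  using assms(2)
proof (induction qs arbitrary: u')
  case Nil
  then show ?case by (simp add: P_def opid_def)
next
  case (Cons q qs)
  then show ?case using assms(1)
    by (auto simp: P_Cons B_def intro!: holomorphic_intros D_holomorphic)
qed

lemma Z_holomorphic:
  assumes "\<And>p. p \<in> set ps \<Longrightarrow> p holomorphic_on UNIV" "\<And>q. q \<in> set qs \<Longrightarrow> q holomorphic_on UNIV"
  shows "(\<lambda>x. Z (map (\<lambda>q. q x) qs) (map (\<lambda>p. p x) ps)) holomorphic_on UNIV"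
  unfolding Z_def length_map by (intro P_holomorphic assms)

subsection \<open>Symmetry in the inhomogeneities\<close>

text \<open>\<open>S\<close> exchanges two double-row matrices with different inhomogeneities.
  Preserving weight and acting by the same scalar \<open>c\<close> on both extremal vectors, it
  relates the two partition functions by that scalar.\<close>

definition intertwines :: "(bool list \<Rightarrow> bool list \<Rightarrow> complex) \<Rightarrow> complex \<Rightarrow> complex list \<Rightarrow> complex list \<Rightarrow> bool" where
  "intertwines S c ms ms' \<longleftrightarrow> length ms = length ms' \<and> (\<forall>u v. hsum u \<noteq> hsum v \<longrightarrow> S u v = 0)
     \<and> (\<forall>s. S (replicate (length ms) s) (replicate (length ms) s) = c)
     \<and> (\<forall>l a u' b w. length u' = length ms \<longrightarrow> length w = length ms \<longrightarrow>
          (\<Sum>v\<in>{v. length v = length ms}. D ms l a u' b v * S v w) = (\<Sum>v\<in>{v. length v = length ms}. S u' v * D ms' l a v b w))"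

definition extend_head :: "(bool list \<Rightarrow> bool list \<Rightarrow> complex) \<Rightarrow> bool list \<Rightarrow> bool list \<Rightarrow> complex" where
  "extend_head S u v = (if u \<noteq> [] \<and> v \<noteq> [] \<and> hd u = hd v then S (tl u) (tl v) else 0)"

lemma extend_head_simps [simp]: "extend_head S (s # u) (t # v) = (if s = t then S u v else 0)"
  by (simp add: extend_head_def)

text \<open>The outer site sees the inner configuration only through its weight, inside the
  dynamical argument. A weight-preserving \<open>S\<close> therefore commutes with the outer
  factors.\<close>

lemma intertwines_Cons:
  assumes "intertwines S c ms ms'"
  shows "intertwines (extend_head S) c (m # ms) (m # ms')"
proof -
  note I = assms[unfolded intertwines_def]
  let ?n = "length ms"
  have comm: "(\<Sum>v\<in>{v. length v = length (m # ms)}. D (m # ms) l a u' b v * extend_head S v w)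
      = (\<Sum>v\<in>{v. length v = length (m # ms)}. extend_head S u' v * D (m # ms') l a v b w)"
    if len: "length u' = length (m # ms)" "length w = length (m # ms)" for l a u' b w
  proof -
    obtain s' u1 t w1 where e: "u' = s' # u1" "w = t # w1" "length u1 = ?n" "length w1 = ?n"
      using len by (cases u'; cases w) auto
    have w: "S x y * F (hsum x) = S x y * F (hsum y)" for x y and F :: "complex \<Rightarrow> complex"
      using I by (cases "hsum x = hsum y") auto
    let ?R1 = "\<lambda>c r. R (l - m) (th - g * hsum u1) (a, s') (c, r)"
    let ?R2 = "\<lambda>d r. R (l + m) (th - g * hsum w1) (r, d) (t, b)"
    have "(\<Sum>v\<in>{v. length v = length (m # ms)}. D (m # ms) l a u' b v * extend_head S v w)
        = (\<Sum>v\<in>{v. length v = ?n}. D (m # ms) l a u' b (t # v) * S v w1)"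
      unfolding e list.size add_0 add_Suc_right One_nat_def Nat.add_0_right sum_cfg_Suc
      by (cases t) simp_all
    also have "\<dots> = (\<Sum>v\<in>{v. length v = ?n}. \<Sum>c\<in>UNIV. \<Sum>d\<in>UNIV. \<Sum>r\<in>UNIV. ?R1 c r * ?R2 d r * (D ms l c u1 d v * S v w1))"
    proof (rule sum.cong[OF refl])
      fix v
      have "R (l - m) (th - g * hsum u1) (a, s') (c, r) * D ms l c u1 d v * R (l + m) (th - g * hsum v) (r, d) (t, b) * S v w1
        = ?R1 c r * ?R2 d r * (D ms l c u1 d v * S v w1)" for c d r
        using w[of v w1 "\<lambda>h. R (l + m) (th - g * h) (r, d) (t, b)"] by (auto simp: mult_ac)
      then show "D (m # ms) l a u' b (t # v) * S v w1 =
          (\<Sum>c\<in>UNIV. \<Sum>d\<in>UNIV. \<Sum>r\<in>UNIV. ?R1 c r * ?R2 d r * (D ms l c u1 d v * S v w1))"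
        unfolding e dbl.simps list.case sum_distrib_right by (simp only:)
    qed
    also have "\<dots> = (\<Sum>c\<in>UNIV. \<Sum>d\<in>UNIV. \<Sum>r\<in>UNIV. ?R1 c r * ?R2 d r * (\<Sum>v\<in>{v. length v = ?n}. D ms l c u1 d v * S v w1))"
      by (subst sum.swap, rule sum.cong[OF refl], subst sum.swap, rule sum.cong[OF refl], subst sum.swap, rule sum.cong[OF refl])
         (simp add: sum_distrib_left)
    also have "\<dots> = (\<Sum>c\<in>UNIV. \<Sum>d\<in>UNIV. \<Sum>r\<in>UNIV. ?R1 c r * ?R2 d r * (\<Sum>v\<in>{v. length v = ?n}. S u1 v * D ms' l c v d w1))"
    proof -
      have "(\<Sum>v\<in>{v. length v = ?n}. D ms l c u1 d v * S v w1) = (\<Sum>v\<in>{v. length v = ?n}. S u1 v * D ms' l c v d w1)" for c d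
        using I e(3,4) by blast
      then show ?thesis by (simp only:)
    qed
    also have "\<dots> = (\<Sum>v\<in>{v. length v = ?n}. \<Sum>c\<in>UNIV. \<Sum>d\<in>UNIV. \<Sum>r\<in>UNIV. ?R1 c r * ?R2 d r * (S u1 v * D ms' l c v d w1))"
      by (rule sym, subst sum.swap, rule sum.cong[OF refl], subst sum.swap, rule sum.cong[OF refl], subst sum.swap, rule sum.cong[OF refl])
         (simp add: sum_distrib_left)
    also have "\<dots> = (\<Sum>v\<in>{v. length v = ?n}. S u1 v * D (m # ms') l a (s' # v) b w)"
    proof (rule sum.cong[OF refl])
      fix v
      have "S u1 v * (R (l - m) (th - g * hsum v) (a, s') (c, r) * D ms' l c v d w1 * R (l + m) (th - g * hsum w1) (r, d) (t, b))
        = ?R1 c r * ?R2 d r * (S u1 v * D ms' l c v d w1)" for c d r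
        using w[of u1 v "\<lambda>h. R (l - m) (th - g * h) (a, s') (c, r)"] by (auto simp: mult_ac)
      then show "(\<Sum>c\<in>UNIV. \<Sum>d\<in>UNIV. \<Sum>r\<in>UNIV. ?R1 c r * ?R2 d r * (S u1 v * D ms' l c v d w1)) = S u1 v * D (m # ms') l a (s' # v) b w"
        unfolding e dbl.simps list.case sum_distrib_left by (simp only:)
    qed
    also have "\<dots> = (\<Sum>v\<in>{v. length v = length (m # ms)}. extend_head S u' v * D (m # ms') l a v b w)"
      unfolding e(1) list.size add_0 add_Suc_right One_nat_def Nat.add_0_right sum_cfg_Suc
      by (cases s') simp_all
    finally show ?thesis .
  qed
  have wt: "extend_head S u v = 0" if "hsum u \<noteq> hsum v" for u v
    using that I by (cases u; cases v) (auto simp: extend_head_def)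
  show ?thesis unfolding intertwines_def
  proof (intro conjI allI impI)
    show "extend_head S (replicate (length (m # ms)) s) (replicate (length (m # ms)) s) = c" for s
    proof -
      have "S (replicate ?n s) (replicate ?n s) = c" using I by blast
      then show ?thesis by simp
    qed
  qed (use I in simp, fact wt, fact comm)
qed

text \<open>\<open>R\<close> composed with the permutation of the two sites, whence the order
  \<open>(t2, t1)\<close>. The spins \<open>u1\<close> further inside supply the dynamical
  shift.\<close>

definition swap_op :: "complex \<Rightarrow> bool list \<Rightarrow> bool list \<Rightarrow> complex" where
  "swap_op x u v = (case u of s1 # s2 # u1 \<Rightarrow> (case v of t1 # t2 # v1 \<Rightarrow>
      if u1 = v1 then R x (th - g * hsum u1) (s1, s2) (t2, t1) else 0 | _ \<Rightarrow> 0) | _ \<Rightarrow> 0)"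

lemma swap_op_simps [simp]:
  "swap_op x (s1 # s2 # u) (t1 # t2 # v) = (if u = v then R x (th - g * hsum u) (s1, s2) (t2, t1) else 0)"
  by (simp add: swap_op_def)

lemma D_two_sites:
  "D (m1 # m2 # ms) l a (s1' # s2' # u') b (s1 # s2 # u) =
    (\<Sum>c'\<in>UNIV. \<Sum>d'\<in>UNIV. \<Sum>r\<in>UNIV. \<Sum>r'\<in>UNIV.
      (\<Sum>c\<in>UNIV. R (l - m1) (th - g * hsum u' - g * hval s2') (a, s1') (c, r) * R (l - m2) (th - g * hsum u') (c, s2') (c', r'))
      * D ms l c' u' d' u
      * (\<Sum>d\<in>UNIV. R (l + m2) (th - g * hsum u) (r', d') (s2, d) * R (l + m1) (th - g * hsum u - g * hval s2) (r, d) (s1, b)))"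
proof -
  have e: "th - g * hsum (s # v) = th - g * hsum v - g * hval s" for s v by (simp add: algebra_simps)
  show ?thesis unfolding dbl.simps list.case e by (rule regroup_sums)
qed

lemma intertwines_swap:
  assumes adm: "admissible (length ms + 1)"
  shows "intertwines (swap_op (m1 - m2)) (br (m1 - m2 + g)) (m1 # m2 # ms) (m2 # m1 # ms)"
proof -
  let ?n = "length ms" and ?S = "swap_op (m1 - m2)"
  have comm: "(\<Sum>v\<in>{v. length v = length (m1 # m2 # ms)}. D (m1 # m2 # ms) l a u' b v * ?S v w)
      = (\<Sum>v\<in>{v. length v = length (m1 # m2 # ms)}. ?S u' v * D (m2 # m1 # ms) l a v b w)"
    if len: "length u' = length (m1 # m2 # ms)" "length w = length (m1 # m2 # ms)" for l a u' b w
  proof -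
    obtain s1' s2' u1 where u': "u' = s1' # s2' # u1" "length u1 = ?n"
      using len(1) by (auto simp: length_Suc_conv)
    obtain t1 t2 w1 where w: "w = t1 # t2 # w1" "length w1 = ?n"
      using len(2) by (auto simp: length_Suc_conv)
    let ?t' = "th - g * hsum u1" and ?t = "th - g * hsum w1"
    have nz: "br (th - g * hsum x) \<noteq> 0" "br (th - g * hsum x - g) \<noteq> 0" "br (th - g * hsum x + g) \<noteq> 0" if "length x = ?n" for x
      using admissible_hsum[OF adm, of x] admissible_hsum[OF adm, of "True # x"] admissible_hsum[OF adm, of "False # x"] that
      by (simp_all add: algebra_simps)
    let ?X = "\<lambda>c' r. \<Sum>c\<in>UNIV. R (l - m1) (?t' - g * hval s2') (a, s1') (c, fst r) * R (l - m2) ?t' (c, s2') (c', snd r)"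
    let ?Y = "\<lambda>d' r s. \<Sum>d\<in>UNIV. R (l + m2) ?t (snd r, d') (snd s, d) * R (l + m1) (?t - g * hval (snd s)) (fst r, d) (fst s, b)"
    let ?X' = "\<lambda>c' p q. \<Sum>c\<in>UNIV. R (l - m2) (?t' - g * hval (fst p)) (a, snd p) (c, snd q) * R (l - m1) ?t' (c, fst p) (c', fst q)"
    let ?Y' = "\<lambda>d' q. \<Sum>d\<in>UNIV. R (l + m1) ?t (fst q, d') (t2, d) * R (l + m2) (?t - g * hval t2) (snd q, d) (t1, b)"
    let ?Rm = "\<lambda>s. R (m1 - m2) ?t s (t2, t1)"
    let ?Rp = "\<lambda>p. R (m1 - m2) ?t' (s1', s2') p"
    let ?Rc = "\<lambda>d' r q. R (m1 - m2) (?t - g * hval d') r q"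
    have Y: "(\<Sum>s\<in>UNIV. ?Y d' r s * ?Rm s) = (\<Sum>q\<in>UNIV. ?Rc d' r q * ?Y' d' q)" for d' r
      using yang_baxter[OF nz[OF w(2)], of "m1 - m2" "l + m2" "fst r" "snd r" d' t2 t1 b]
      unfolding yb_left_def yb_right_def
      by (simp add: sum_pair UNIV_bool ring_distribs mult_ac add_ac)
    have X: "(\<Sum>r\<in>UNIV. ?X c' r * R (m1 - m2) (?t' - g * hval c') r q) = (\<Sum>p\<in>UNIV. ?Rp p * ?X' c' p q)" for c' q
      using yang_baxter[OF nz[OF u'(2)], of "l - m1" "m1 - m2" a s1' s2' c' "fst q" "snd q"]
      unfolding yb_left_def yb_right_def
      by (simp add: sum_pair UNIV_bool ring_distribs mult_ac add_ac)
    \<comment> \<open>The central element \<open>D ms l c' u1 d' w1\<close> vanishes unless weight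
      is conserved, and conservation equates the dynamical arguments left and right of it. This is
      what lets the two Yang-Baxter moves meet in the same \<open>Rc\<close>.\<close>
    have main: "(\<Sum>s\<in>UNIV. (\<Sum>r\<in>UNIV. ?X c' r * D ms l c' u1 d' w1 * ?Y d' r s) * ?Rm s)
      = (\<Sum>p\<in>UNIV. ?Rp p * (\<Sum>q\<in>UNIV. ?X' c' p q * D ms l c' u1 d' w1 * ?Y' d' q))" for c' d'
    proof (cases "hval c' + hsum u1 = hval d' + hsum w1")
      case True
      then have "g * (hval c' + hsum u1) = g * (hval d' + hsum w1)" by simp
      then have eq: "?t - g * hval d' = ?t' - g * hval c'" by (simp add: distrib_left diff_diff_eq add.commute)
      show ?thesis by (rule exchange_sums[where Rc = "?Rc d'"], rule Y, unfold eq, rule X)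
    qed (simp add: dbl_weight)
    have "(\<Sum>v\<in>{v. length v = length (m1 # m2 # ms)}. D (m1 # m2 # ms) l a u' b v * ?S v w)
        = (\<Sum>s\<in>UNIV. D (m1 # m2 # ms) l a u' b (fst s # snd s # w1) * ?Rm s)"
      using w(2) unfolding w(1) list.size add_0 add_Suc_right One_nat_def Nat.add_0_right sum_cfg_Suc sum_pair
      by (simp add: UNIV_bool sum.distrib if_distrib[of "\<lambda>x. _ * x"] sum.delta' add_ac del: dbl.simps cong: if_cong)
    also have "\<dots> = (\<Sum>c'\<in>UNIV. \<Sum>d'\<in>UNIV. \<Sum>s\<in>UNIV. (\<Sum>r\<in>UNIV. ?X c' r * D ms l c' u1 d' w1 * ?Y d' r s) * ?Rm s)"
    proof -
      have "D (m1 # m2 # ms) l a u' b (fst s # snd s # w1) = (\<Sum>c'\<in>UNIV. \<Sum>d'\<in>UNIV. \<Sum>r\<in>UNIV. ?X c' r * D ms l c' u1 d' w1 * ?Y d' r s)" for s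
        unfolding u' D_two_sites sum_pair by (rule sum.cong[OF refl], rule sum.cong[OF refl]) (simp add: UNIV_bool add_ac)
      then show ?thesis
        by (simp only: sum_distrib_right[where r = "?Rm _"]) (subst sum.swap, rule sum.cong[OF refl], rule sum.swap)
    qed
    also have "\<dots> = (\<Sum>c'\<in>UNIV. \<Sum>d'\<in>UNIV. \<Sum>p\<in>UNIV. ?Rp p * (\<Sum>q\<in>UNIV. ?X' c' p q * D ms l c' u1 d' w1 * ?Y' d' q))"
      by (simp only: main)
    also have "\<dots> = (\<Sum>p\<in>UNIV. ?Rp p * D (m2 # m1 # ms) l a (snd p # fst p # u1) b w)"
    proof -
      have "D (m2 # m1 # ms) l a (snd p # fst p # u1) b w = (\<Sum>c'\<in>UNIV. \<Sum>d'\<in>UNIV. \<Sum>q\<in>UNIV. ?X' c' p q * D ms l c' u1 d' w1 * ?Y' d' q)" for p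
        unfolding w D_two_sites sum_pair by (rule sum.cong[OF refl], rule sum.cong[OF refl]) (simp add: UNIV_bool add_ac)
      then show ?thesis
        by (simp only: sum_distrib_left[where r = "?Rp _"]) (rule sym, subst sum.swap, rule sum.cong[OF refl], rule sum.swap)
    qed
    also have "\<dots> = (\<Sum>v\<in>{v. length v = length (m1 # m2 # ms)}. ?S u' v * D (m2 # m1 # ms) l a v b w)"
      using u'(2) unfolding u'(1) list.size add_0 add_Suc_right One_nat_def Nat.add_0_right sum_cfg_Suc sum_pair
      by (simp add: UNIV_bool sum.distrib if_distrib[of "\<lambda>x. x * _"] sum.delta add_ac del: dbl.simps cong: if_cong)
    finally show ?thesis .
  qed
  have wt: "?S u v = 0" if "hsum u \<noteq> hsum v" for u v
    using that by (auto simp: swap_op_def split: list.splits intro!: Rmat_weight)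
  have norm: "?S (replicate (length (m1 # m2 # ms)) s) (replicate (length (m1 # m2 # ms)) s) = br (m1 - m2 + g)" for s
    by (cases s) (simp_all add: Rmat_simps)
  show ?thesis unfolding intertwines_def
    by (intro conjI allI impI) (simp, fact wt, fact norm, fact comm)
qed

lemma intertwines_P:
  assumes I: "intertwines S c ms ms'" and len: "length u' = length ms" "length w = length ms"
  shows "(\<Sum>v\<in>{v. length v = length ms}. P ms ls u' v * S v w) = (\<Sum>v\<in>{v. length v = length ms}. S u' v * P ms' ls v w)"
  using len(1)
proof (induction ls arbitrary: u')
  case Nil
  then show ?case using len(2)
    by (simp add: P_def opid_def if_distrib[of "\<lambda>x. x * _"] if_distrib[of "\<lambda>x. _ * x"] sum.delta sum.delta' cong: if_cong)
next
  case (Cons l ls)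
  let ?C = "{v :: bool list. length v = length ms}"
  have len': "length ms' = length ms" using I by (simp add: intertwines_def)
  have "(\<Sum>v\<in>?C. P ms (l # ls) u' v * S v w) = (\<Sum>x\<in>?C. B ms l u' x * (\<Sum>v\<in>?C. P ms ls x v * S v w))"
    unfolding P_Cons sum_distrib_left sum_distrib_right by (subst sum.swap) (simp add: mult.assoc)
  also have "\<dots> = (\<Sum>x\<in>?C. B ms l u' x * (\<Sum>v\<in>?C. S x v * P ms' ls v w))"
    by (intro sum.cong refl) (simp add: Cons.IH)
  also have "\<dots> = (\<Sum>v\<in>?C. (\<Sum>x\<in>?C. B ms l u' x * S x v) * P ms' ls v w)"
    unfolding sum_distrib_left sum_distrib_right by (subst sum.swap) (simp add: mult.assoc)
  also have "\<dots> = (\<Sum>v\<in>?C. (\<Sum>x\<in>?C. S u' x * B ms' l x v) * P ms' ls v w)"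
  proof -
    have "(\<Sum>x\<in>?C. B ms l u' x * S x v) = (\<Sum>x\<in>?C. S u' x * B ms' l x v)" if "v \<in> ?C" for v
      using I Cons.prems that unfolding intertwines_def B_def by blast
    then show ?thesis by (intro sum.cong refl) simp
  qed
  also have "\<dots> = (\<Sum>v\<in>?C. S u' v * P ms' (l # ls) v w)"
    unfolding P_Cons len' sum_distrib_left sum_distrib_right by (subst sum.swap) (simp add: mult.assoc)
  finally show ?case .
qed

lemma intertwines_Z:
  assumes "intertwines S c ms ms'"
  shows "c * Z ls ms = c * Z ls ms'"
proof -
  let ?n = "length ms"
  have len': "length ms' = ?n" using assms by (simp add: intertwines_def)
  have c: "S (replicate ?n s) (replicate ?n s) = c" for s using assms unfolding intertwines_def by blast
  have S: "S u v = 0" if "hsum u \<noteq> hsum v" for u v using assms that unfolding intertwines_def by blast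
  let ?C = "{v :: bool list. length v = ?n}"
  have 1: "S v (replicate ?n True) = (if v = replicate ?n True then c else 0)" if "v \<in> ?C" for v
  proof (cases "v = replicate ?n True")
    case False
    then have "hsum v \<noteq> hsum (replicate ?n True)" using hsum_eq_replicate[of v ?n True] that by (auto simp: hsum_replicate)
    then show ?thesis using S[of v "replicate ?n True"] False by auto
  qed (simp add: c)
  have 2: "S (replicate ?n False) v = (if v = replicate ?n False then c else 0)" if "v \<in> ?C" for v
  proof (cases "v = replicate ?n False")
    case False
    then have "hsum v \<noteq> hsum (replicate ?n False)" using hsum_eq_replicate[of v ?n False] that by (auto simp: hsum_replicate)
    then show ?thesis using S[of "replicate ?n False" v] False by auto
  qed (simp add: c)
  have "(\<Sum>v\<in>?C. P ms ls (replicate ?n False) v * S v (replicate ?n True)) = c * Z ls ms"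
  proof -
    have "(\<Sum>v\<in>?C. P ms ls (replicate ?n False) v * S v (replicate ?n True))
        = (\<Sum>v\<in>?C. if v = replicate ?n True then P ms ls (replicate ?n False) v * c else 0)"
      by (intro sum.cong refl) (simp only: 1 split: if_split, simp)
    then show ?thesis by (simp add: Z_def sum.delta mult.commute)
  qed
  moreover have "(\<Sum>v\<in>?C. S (replicate ?n False) v * P ms' ls v (replicate ?n True)) = c * Z ls ms'"
  proof -
    have "(\<Sum>v\<in>?C. S (replicate ?n False) v * P ms' ls v (replicate ?n True))
        = (\<Sum>v\<in>?C. if v = replicate ?n False then c * P ms' ls v (replicate ?n True) else 0)"
      by (intro sum.cong refl) (simp only: 2 split: if_split, simp)
    then show ?thesis by (simp add: Z_def len' sum.delta)
  qed
  ultimately show ?thesis using intertwines_P[OF assms, of "replicate ?n False" "replicate ?n True" ls] by auto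
qed

lemma Z_swap_sites:
  assumes adm: "admissible (length xs + length ys + 2)"
  shows "Z ls (xs @ m1 # m2 # ys) = Z ls (xs @ m2 # m1 # ys)"
proof -
  have "\<exists>S. intertwines S (br (x - m2 + g)) (xs @ x # m2 # ys) (xs @ m2 # x # ys)" for x
  proof (induction xs)
    case Nil
    show ?case using intertwines_swap[of ys x m2] admissible_mono[OF adm] by auto
  next
    case (Cons m xs)
    then show ?case using intertwines_Cons by fastforce
  qed
  then have eq: "Z ls (xs @ x # m2 # ys) = Z ls (xs @ m2 # x # ys)" if "br (x - m2 + g) \<noteq> 0" for x
    using that intertwines_Z by (metis mult_left_cancel)
  have hol1: "(\<lambda>x. Z ls (xs @ x # m2 # ys)) holomorphic_on UNIV"
    using Z_holomorphic[of "map (\<lambda>m _. m) xs @ (\<lambda>x. x) # (\<lambda>_. m2) # map (\<lambda>m _. m) ys" "map (\<lambda>m _. m) ls"]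
    by (simp add: o_def) (fastforce intro: holomorphic_intros)
  have hol2: "(\<lambda>x. Z ls (xs @ m2 # x # ys)) holomorphic_on UNIV"
    using Z_holomorphic[of "map (\<lambda>m _. m) xs @ (\<lambda>_. m2) # (\<lambda>x. x) # map (\<lambda>m _. m) ys" "map (\<lambda>m _. m) ls"]
    by (simp add: o_def) (fastforce intro: holomorphic_intros)
  \<comment> \<open>The common scalar \<open>br (x - m2 + g)\<close> can be cancelled only where it
    is nonzero; the exceptional \<open>m1\<close> are reached by continuation in
    \<open>x\<close>.\<close>
  have "eventually (\<lambda>x. Z ls (xs @ x # m2 # ys) = Z ls (xs @ m2 # x # ys)) (at m1)"
    using tf_affine_nonzero[OF one_neq_zero, of "- m2 + g" m1] by eventually_elim (rule eq, simp add: algebra_simps)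
  then show ?thesis by (rule eq_if_eventually_eq[OF hol1 hol2])
qed

lemma Z_site_to_front:
  assumes "admissible (length xs + length ys + 2)"
  shows "Z ls (xs @ m # ys) = Z ls (m # xs @ ys)"
  using assms
proof (induction xs arbitrary: ys rule: rev_induct)
  case (snoc x xs)
  have "Z ls ((xs @ [x]) @ m # ys) = Z ls (xs @ m # x # ys)"
    using Z_swap_sites[of xs ys ls x m] admissible_mono[OF snoc.prems] by simp
  also have "\<dots> = Z ls (m # xs @ x # ys)"
    by (rule snoc.IH) (use snoc.prems in simp)
  finally show ?case by simp
qed simp


subsection \<open>The outermost site\<close>

definition shift_ratio :: "complex \<Rightarrow> complex" where
  "shift_ratio h = br (th - g * h - g) / br (th - g * h)"

text \<open>Every row lowers the inner weight by 2, so \<open>n\<close> successive rows meet the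
  ratios at \<open>h\<close>, \<open>h - 2\<close>, and so on.\<close>

primrec shift_prod :: "complex \<Rightarrow> nat \<Rightarrow> complex" where
  "shift_prod h 0 = 1"
| "shift_prod h (Suc n) = shift_ratio (h - 2 * of_nat n) * shift_prod h n"

text \<open>The outer spin can flip on the returning or on the outgoing passage of the auxiliary
  line; the two summands are these events, weighted by the inner diagonal elements \<open>x\<close>
  and \<open>y\<close>.\<close>

definition flip_weight :: "complex \<Rightarrow> complex \<Rightarrow> complex \<Rightarrow> complex \<Rightarrow> complex \<Rightarrow> complex" where
  "flip_weight l m t x y = br (t + l + m) * br (l - m) * x + br (l + m) * br (t - l + m) * y"

lemma B_outer_plus: "B (m # ms) l (True # v') (True # v) = br (l - m + g) * br (l + m) * shift_ratio (hsum v) * B ms l v' v"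
  by (simp add: B_def UNIV_bool Rmat_simps shift_ratio_def)

lemma B_outer_minus: "B (m # ms) l (False # v') (False # v) = br (l + m + g) * br (l - m) * shift_ratio (hsum v') * B ms l v' v"
  by (simp add: B_def UNIV_bool Rmat_simps shift_ratio_def)

text \<open>On the output side the pair of up spins forces the intermediate outer spin up; on the
  input side the pair of down spins forces it down.\<close>

lemma B_outer_raise: "B (m # ms) l (True # v') (False # v) = 0"
  by (simp add: B_def UNIV_bool Rmat_simps)

lemma B_outer_lower:
  "B (m # ms) l (False # v') (True # v) = br g * shift_ratio (hsum v) / br (th - g * hsum v)
     * flip_weight l m (th - g * hsum v) (D ms l True v' True v) (D ms l False v' False v)"
proof (cases "hsum v' = hsum v")
  case True
  then show ?thesis
    by (simp add: B_def UNIV_bool Rmat_simps shift_ratio_def flip_weight_def ring_distribs diff_diff_eq2 add.assoc)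
       (simp add: divide_inverse algebra_simps)
next
  case False
  then have "D ms l a v' a v = 0" for a by (intro dbl_weight) simp
  then show ?thesis by (simp add: B_def UNIV_bool Rmat_simps flip_weight_def)
qed

lemma P_outer_plus:
  "length v' = length ms \<Longrightarrow> length v = length ms \<Longrightarrow>
   P (m # ms) ls (True # v') (True # v) = (\<Prod>l\<leftarrow>ls. br (l - m + g) * br (l + m)) * shift_prod (hsum v) (length ls) * P ms ls v' v"
proof (induction ls arbitrary: v')
  case Nil
  show ?case by (simp add: P_def opid_def)
next
  case (Cons l ls)
  let ?c = "(\<Prod>l\<leftarrow>ls. br (l - m + g) * br (l + m))"
  have "P (m # ms) (l # ls) (True # v') (True # v) = (\<Sum>z\<in>{z. length z = length ms}.
      br (l - m + g) * br (l + m) * shift_ratio (hsum z) * B ms l v' z * (?c * shift_prod (hsum v) (length ls) * P ms ls z v))"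
    using Cons by (simp add: P_Cons sum_cfg_Suc B_outer_plus B_outer_raise)
  also have "\<dots> = (\<Sum>z\<in>{z. length z = length ms}.
      br (l - m + g) * br (l + m) * ?c * shift_prod (hsum v) (length (l # ls)) * (B ms l v' z * P ms ls z v))"
  proof (intro sum.cong refl)
    fix z
    show "br (l - m + g) * br (l + m) * shift_ratio (hsum z) * B ms l v' z * (?c * shift_prod (hsum v) (length ls) * P ms ls z v)
      = br (l - m + g) * br (l + m) * ?c * shift_prod (hsum v) (length (l # ls)) * (B ms l v' z * P ms ls z v)"
    proof (cases "hsum z = hsum v - 2 * of_nat (length ls)")
      case True then show ?thesis by simp
    qed (simp add: P_weight)
  qed
  finally show ?case by (simp add: P_Cons sum_distrib_left)
qed

lemma P_outer_raise:
  "P (m # ms) ls (True # v') (False # v) = 0"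
proof (induction ls arbitrary: v')
  case Nil
  show ?case by (simp add: P_def opid_def)
next
  case (Cons l ls)
  then show ?case by (simp add: P_Cons sum_cfg_Suc B_outer_raise)
qed

lemma P_outer_minus:
  "length v' = length ms \<Longrightarrow> length v = length ms \<Longrightarrow>
   P (m # ms) ls (False # v') (False # v) = (\<Prod>l\<leftarrow>ls. br (l + m + g) * br (l - m)) * shift_prod (hsum v - 2) (length ls) * P ms ls v' v"
proof (induction ls arbitrary: v')
  case Nil
  show ?case by (simp add: P_def opid_def)
next
  case (Cons l ls)
  let ?c = "(\<Prod>l\<leftarrow>ls. br (l + m + g) * br (l - m))"
  have "P (m # ms) (l # ls) (False # v') (False # v) = (\<Sum>z\<in>{z. length z = length ms}.
      br (l + m + g) * br (l - m) * shift_ratio (hsum v') * B ms l v' z * (?c * shift_prod (hsum v - 2) (length ls) * P ms ls z v))"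
    using Cons by (simp add: P_Cons sum_cfg_Suc B_outer_minus P_outer_raise)
  also have "\<dots> = (\<Sum>z\<in>{z. length z = length ms}.
      br (l + m + g) * br (l - m) * ?c * shift_prod (hsum v - 2) (length (l # ls)) * (B ms l v' z * P ms ls z v))"
  proof (intro sum.cong refl)
    fix z
    show "br (l + m + g) * br (l - m) * shift_ratio (hsum v') * B ms l v' z * (?c * shift_prod (hsum v - 2) (length ls) * P ms ls z v)
      = br (l + m + g) * br (l - m) * ?c * shift_prod (hsum v - 2) (length (l # ls)) * (B ms l v' z * P ms ls z v)"
    proof (cases "P ms ls z v = 0 \<or> B ms l v' z = 0")
      case False
      then have "hsum z = hsum v - 2 * of_nat (length ls)" "hsum v' = hsum z - 2"
        using P_weight B_weight by blast+
      then have "hsum v' = hsum v - 2 - 2 * of_nat (length ls)" by simp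
      then show ?thesis by simp
    qed auto
  qed
  finally show ?case by (simp add: P_Cons sum_distrib_left)
qed

text \<open>Either the leading row flips the outer spin, and the rest act with that spin up, or it
  does not and induction applies. The rows that keep the spin contribute scalar products of degree 2
  each.\<close>

lemma theta_fun_P_outer:
  assumes "length v = length ms"
  shows "length v' = length ms \<Longrightarrow> theta_fun (2 * length ls) (th + g * (of_nat (length ls) - 1) - g * hsum v) (\<lambda>m. P (m # ms) ls (False # v') (True # v))"
proof (induction ls arbitrary: v')
  case Nil
  show ?case by (simp add: P_def opid_def theta_fun_0)
next
  case (Cons l ls)
  let ?n = "length ls"
  let ?S = "th + g * (of_nat (length (l # ls)) - 1) - g * hsum v"
  have p1: "theta_fun 2 g (\<lambda>m. br (l + m + g) * br (l - m))" for l
    by (rule theta_fun_eqI[OF theta_fun_mult[OF theta_fun_tf_plus[of "l + g"] theta_fun_tf_minus[of l]]]) (simp_all add: algebra_simps)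
  have p2: "theta_fun 2 (- g) (\<lambda>m. br (l - m + g) * br (l + m))" for l
    by (rule theta_fun_eqI[OF theta_fun_mult[OF theta_fun_tf_minus[of "l + g"] theta_fun_tf_plus[of l]]]) (simp_all add: algebra_simps)
  have p3: "theta_fun 2 t (\<lambda>m. flip_weight l m t x y)" for t x y
    unfolding flip_weight_def
  proof (intro theta_fun_add theta_fun_cmult2)
    show "theta_fun 2 t (\<lambda>m. br (t + l + m) * br (l - m))"
      by (rule theta_fun_eqI[OF theta_fun_mult[OF theta_fun_tf_plus[of "t + l"] theta_fun_tf_minus[of l]]]) (simp_all add: algebra_simps)
    show "theta_fun 2 t (\<lambda>m. br (l + m) * br (t - l + m))"
      by (rule theta_fun_eqI[OF theta_fun_mult[OF theta_fun_tf_plus[of l] theta_fun_tf_plus[of "t - l"]]]) (simp_all add: algebra_simps)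
  qed
  have pp: "theta_fun (2 * length xs) (- g * of_nat (length xs)) (\<lambda>m. \<Prod>l\<leftarrow>xs. br (l - m + g) * br (l + m))" for xs
  proof (induction xs)
    case Nil show ?case by (simp add: theta_fun_const)
  next
    case (Cons x xs)
    show ?case by (rule theta_fun_eqI[OF theta_fun_mult[OF p2[of x] Cons]]) (simp_all add: algebra_simps)
  qed
  have "(\<lambda>m. P (m # ms) (l # ls) (False # v') (True # v)) = (\<lambda>m. \<Sum>z\<in>{z. length z = length ms}.
      B (m # ms) l (False # v') (True # z) * P (m # ms) ls (True # z) (True # v)
      + B (m # ms) l (False # v') (False # z) * P (m # ms) ls (False # z) (True # v))"
    by (simp add: P_Cons sum_cfg_Suc)
  moreover have "theta_fun (2 * length (l # ls)) ?S (\<lambda>m. B (m # ms) l (False # v') (True # z) * P (m # ms) ls (True # z) (True # v))"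
    if z: "length z = length ms" for z
  \<comment> \<open>The flip contributes the configuration-dependent parameter
    \<open>th - g * hsum z\<close>; weight conservation in the remaining rows fixes
    \<open>hsum z\<close>, so every surviving term has the same sum parameter.\<close>
  proof (cases "hsum z = hsum v - 2 * of_nat ?n")
    case True
    let ?t = "th - g * hsum z"
    have "theta_fun (2 + 2 * ?n) (?t + - g * of_nat ?n) (\<lambda>m. (br g * shift_ratio (hsum z) / br ?t
        * flip_weight l m ?t (D ms l True v' True z) (D ms l False v' False z))
        * ((\<Prod>l\<leftarrow>ls. br (l - m + g) * br (l + m)) * shift_prod (hsum v) ?n * P ms ls z v))"
      by (intro theta_fun_mult theta_fun_cmult theta_fun_cmult2 p3 pp)
    then show ?thesis unfolding B_outer_lower P_outer_plus[OF z assms]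
      by (rule theta_fun_eqI) (simp_all add: True algebra_simps)
  next
    case False
    then show ?thesis unfolding P_outer_plus[OF z assms] by (simp add: P_weight theta_fun_0)
  qed
  moreover have "theta_fun (2 * length (l # ls)) ?S (\<lambda>m. B (m # ms) l (False # v') (False # z) * P (m # ms) ls (False # z) (True # v))"
    if z: "length z = length ms" for z
    unfolding B_outer_minus
    by (rule theta_fun_eqI[OF theta_fun_mult[OF theta_fun_cmult2[OF theta_fun_cmult2[OF p1[of l], of "shift_ratio (hsum v')"], of "B ms l v' z"] Cons.IH[OF z]]])
       (simp_all add: algebra_simps)
  ultimately show ?case by (auto intro!: theta_fun_sum theta_fun_add)
qed

lemma theta_fun_Z_site:
  assumes "length ls = Suc (length ms)"
  shows "theta_fun (2 * length ls) th (\<lambda>m. Z ls (m # ms))"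
  unfolding Z_def
  by (rule theta_fun_eqI[OF theta_fun_P_outer[of "replicate (length ms) True" ms "replicate (length ms) False" ls]])
     (simp_all add: assms hsum_replicate)

lemma D_diag_weight:
  assumes "length u = n" "u \<noteq> replicate n s"
  shows "D ms l a (replicate n s) a u = 0" "D ms l a u a (replicate n s) = 0"
proof -
  have "hsum u \<noteq> hsum (replicate n s)"
    using hsum_eq_replicate[OF assms(1), of s] assms(2) by (auto simp: hsum_replicate)
  then show "D ms l a (replicate n s) a u = 0" "D ms l a u a (replicate n s) = 0"
    by (auto intro!: dbl_weight)
qed

text \<open>At such \<open>l\<close> the amplitude for an outer spin that is already down in the top
  row vanishes. The flip must happen in that row, the rows below act on the outer site as scalars,
  and extremal weight fixes the intermediate configuration.\<close>

lemma Z_reduce_top: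
  assumes len: "length ls = length ms" and l: "br (l - m) = 0 \<or> br (l + m + g) = 0"
  shows "Z (l # ls) (m # ms) =
    br g * shift_ratio (- of_nat (length ms)) / br (th + g * of_nat (length ms))
    * flip_weight l m (th + g * of_nat (length ms)) (D ms l True (replicate (length ms) False) True (replicate (length ms) False))
        (D ms l False (replicate (length ms) False) False (replicate (length ms) False))
    * ((\<Prod>x\<leftarrow>ls. br (x - m + g) * br (x + m)) * shift_prod (of_nat (length ms)) (length ms) * Z ls ms)"
proof -
  let ?n = "length ms" and ?F = "replicate (length ms) False" and ?T = "replicate (length ms) True"
  have "Z (l # ls) (m # ms) = (\<Sum>z\<in>{z. length z = ?n}. B (m # ms) l (False # ?F) (True # z) * P (m # ms) ls (True # z) (True # ?T)
       + B (m # ms) l (False # ?F) (False # z) * P (m # ms) ls (False # z) (True # ?T))"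
    by (simp add: Z_def P_Cons sum_cfg_Suc)
  also have "\<dots> = (\<Sum>z\<in>{z. length z = ?n}. if z = ?F then B (m # ms) l (False # ?F) (True # z) * P (m # ms) ls (True # z) (True # ?T) else 0)"
  proof (intro sum.cong refl)
    fix z :: "bool list" assume z: "z \<in> {z. length z = ?n}"
    have "B (m # ms) l (False # ?F) (False # z) = 0" using l by (auto simp: B_outer_minus)
    moreover have "B (m # ms) l (False # ?F) (True # z) = 0" if "z \<noteq> ?F"
      using that z by (simp add: B_outer_lower flip_weight_def D_diag_weight)
    ultimately show "B (m # ms) l (False # ?F) (True # z) * P (m # ms) ls (True # z) (True # ?T)
       + B (m # ms) l (False # ?F) (False # z) * P (m # ms) ls (False # z) (True # ?T)
       = (if z = ?F then B (m # ms) l (False # ?F) (True # z) * P (m # ms) ls (True # z) (True # ?T) else 0)"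
      by auto
  qed
  also have "\<dots> = B (m # ms) l (False # ?F) (True # ?F) * P (m # ms) ls (True # ?F) (True # ?T)"
    by (simp add: sum.delta)
  finally show ?thesis
    by (simp add: B_outer_lower P_outer_plus hsum_replicate len Z_def)
qed

text \<open>The mirror image: here the amplitude for an outer spin that stays up in the bottom row
  vanishes, so the bottom row performs the flip. The values of \<open>l\<close> differ from those
  for the top row.\<close>

lemma Z_reduce_bottom:
  assumes len: "length ls = length ms" and l: "br (l + m) = 0 \<or> br (l - m + g) = 0"
  shows "Z (ls @ [l]) (m # ms) =
    br g * shift_ratio (of_nat (length ms)) / br (th - g * of_nat (length ms))
    * flip_weight l m (th - g * of_nat (length ms)) (D ms l True (replicate (length ms) True) True (replicate (length ms) True))
        (D ms l False (replicate (length ms) True) False (replicate (length ms) True))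
    * ((\<Prod>x\<leftarrow>ls. br (x + m + g) * br (x - m)) * shift_prod (of_nat (length ms) - 2) (length ms) * Z ls ms)"
proof -
  let ?n = "length ms" and ?F = "replicate (length ms) False" and ?T = "replicate (length ms) True"
  have "Z (ls @ [l]) (m # ms) = (\<Sum>z\<in>{z. length z = ?n}. P (m # ms) ls (False # ?F) (True # z) * B (m # ms) l (True # z) (True # ?T)
       + P (m # ms) ls (False # ?F) (False # z) * B (m # ms) l (False # z) (True # ?T))"
    by (simp add: Z_def P_snoc sum_cfg_Suc)
  also have "\<dots> = (\<Sum>z\<in>{z. length z = ?n}. if z = ?T then P (m # ms) ls (False # ?F) (False # z) * B (m # ms) l (False # z) (True # ?T) else 0)"
  proof (intro sum.cong refl)
    fix z :: "bool list" assume z: "z \<in> {z. length z = ?n}"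
    have "B (m # ms) l (True # z) (True # ?T) = 0" using l by (auto simp: B_outer_plus)
    moreover have "B (m # ms) l (False # z) (True # ?T) = 0" if "z \<noteq> ?T"
      using that z by (simp add: B_outer_lower flip_weight_def D_diag_weight)
    ultimately show "P (m # ms) ls (False # ?F) (True # z) * B (m # ms) l (True # z) (True # ?T)
       + P (m # ms) ls (False # ?F) (False # z) * B (m # ms) l (False # z) (True # ?T)
       = (if z = ?T then P (m # ms) ls (False # ?F) (False # z) * B (m # ms) l (False # z) (True # ?T) else 0)"
      by auto
  qed
  also have "\<dots> = P (m # ms) ls (False # ?F) (False # ?T) * B (m # ms) l (False # ?T) (True # ?T)"
    by (simp add: sum.delta)
  finally show ?thesis
    by (simp add: B_outer_lower P_outer_minus hsum_replicate len Z_def mult_ac)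
qed

lemma D_all_equal:
  "D ms l s (replicate (length ms) s) s (replicate (length ms) s) = Kred l s * (\<Prod>m\<leftarrow>ms. br (l + m + g) * br (l - m + g))"
proof (induction ms)
  case (Cons m ms)
  then show ?case by (cases s) (simp_all add: UNIV_bool Rmat_simps)
qed simp

text \<open>An instance of Fay's identity that separates the dependence on \<open>l\<close> from
  that on \<open>m\<close>. It is the origin of the zeros at \<open>m = ze\<close> and
  \<open>m = - th - ze\<close>.\<close>

lemma reflection_identity:
  "br (t + l + m) * br (l - m) * (br (z + l) * br (t + z - l)) + br (l + m) * br (t - l + m) * (br (z - l) * br (t + z + l))
    = br t * br (2 * l) * br (z - m) * br (t + z + m)"
  using fay[of "z - 2 * l - m" "l + m + t" "2 * l" "l + m"] by (simp add: algebra_simps)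

text \<open>At \<open>m = - l - g\<close> both diagonal elements contribute to the spin flip, but this combination factorises.\<close>
lemma flip_weight_reflected:
  assumes "admissible (length ms)"
  shows "flip_weight l (- l - g) (th + g * of_nat (length ms)) (D ms l True (replicate (length ms) False) True (replicate (length ms) False))
        (D ms l False (replicate (length ms) False) False (replicate (length ms) False))
     = br (th + g * of_nat (length ms)) * br (2 * l) * br (ze + l + g) * br (th + ze - l - g) * (\<Prod>m\<leftarrow>ms. br (l + m) * br (l - m))"
  using assms
proof (induction ms)
  case Nil
  show ?case using reflection_identity[of th l "- l - g" ze] by (simp add: flip_weight_def Kred_def algebra_simps)
next
  case (Cons m ms)
  let ?n = "length ms" and ?F = "replicate (length ms) False"
  define t where "t = th + g * of_nat ?n"
  define x where "x = D ms l True ?F True ?F"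
  define y where "y = D ms l False ?F False ?F"
  have adm: "admissible ?n" using Cons.prems admissible_mono by auto
  have t0: "br t \<noteq> 0" using admissible_hsum[OF adm, of ?F] by (simp add: hsum_replicate t_def)
  have t1: "th + g * of_nat (length (m # ms)) = t + g" by (simp add: t_def algebra_simps)
  have hs: "th - g * hsum ?F = t" by (simp add: hsum_replicate t_def)
  have x': "D (m # ms) l True (False # ?F) True (False # ?F) =
      br (l - m) * br (l + m) * br (t - g) * br (t + g) / (br t * br t) * x + br (t - l + m) * br (t - l - m) * br g * br g / (br t * br t) * y"
    by (simp add: UNIV_bool Rmat_simps hs x_def y_def) (simp add: algebra_simps)
  have y': "D (m # ms) l False (False # ?F) False (False # ?F) = br (l - m + g) * br (l + m + g) * y"
    by (simp add: UNIV_bool Rmat_simps y_def)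
  have IH: "br (t - g) * br (2 * l + g) * x - br g * br (t - 2 * l - g) * y
      = br t * br (2 * l) * br (ze + l + g) * br (th + ze - l - g) * (\<Prod>m\<leftarrow>ms. br (l + m) * br (l - m))"
    using Cons.IH[OF adm] by (simp add: flip_weight_def t_def x_def y_def algebra_simps)
  \<comment> \<open>The recursion mixes \<open>y\<close> into both terms; this Fay instance
    recombines the coefficients of \<open>y\<close> into the one for one site less, so that
    \<open>IH\<close> applies up to a factor.\<close>
  have I: "br (2 * l + g) * br g * (br (t - l - m) * br (t - l + m)) - br t * br (t - 2 * l) * (br (l + m + g) * br (l - m + g))
      + br (l + m) * br (l - m) * br (t + g) * br (t - 2 * l - g) = 0"
    using fay[of "t - g - 3 * l - m" "g + 2 * l" "g + l + m" "l + m"] by (simp add: algebra_simps)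
  have "flip_weight l (- l - g) (t + g) (D (m # ms) l True (False # ?F) True (False # ?F)) (D (m # ms) l False (False # ?F) False (False # ?F))
    = br t * br (2 * l + g) * (br (l - m) * br (l + m) * br (t - g) * br (t + g) / (br t * br t) * x + br (t - l + m) * br (t - l - m) * br g * br g / (br t * br t) * y)
      - br g * br (t - 2 * l) * (br (l - m + g) * br (l + m + g) * y)"
    unfolding x' y' flip_weight_def by (simp add: algebra_simps)
  also have "\<dots> = br (l + m) * br (l - m) * br (t + g) / br t * (br (t - g) * br (2 * l + g) * x - br g * br (t - 2 * l - g) * y)"
    using t0 I by (simp add: divide_simps) algebra
  also have "\<dots> = br (t + g) * br (2 * l) * br (ze + l + g) * br (th + ze - l - g) * (\<Prod>m\<leftarrow>m # ms. br (l + m) * br (l - m))"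
    unfolding IH using t0 by simp
  finally show ?case unfolding t1 by (simp del: dbl.simps)
qed

definition site_const :: "nat \<Rightarrow> complex" where
  "site_const n = br g * shift_ratio (- of_nat n) * shift_prod (of_nat n) n"

lemma Z_at_site:
  assumes "length ls = length ms" "admissible (length ms)"
  shows "Z (l # ls) (l # ms) = site_const (length ms) * br (2 * l) * br (ze - l) * br (th + ze + l)
     * (\<Prod>m\<leftarrow>ms. br (l + m + g) * br (l - m + g)) * (\<Prod>x\<leftarrow>ls. br (x - l + g) * br (x + l)) * Z ls ms"
proof -
  have "br (th + g * of_nat (length ms)) \<noteq> 0"
    using admissible_hsum[OF assms(2), of "replicate (length ms) False"] by (simp add: hsum_replicate)
  then show ?thesis
    using Z_reduce_top[OF assms(1), of l l] D_all_equal[of ms l False]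
    by (simp add: flip_weight_def site_const_def Kred_def mult_ac)
qed

lemma Z_at_reflected_site:
  assumes "length ls = length ms" "admissible (length ms)"
  shows "Z (l # ls) ((- l - g) # ms) = site_const (length ms) * br (2 * l) * br (ze + l + g) * br (th + ze - l - g)
     * (\<Prod>m\<leftarrow>ms. br (l + m) * br (l - m)) * (\<Prod>x\<leftarrow>ls. br (x + l + 2 * g) * br (x - l - g)) * Z ls ms"
proof -
  have "br (th + g * of_nat (length ms)) \<noteq> 0"
    using admissible_hsum[OF assms(2), of "replicate (length ms) False"] by (simp add: hsum_replicate)
  moreover have "(\<Prod>x\<leftarrow>ls. br (x - (- l - g) + g) * br (x + (- l - g))) = (\<Prod>x\<leftarrow>ls. br (x + l + 2 * g) * br (x - l - g))"
    by (simp add: algebra_simps)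
  ultimately show ?thesis
    using Z_reduce_top[OF assms(1), of l "- l - g"] flip_weight_reflected[OF assms(2), of l]
    by (simp add: site_const_def mult_ac)
qed

subsection \<open>The innermost site\<close>

lemma D_single: "D [m] l True [False] False [True] = br g * br (th - g) / br th * br (2 * l) * br (ze - m) * br (th + ze + m)"
proof -
  have "D [m] l True [False] False [True] = br g * shift_ratio 0 / br th * flip_weight l m th (Kred l True) (Kred l False)"
    using B_outer_lower[of m "[]" l "[]" "[]"] by (simp add: B_def)
  also have "flip_weight l m th (Kred l True) (Kred l False) = br th * br (2 * l) * br (ze - m) * br (th + ze + m)"
    unfolding flip_weight_def Kred_def by (simp add: reflection_identity)
  finally show ?thesis by (simp add: shift_ratio_def)
qed

text \<open>A double row lowering the spin next to the boundary contains the one-site element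
  \<open>D_single\<close> as a factor, and that element carries
  \<open>br (ze - m) * br (th + ze + m)\<close>.\<close>

lemma D_innermost:
  assumes "br (ze - m) = 0 \<or> br (th + ze + m) = 0"
  shows "D (ms @ [m]) l a (u' @ [False]) b (u @ [True]) = 0"
proof (induction ms arbitrary: a u' b u)
  case Nil
  show ?case
  proof (cases "u' = [] \<and> u = [] \<and> a \<and> \<not> b")
    case True
    then show ?thesis using D_single[of m l] assms by auto
  next
    case False
    then have "u' \<noteq> [] \<or> u \<noteq> [] \<or> (u' = [] \<and> u = [] \<and> hval a + hsum [False] \<noteq> hval b + hsum [True])"
      by (cases a; cases b) auto
    then show ?thesis
    proof (elim disjE conjE)
      assume "u' \<noteq> []" then show ?thesis by (intro dbl_length) simp
    next
      assume "u \<noteq> []" then show ?thesis by (intro dbl_length) simp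
    next
      assume "u' = []" "u = []" "hval a + hsum [False] \<noteq> hval b + hsum [True]"
      then show ?thesis using dbl_weight[of a "[False]" b "[True]"] by simp
    qed
  qed
next
  case (Cons m' ms)
  show ?case
  proof (cases u'; cases u)
    fix s' v' s v assume e: "u' = s' # v'" "u = s # v"
    show ?thesis by (simp add: e Cons.IH)
  qed (auto intro!: dbl_length simp del: dbl.simps)
qed

text \<open>Lowering the innermost spin must take place in some row, and each row alone has
  amplitude zero for it.\<close>

lemma P_innermost:
  assumes m: "br (ze - m) = 0 \<or> br (th + ze + m) = 0"
  shows "length u' = length ms \<Longrightarrow> length u = length ms \<Longrightarrow> P (ms @ [m]) ls (u' @ [False]) (u @ [True]) = 0"
proof (induction ls arbitrary: u')
  case Nil
  then show ?case by (simp add: P_def opid_def)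
next
  case (Cons l ls)
  have "B (ms @ [m]) l (u' @ [False]) v * P (ms @ [m]) ls v (u @ [True]) = 0" if v: "length v = length (ms @ [m])" for v
  proof -
    obtain w s where w: "v = w @ [s]" using v by (cases v rule: rev_cases) auto
    show ?thesis
    proof (cases s)
      case True
      then show ?thesis using D_innermost[OF m] by (simp add: w B_def)
    next
      case False
      then show ?thesis using Cons v by (simp add: w)
    qed
  qed
  then show ?case unfolding P_Cons by (intro sum.neutral) blast
qed

lemma Z_innermost_zero:
  assumes "br (ze - m) = 0 \<or> br (th + ze + m) = 0"
  shows "Z ls (ms @ [m]) = 0"
  using P_innermost[OF assms, of "replicate (length ms) False" ms "replicate (length ms) True" ls]
  by (simp add: Z_def replicate_append_same)

end

section \<open>The exact zero set of the theta function\<close>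

context nonzero_theta
begin

text \<open>The quotient of \<open>tf\<close> by \<open>phi\<close> has degree 0 and sum parameter
  0, a case excluded from \<open>theta_fun_degree_0\<close>. Multiplying it by a translate of
  \<open>tf\<close> changes the parameter, so that a zero of the quotient would force
  \<open>tf\<close> to vanish identically.\<close>

lemma tf_factor:
  obtains h where "h holomorphic_on UNIV" "\<And>x. h x \<noteq> 0" "\<And>x. tf tau x = h x * phi x"
proof -
  obtain h where h: "theta_fun 0 0 h" "\<And>x. tf tau x = h x * phi x"
    using theta_fun_divide[of 0 0 "tf tau" 0] theta_fun_tf by (metis One_nat_def add_0 diff_0_right tf_0)
  have "h x \<noteq> 0" for x
  proof
    assume h0: "h x = 0"
    obtain c where c: "tf tau c \<noteq> 0" using tf_nonzero by blast
    \<comment> \<open>Chosen so that dividing out the zero \<open>x\<close> leaves the parameter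
      \<open>- b + x = c\<close>, at which \<open>tf\<close> does not vanish.\<close>
    define b where "b = x - c"
    have "theta_fun 1 (-b) (\<lambda>x. h x * tf tau (x - b))"
      using theta_fun_mult[OF h(1) theta_fun_tf_plus[of "-b"]] by simp
    then obtain k where k: "theta_fun 0 (-b + x) k" "\<And>y. h y * tf tau (y - b) = k y * phi (y - x)"
      using theta_fun_divide[of 0 "-b" "\<lambda>x. h x * tf tau (x - b)" x] h0 by auto
    have "tf tau (-b + x) \<noteq> 0" using c by (simp add: b_def)
    then have "k y = 0" for y using theta_fun_degree_0[OF k(1)] by simp
    then have z: "h y * tf tau (y - b) = 0" for y using k(2) by simp
    have "h y = 0" for y
    proof -
      have "eventually (\<lambda>y. h y = 0) (at y)"
        using tf_affine_nonzero[OF one_neq_zero, of "-b" y] z by (auto elim!: eventually_mono)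
      then show ?thesis
        using eq_if_eventually_eq[of h "\<lambda>_. 0"] theta_fun_holomorphic[OF h(1)] by simp
    qed
    then show False using h(2)[of c] c by simp
  qed
  then show ?thesis using that[of h] h theta_fun_holomorphic by blast
qed

lemma tf_eq_0: "tf tau x = 0 \<Longrightarrow> x \<in> lattice"
  by (rule tf_factor) (metis mult_eq_0_iff phi_eq_0)

lemma deriv_tf_ne_0: "deriv (tf tau) 0 \<noteq> 0"
proof (rule tf_factor)
  fix h assume h: "h holomorphic_on UNIV" "\<And>x. h x \<noteq> 0" "\<And>x. tf tau x = h x * phi x"
  have d: "(k has_field_derivative deriv k 0) (at 0)" if "k holomorphic_on UNIV" for k :: "complex \<Rightarrow> complex"
    using holomorphic_derivI[OF that open_UNIV] by simp
  have "((\<lambda>x. h x * phi x) has_field_derivative (deriv h 0 * phi 0 + deriv phi 0 * h 0)) (at 0)"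
    by (rule DERIV_mult[OF d[OF h(1)] d[OF theta_fun_holomorphic[OF theta_fun_phi]]])
  moreover have "tf tau = (\<lambda>x. h x * phi x)" using h(3) by auto
  ultimately have "deriv (tf tau) 0 = deriv phi 0 * h 0"
    using phi_lattice[OF zero_in_lattice] by (auto dest: DERIV_imp_deriv)
  then show ?thesis using h(2) deriv_phi_ne_0[OF zero_in_lattice] by simp
qed

text \<open>Keeps the nodes \<open>0\<close> and \<open>\<i> * pi / 2\<close> apart; it rests on the
  exact zero set, since half a period is not a lattice point.\<close>

lemma tf_half_period: "tf tau (\<i> * pi / 2) \<noteq> 0"
proof
  assume "tf tau (\<i> * pi / 2) = 0"
  then obtain m k where e: "\<i> * pi / 2 = of_int m * (\<i> * pi) + of_int k * (\<i> * pi * tau)"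
    using tf_eq_0 unfolding lattice_def by blast
  have "of_int k * Im tau = 0" using arg_cong[OF e, of Re] by simp
  then have k: "k = 0" using Im_tau by simp
  have "1 / 2 = (of_int m :: real)" using arg_cong[OF e, of Im] unfolding k by simp
  then have "real_of_int (2 * m) = real_of_int 1" by simp
  then have "2 * m = 1" by (simp only: of_int_eq_iff)
  then show False by presburger
qed

lemma tf_add_pi: "tf tau (x + \<i> * pi) = - tf tau x"
  using theta_fun_tf by (simp add: theta_fun_def)

lemma theta_fun_uminus:
  assumes "theta_fun N s h"
  shows "theta_fun N (- s) (\<lambda>x. h (- x))"
proof -
  have 1: "h (- (x + \<i> * pi)) = (-1) ^ N * h (- x)" for x
  proof -
    have "h (- x) = (-1) ^ N * h (- (x + \<i> * pi))"
      using assms[unfolded theta_fun_def, THEN conjunct2, THEN conjunct1, rule_format, of "- (x + \<i> * pi)"] by simp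
    then show ?thesis by (simp add: mult.assoc[symmetric] power_mult_distrib[symmetric])
  qed
  define w where "w = \<i> * pi * tau"
  have 2: "h (- (x + w)) = (-1) ^ N * exp (- (of_nat N * w + 2 * of_nat N * x + 2 * - s)) * h (- x)" for x
  proof -
    have "h (- x) = (-1) ^ N * exp (- (of_nat N * w + 2 * of_nat N * (- (x + w)) + 2 * s)) * h (- (x + w))"
      using assms[unfolded theta_fun_def, THEN conjunct2, THEN conjunct2, rule_format, of "- (x + w)"]
      unfolding w_def[symmetric] by simp
    then have "(-1) ^ N * exp (- (of_nat N * w + 2 * of_nat N * x + 2 * - s)) * h (- x)
      = ((-1) ^ N * (-1) ^ N) * (exp (- (of_nat N * w + 2 * of_nat N * x + 2 * - s)) * exp (- (of_nat N * w + 2 * of_nat N * (- (x + w)) + 2 * s))) * h (- (x + w))"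
      by (simp only: mult_ac)
    also have "\<dots> = h (- (x + w))"
      by (simp add: power_mult_distrib[symmetric] mult_exp_exp algebra_simps)
    finally show ?thesis by simp
  qed
  have "(\<lambda>x. h (- x)) holomorphic_on UNIV"
    by (intro holomorphic_UNIV_compose[OF theta_fun_holomorphic[OF assms]] holomorphic_intros)
  then show ?thesis unfolding theta_fun_def using 1 2[unfolded w_def] by blast
qed

end

context sos
begin

subsection \<open>Symmetry in the spectral parameters\<close>

lemma theta_fun_Z_top: "theta_fun (2 * length ms + 2) (g * (of_nat (length ms) - 1)) (\<lambda>l. Z (l # ls) ms)"
  unfolding Z_def P_Cons by (intro theta_fun_sum theta_fun_cmult2 theta_fun_B)

lemma theta_fun_Z_bottom: "theta_fun (2 * length ms + 2) (g * (of_nat (length ms) - 1)) (\<lambda>l. Z (ls @ [l]) ms)"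
  unfolding Z_def by (simp only: P_snoc length_replicate) (intro theta_fun_sum theta_fun_cmult theta_fun_B)

text \<open>Contains the offsets between a node attached to a site and the nodes \<open>0\<close>
  and \<open>\<i> * pi / 2\<close>, for the node lists of both the top and the bottom row.\<close>

definition shifts :: "complex set" where
  "shifts = {0, \<i> * pi / 2, - (\<i> * pi / 2), g, - g, g + \<i> * pi / 2, - g - \<i> * pi / 2, \<i> * pi / 2 - g}"

definition generic_sites :: "complex list \<Rightarrow> bool" where
  "generic_sites ms \<longleftrightarrow> (\<forall>i\<in>{..<length ms}. \<forall>j\<in>{i<..<length ms}. br (ms ! i - ms ! j) \<noteq> 0)
    \<and> (\<forall>i\<in>{..<length ms}. \<forall>j\<in>{..<length ms}. \<forall>c\<in>{g, - g}. br (ms ! i + ms ! j + c) \<noteq> 0)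
    \<and> (\<forall>i\<in>{..<length ms}. \<forall>c\<in>shifts. br (ms ! i + c) \<noteq> 0)"

lemma generic_sites_set:
  assumes "generic_sites ms"
  shows "\<And>a b c. a \<in> set ms \<Longrightarrow> b \<in> set ms \<Longrightarrow> c \<in> {g, - g} \<Longrightarrow> br (a + b + c) \<noteq> 0"
    and "\<And>a c. a \<in> set ms \<Longrightarrow> c \<in> shifts \<Longrightarrow> br (a + c) \<noteq> 0"
    and "sorted_wrt (\<lambda>p q. br (p - q) \<noteq> 0) ms"
  using assms unfolding generic_sites_def in_set_conv_nth sorted_wrt_iff_nth_less
  by (blast, blast, simp)

text \<open>The value \<open>\<i> * pi / 2 - g\<close> is the sum condition for interpolation in a
  spectral parameter. The others separate the nodes \<open>ze\<close>, \<open>- ze\<close>,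
  \<open>th + ze\<close>, \<open>- th - ze\<close>, \<open>0\<close> and
  \<open>\<i> * pi / 2\<close> of the two-site argument.\<close>

definition generic_boundary :: bool where
  "generic_boundary \<longleftrightarrow> (\<forall>x\<in>{2 * ze, 2 * ze + th, ze, ze - \<i> * pi / 2, 2 * (th + ze), th + ze, th + ze - \<i> * pi / 2, \<i> * pi / 2 - g}. br x \<noteq> 0)"

lemma br_minus_iff: "br (a - b) \<noteq> 0 \<longleftrightarrow> br (b - a) \<noteq> 0"
  using tf_minus[of "a - b"] by auto

lemma generic_sites_top:
  assumes "generic_sites ms"
  shows "sorted_wrt (\<lambda>p q. br (p - q) \<noteq> 0) (ms @ map (\<lambda>m. - m - g) ms @ [0, \<i> * pi / 2])"
proof -
  note gs = generic_sites_set[OF assms]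
  have 1: "br (a + b + g) \<noteq> 0" if "a \<in> set ms" "b \<in> set ms" for a b
    using gs(1)[OF that, of g] by simp
  have 3: "br (- a - g) \<noteq> 0" "br (- a - g - \<i> * pi / 2) \<noteq> 0" "br a \<noteq> 0" "br (a - \<i> * pi / 2) \<noteq> 0" if "a \<in> set ms" for a
    using gs(2)[OF that, of g] gs(2)[OF that, of "g + \<i> * pi / 2"] gs(2)[OF that, of 0] gs(2)[OF that, of "- (\<i> * pi / 2)"]
      tf_minus[of "a + g"] tf_minus[of "a + g + \<i> * pi / 2"] by (simp_all add: shifts_def algebra_simps)
  have 5: "sorted_wrt (\<lambda>p q. br (p - q) \<noteq> 0) (map (\<lambda>m. - m - g) ms)"
    unfolding sorted_wrt_map by (rule sorted_wrt_mono_rel[OF _ gs(3)]) (simp add: br_minus_iff)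
  show ?thesis
    unfolding sorted_wrt_append using 1 3 gs(3) 5 tf_half_period
    by (auto simp: algebra_simps)
qed

lemma generic_sites_bottom:
  assumes "generic_sites ms"
  shows "sorted_wrt (\<lambda>p q. br (p - q) \<noteq> 0) (map uminus ms @ map (\<lambda>m. m - g) ms @ [0, \<i> * pi / 2])"
proof -
  note gs = generic_sites_set[OF assms]
  have 1: "br (- a - (b - g)) \<noteq> 0" if "a \<in> set ms" "b \<in> set ms" for a b
    using gs(1)[OF that, of "- g"] tf_minus[of "a + b - g"] by (simp add: algebra_simps)
  have 3: "br (a - g) \<noteq> 0" "br (a - g - \<i> * pi / 2) \<noteq> 0" "br a \<noteq> 0" "br (- a - \<i> * pi / 2) \<noteq> 0" if "a \<in> set ms" for a
    using gs(2)[OF that, of "- g"] gs(2)[OF that, of "- g - \<i> * pi / 2"] gs(2)[OF that, of 0] gs(2)[OF that, of "\<i> * pi / 2"]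
      tf_minus[of "a + \<i> * pi / 2"] by (simp_all add: shifts_def algebra_simps)
  have 5: "sorted_wrt (\<lambda>p q. br (p - q) \<noteq> 0) (map uminus ms)" "sorted_wrt (\<lambda>p q. br (p - q) \<noteq> 0) (map (\<lambda>m. m - g) ms)"
    unfolding sorted_wrt_map by (rule sorted_wrt_mono_rel[OF _ gs(3)], simp add: br_minus_iff)+
  show ?thesis
    unfolding sorted_wrt_append using 1 3 5 tf_half_period
    by auto
qed

text \<open>Sites moving at pairwise different speeds are generic at almost all times.\<close>
lemma eventually_generic_sites:
  "eventually (\<lambda>x. generic_sites (map (\<lambda>i. ms ! i + of_nat (Suc i) * x) [0..<length ms])) (at 0)"
proof -
  have 1: "eventually (\<lambda>x. br (ms ! i + of_nat (Suc i) * x - (ms ! j + of_nat (Suc j) * x)) \<noteq> 0) (at 0)" if "i < j" for i j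
  proof -
    have "of_nat (Suc i) - of_nat (Suc j) \<noteq> (0 :: complex)" using that by simp
    from tf_affine_nonzero[OF this, of "ms ! i - ms ! j" 0] show ?thesis by (simp add: algebra_simps)
  qed
  have 2: "eventually (\<lambda>x. br (ms ! i + of_nat (Suc i) * x + (ms ! j + of_nat (Suc j) * x) + c) \<noteq> 0) (at 0)" for i j c
  proof -
    have "of_nat (Suc i) + of_nat (Suc j) \<noteq> (0 :: complex)" by (metis add_Suc of_nat_add of_nat_neq_0)
    from tf_affine_nonzero[OF this, of "ms ! i + ms ! j + c" 0] show ?thesis by (simp add: algebra_simps)
  qed
  have 3: "eventually (\<lambda>x. br (ms ! i + of_nat (Suc i) * x + c) \<noteq> 0) (at 0)" for i c
    using tf_affine_nonzero[OF of_nat_neq_0, of i "ms ! i + c" 0] by (simp add: algebra_simps)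
  show ?thesis
    unfolding generic_sites_def length_map length_upt
    by (intro eventually_conj eventually_ball_finite ballI) (use 1 2 3 in \<open>auto simp: shifts_def\<close>)
qed

text \<open>As a function of \<open>l\<close> the difference has as many known zeros as its degree.
  At the nodes of a site, moved to the front, the top row peels off and the shorter identity
  applies; the peeled factor depends on the other rows only through a symmetric product, hence the
  hypothesis \<open>prod\<close>. The last two nodes are the zeros of \<open>B\<close>.\<close>

lemma Z_swap_top:
  assumes adm: "admissible (Suc (length ms))" and gen: "generic_sites ms" "generic_boundary"
    and len: "Suc (length ls) = length ms" "length ls' = length ls"
    and prod: "\<And>F :: complex \<Rightarrow> complex. (\<Prod>x\<leftarrow>ls'. F x) = (\<Prod>x\<leftarrow>ls. F x)"
    and IH: "\<And>ns. length ns = length ls \<Longrightarrow> Z ls' ns = Z ls ns"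
  shows "Z (l # ls') ms = Z (l # ls) ms"
proof -
  let ?F = "\<lambda>l. Z (l # ls') ms - Z (l # ls) ms"
  have zero: "?F l = 0" if m: "m \<in> set ms" and l: "br (l - m) = 0 \<or> br (l + m + g) = 0" for l m
  proof -
    obtain xs ys where ms: "ms = xs @ m # ys" using m by (meson split_list)
    have "Z (l # ks) ms = Z (l # ks) (m # xs @ ys)" for ks
      unfolding ms by (rule Z_site_to_front) (use adm ms in simp)
    moreover have n: "length ls = length (xs @ ys)" "length ls' = length (xs @ ys)" using len ms by auto
    ultimately show ?thesis
      using Z_reduce_top[OF n(1) l] Z_reduce_top[OF n(2) l] IH[of "xs @ ys"] n by (simp add: prod)
  qed
  have b: "?F 0 = 0" "?F (\<i> * pi / 2) = 0"
    using B_zero[of ms] admissible_mono[OF adm] by (simp_all add: Z_def P_Cons)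
  have "?F l = 0"
  proof (rule theta_fun_interpolation[OF theta_fun_diff[OF theta_fun_Z_top theta_fun_Z_top] _ _ generic_sites_top[OF gen(1)]])
    show "\<forall>p\<in>set (ms @ map (\<lambda>m. - m - g) ms @ [0, \<i> * pi / 2]). ?F p = 0"
      using zero b by auto
    have s: "sum_list (map (\<lambda>m. - m - g) xs) = - sum_list xs - of_nat (length xs) * g" for xs :: "complex list"
      by (induction xs) (simp_all add: algebra_simps)
    show "br (g * (of_nat (length ms) - 1) + sum_list (ms @ map (\<lambda>m. - m - g) ms @ [0, \<i> * pi / 2])) \<noteq> 0"
      using gen(2) by (simp add: s generic_boundary_def algebra_simps)
  qed simp
  then show ?thesis by simp
qed

lemma Z_swap_bottom:
  assumes adm: "admissible (Suc (length ms))" and gen: "generic_sites ms" "generic_boundary"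
    and len: "Suc (length ls) = length ms" "length ls' = length ls"
    and prod: "\<And>F :: complex \<Rightarrow> complex. (\<Prod>x\<leftarrow>ls'. F x) = (\<Prod>x\<leftarrow>ls. F x)"
    and IH: "\<And>ns. length ns = length ls \<Longrightarrow> Z ls' ns = Z ls ns"
  shows "Z (ls' @ [l]) ms = Z (ls @ [l]) ms"
proof -
  let ?F = "\<lambda>l. Z (ls' @ [l]) ms - Z (ls @ [l]) ms"
  have zero: "?F l = 0" if m: "m \<in> set ms" and l: "br (l + m) = 0 \<or> br (l - m + g) = 0" for l m
  proof -
    obtain xs ys where ms: "ms = xs @ m # ys" using m by (meson split_list)
    have "Z (ks @ [l]) ms = Z (ks @ [l]) (m # xs @ ys)" for ks
      unfolding ms by (rule Z_site_to_front) (use adm ms in simp)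
    moreover have n: "length ls = length (xs @ ys)" "length ls' = length (xs @ ys)" using len ms by auto
    ultimately show ?thesis
      using Z_reduce_bottom[OF n(1) l] Z_reduce_bottom[OF n(2) l] IH[of "xs @ ys"] n by (simp add: prod)
  qed
  have b: "?F 0 = 0" "?F (\<i> * pi / 2) = 0"
    using B_zero[of ms] admissible_mono[OF adm] by (simp_all add: Z_def P_snoc)
  have "?F l = 0"
  proof (rule theta_fun_interpolation[OF theta_fun_diff[OF theta_fun_Z_bottom theta_fun_Z_bottom] _ _ generic_sites_bottom[OF gen(1)]])
    show "\<forall>p\<in>set (map uminus ms @ map (\<lambda>m. m - g) ms @ [0, \<i> * pi / 2]). ?F p = 0"
      using zero b by auto
    have s: "sum_list (map uminus xs) + (sum_list (map (\<lambda>m. m - g) xs)) = - of_nat (length xs) * g" for xs :: "complex list"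
      by (induction xs) (simp_all add: algebra_simps)
    show "br (g * (of_nat (length ms) - 1) + sum_list (map uminus ms @ map (\<lambda>m. m - g) ms @ [0, \<i> * pi / 2])) \<noteq> 0"
      using gen(2) by (simp add: s generic_boundary_def algebra_simps flip: add.assoc)
  qed simp
  then show ?thesis by simp
qed

text \<open>Both sides have degree 6 and sum parameter 0, and their difference vanishes at the
  boundary zeros with both signs, at 0 and at half a period. The reflection is wanted because a row
  \<open>a\<close> peels off the top at \<open>x = a\<close> but off the bottom at
  \<open>x = - a\<close>.\<close>

lemma Z_two_even:
  assumes adm: "admissible 3" and gen: generic_boundary and len: "length ls = 2"
  shows "Z ls [x, m] * (br (ze + x) * br (th + ze - x)) = Z ls [- x, m] * (br (ze - x) * br (th + ze + x))"
proof -
  let ?F = "\<lambda>x. Z ls [x, m] * (br (ze + x) * br (th + ze - x)) - Z ls [- x, m] * (br (ze - x) * br (th + ze + x))"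
  have tZ: "theta_fun 4 th (\<lambda>x. Z ls [x, m])" using theta_fun_Z_site[of ls "[m]"] len by simp
  have "theta_fun 6 0 (\<lambda>x. Z ls [x, m] * (br (ze + x) * br (th + ze - x)))"
    by (rule theta_fun_eqI[OF theta_fun_mult[OF tZ theta_fun_mult[OF theta_fun_tf_plus[of ze] theta_fun_tf_minus[of "th + ze"]]]])
       (simp_all add: add.commute)
  moreover have "theta_fun 6 0 (\<lambda>x. Z ls [- x, m] * (br (ze - x) * br (th + ze + x)))"
    by (rule theta_fun_eqI[OF theta_fun_mult[OF theta_fun_uminus[OF tZ] theta_fun_mult[OF theta_fun_tf_minus[of ze] theta_fun_tf_plus[of "th + ze"]]]])
       (simp_all add: algebra_simps)
  ultimately have tF: "theta_fun 6 0 ?F" by (rule theta_fun_diff)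
  have Z0: "Z ls [x, m] = 0" if "br (ze - x) = 0 \<or> br (th + ze + x) = 0" for x
    using Z_innermost_zero[OF that, of ls "[m]"] Z_swap_sites[of "[]" "[]" ls x m] admissible_mono[OF adm] by simp
  define h where "h = \<i> * pi / 2"
  have hh: "h - - h = \<i> * pi" by (simp add: h_def)
  have per: "br (y + h) = - br (y - h)" for y
    using tf_add_pi[of "y - h"] by (simp add: h_def algebra_simps)
  \<comment> \<open>Here \<open>h\<close> and \<open>- h\<close> differ by the period
    \<open>\<i> * pi\<close>, and the degree 4 is even, so no sign appears.\<close>
  have "Z ls [h, m] = Z ls [- h, m]"
    using tZ[unfolded theta_fun_def, THEN conjunct2, THEN conjunct1, rule_format, of "- h"] hh by (simp add: h_def)
  then have Fh: "?F h = 0" using per[of ze] per[of "th + ze"] by simp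
  let ?ps = "[ze, - ze, th + ze, - th - ze, 0, h]"
  have gb: "br (2 * ze) \<noteq> 0" "br (2 * ze + th) \<noteq> 0" "br ze \<noteq> 0" "br (ze - h) \<noteq> 0" "br (2 * (th + ze)) \<noteq> 0"
    "br (th + ze) \<noteq> 0" "br (th + ze - h) \<noteq> 0" "br th \<noteq> 0" "br h \<noteq> 0"
    using gen tf_half_period adm[unfolded admissible_def, rule_format, of 0] by (simp_all add: generic_boundary_def h_def)
  have gm: "br (- (2 * ze)) \<noteq> 0" "br (- (2 * ze + th)) \<noteq> 0" "br (- ze) \<noteq> 0" "br (- (ze + h)) \<noteq> 0" "br (- (2 * (th + ze))) \<noteq> 0"
    "br (- (th + ze)) \<noteq> 0" "br (- (th + ze + h)) \<noteq> 0" "br (- th) \<noteq> 0" "br (- h) \<noteq> 0"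
    unfolding tf_minus neg_equal_0_iff_equal per using gb by simp_all
  have e: "- ze - h = - (ze + h)" "- th - (h + ze) = - (th + ze + h)" by simp_all
  have gm': "br (- ze - h) \<noteq> 0" "br (- th - (h + ze)) \<noteq> 0" unfolding e using gm by simp_all
  have "?F x = 0"
  proof (rule theta_fun_interpolation[OF tF, of ?ps])
    show "\<forall>p\<in>set ?ps. ?F p = 0" using Z0 Fh by simp
    show "sorted_wrt (\<lambda>p q. br (p - q) \<noteq> 0) ?ps" using gb gm gm' by (simp add: algebra_simps)
    show "br (0 + sum_list ?ps) \<noteq> 0" using gb by simp
  qed simp
  then show ?thesis by simp
qed

text \<open>Peeling the top row at \<open>x = a\<close> and the bottom row at \<open>x = - a\<close>
  leaves the same one-site function; evenness moves the second value back to
  \<open>x = a\<close>.\<close>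

lemma Z_two_at_site:
  assumes adm: "admissible 3" and gen: generic_boundary and a: "br (ze + a) * br (th + ze - a) \<noteq> 0"
  shows "Z [b, a] [a, m] = Z [a, b] [a, m]"
proof -
  have t: "br (th - g) \<noteq> 0" using adm[unfolded admissible_def, rule_format, of "-1"] by simp
  have 1: "Z [a, b] [a, m] = br g * shift_ratio (- 1) * shift_ratio 1 * br (2 * a) * br (ze - a) * br (th + ze + a)
     * (br (a + m + g) * br (a - m + g)) * (br (b - a + g) * br (b + a)) * Z [b] [m]"
    using Z_at_site[of "[b]" "[m]" a] admissible_mono[OF adm] by (simp add: site_const_def)
  have 2: "Z [b, a] [- a, m] = br g * shift_ratio 1 * shift_ratio (- 1) * br (2 * a) * (br (ze + a) * br (th + ze - a))
     * (br (a + m + g) * br (a - m + g)) * (br (b - a + g) * br (b + a)) * Z [b] [m]"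
    using Z_reduce_bottom[of "[b]" "[m]" a "- a"] D_all_equal[of "[m]" a True] t
    by (simp add: flip_weight_def Kred_def mult_ac del: dbl.simps)
  have "Z [b, a] [a, m] * (br (ze + a) * br (th + ze - a)) = Z [b, a] [- a, m] * (br (ze - a) * br (th + ze + a))"
    by (rule Z_two_even[OF adm gen]) simp
  also have "\<dots> = Z [a, b] [a, m] * (br (ze + a) * br (th + ze - a))"
    unfolding 1 2 by (simp add: mult_ac)
  finally show ?thesis using a by simp
qed

text \<open>Interpolation in the inhomogeneity \<open>x\<close>: four nodes for degree 4, with sum
  condition \<open>br (a + b) \<noteq> 0\<close>. All genericity of the spectral pair is removed by
  moving it along a line with unequal speeds.\<close>

lemma Z_two_sym:
  assumes adm: "admissible 3" and gen: generic_boundary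
  shows "Z [a, b] [x, m] = Z [b, a] [x, m]"
proof -
  have generic: "Z [a, b] [x, m] = Z [b, a] [x, m]"
    if "br (ze + a) \<noteq> 0" "br (th + ze - a) \<noteq> 0" "br (ze + b) \<noteq> 0" "br (th + ze - b) \<noteq> 0" "br (a + b) \<noteq> 0"
      "br (ze - a) \<noteq> 0" "br (ze - b) \<noteq> 0" "br (th + ze + a) \<noteq> 0" "br (th + ze + b) \<noteq> 0" "br (a - b) \<noteq> 0" for a b
  proof -
    let ?F = "\<lambda>x. Z [a, b] [x, m] - Z [b, a] [x, m]"
    have tF: "theta_fun 4 th ?F"
      using theta_fun_Z_site[of "[a, b]" "[m]"] theta_fun_Z_site[of "[b, a]" "[m]"] by (intro theta_fun_diff) simp_all
    have Z0: "Z ls [x, m] = 0" if "br (ze - x) = 0 \<or> br (th + ze + x) = 0" for x ls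
      using Z_innermost_zero[OF that, of ls "[m]"] Z_swap_sites[of "[]" "[]" ls x m] admissible_mono[OF adm] by simp
    have "?F x = 0"
    proof (rule theta_fun_interpolation[OF tF, of "[ze, - th - ze, a, b]"])
      show "\<forall>p\<in>set [ze, - th - ze, a, b]. ?F p = 0"
        using Z0 that Z_two_at_site[OF adm gen, of a b m] Z_two_at_site[OF adm gen, of b a m] by simp
      have "br (2 * ze + th) \<noteq> 0" using gen by (simp add: generic_boundary_def)
      moreover have "ze - (- th - ze) = 2 * ze + th" by simp
      ultimately have c: "br (ze - (- th - ze)) \<noteq> 0" by simp
      have n: "br (- th - ze - y) \<noteq> 0" if "br (th + ze + y) \<noteq> 0" for y
        using tf_minus[of "th + ze + y"] that by simp
      show "sorted_wrt (\<lambda>p q. br (p - q) \<noteq> 0) [ze, - th - ze, a, b]"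
        using that c n by simp
    qed (use that in simp_all)
    then show ?thesis by simp
  qed
  have hol: "(\<lambda>y. Z [c + y, d + 2 * y] [x, m]) holomorphic_on UNIV" "(\<lambda>y. Z [d + 2 * y, c + y] [x, m]) holomorphic_on UNIV" for c d
    using Z_holomorphic[of "[\<lambda>_. x, \<lambda>_. m]" "[\<lambda>y. c + y, \<lambda>y. d + 2 * y]"]
      Z_holomorphic[of "[\<lambda>_. x, \<lambda>_. m]" "[\<lambda>y. d + 2 * y, \<lambda>y. c + y]"]
    by (force intro: holomorphic_intros)+
  have e: "eventually (\<lambda>y. br (k * y + c) \<noteq> 0) (at 0)" if "k \<noteq> 0" for k c
    by (rule tf_affine_nonzero[OF that])
  have "eventually (\<lambda>y. Z [a + y, b + 2 * y] [x, m] = Z [b + 2 * y, a + y] [x, m]) (at 0)"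
    using e[of 1 "ze + a"] e[of "-1" "th + ze - a"] e[of 2 "ze + b"] e[of "-2" "th + ze - b"] e[of 3 "a + b"]
      e[of "-1" "ze - a"] e[of "-2" "ze - b"] e[of 1 "th + ze + a"] e[of 2 "th + ze + b"] e[of "-1" "a - b"]
    by (simp, elim eventually_rev_mp, intro always_eventually allI impI generic) (simp_all add: algebra_simps)
  from eq_if_eventually_eq[OF hol this] show ?thesis by simp
qed

lemma Z_swap_spectral:
  assumes "admissible (Suc (length ms))" generic_boundary "length ms = length xs + length ys + 2"
  shows "Z (xs @ a # b # ys) ms = Z (xs @ b # a # ys) ms"
  using assms(1,3)
proof (induction "length ms" arbitrary: ms xs ys a b rule: less_induct)
  case less
  have generic: "Z (xs @ a # b # ys) ns = Z (xs @ b # a # ys) ns" if gen: "generic_sites ns" and len: "length ns = length ms" for ns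
  proof -
    have adm: "admissible (Suc (length ns))" using less.prems len by simp
    have prod: "(\<Prod>x\<leftarrow>us @ a # b # vs. F x) = (\<Prod>x\<leftarrow>us @ b # a # vs. F x)" for F :: "complex \<Rightarrow> complex" and us vs
      by (simp add: mult_ac)
    have IH: "Z (us @ a # b # vs) ks = Z (us @ b # a # vs) ks" if "length ks = length us + length vs + 2" "length ks < length ms" for us vs ks
      using less.hyps[OF that(2)] admissible_mono[OF less.prems(1), of "Suc (length ks)"] that by simp
    \<comment> \<open>Unless the pair makes up all rows, a row outside it sits at the top or at the
      bottom and serves as the interpolation variable.\<close>
    consider l us where "xs = l # us" | l us where "xs = []" "ys = us @ [l]" | "xs = []" "ys = []"
      by (cases xs; cases ys rule: rev_cases) auto
    then show ?thesis
    proof cases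
      case 1
      show ?thesis unfolding 1 append_Cons
        by (rule Z_swap_top[OF adm gen assms(2)]) (use less.prems len IH 1 in \<open>simp_all add: mult_ac\<close>)
    next
      case 2
      have "Z ((a # b # us) @ [l]) ns = Z ((b # a # us) @ [l]) ns"
        by (rule Z_swap_bottom[OF adm gen assms(2)]) (use less.prems len IH[of _ "[]"] 2 in \<open>simp_all add: mult_ac\<close>)
      then show ?thesis by (simp add: 2)
    next
      case 3
      then obtain x m where "ns = [x, m]" using len less.prems by (auto simp: length_Suc_conv numeral_2_eq_2)
      then show ?thesis using Z_two_sym assms(2) adm 3 by (simp add: numeral_3_eq_3)
    qed
  qed
  \<comment> \<open>Sites moving at distinct speeds are generic for almost all small times; time 0
    gives back \<open>ms\<close>.\<close>
  define qs where "qs = map (\<lambda>i x. ms ! i + of_nat (Suc i) * x) [0..<length ms]"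
  have hol: "(\<lambda>x. Z ls (map (\<lambda>q. q x) qs)) holomorphic_on UNIV" for ls
  proof -
    have 1: "q holomorphic_on UNIV" if "q \<in> set qs" for q
      using that by (auto simp: qs_def intro!: holomorphic_intros)
    have 2: "q holomorphic_on UNIV" if "q \<in> set (map (\<lambda>l _. l) ls)" for q :: "complex \<Rightarrow> complex"
      using that by auto
    from Z_holomorphic[of qs "map (\<lambda>l _. l) ls", OF 1 2] show ?thesis by (simp add: o_def)
  qed
  have "eventually (\<lambda>x. Z (xs @ a # b # ys) (map (\<lambda>q. q x) qs) = Z (xs @ b # a # ys) (map (\<lambda>q. q x) qs)) (at 0)"
    using eventually_generic_sites[of ms] by (rule eventually_mono) (rule generic, simp_all add: qs_def o_def)
  from eq_if_eventually_eq[OF hol hol this] show ?case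
    by (simp add: qs_def o_def map_nth)
qed

lemma Z_spectral_to_front:
  assumes "admissible (Suc (length ms))" generic_boundary "length ms = length xs + length ys + 1"
  shows "Z (xs @ a # ys) ms = Z (a # xs @ ys) ms"
  using assms(3)
proof (induction xs arbitrary: ys rule: rev_induct)
  case (snoc x xs)
  have "Z ((xs @ [x]) @ a # ys) ms = Z (xs @ a # x # ys) ms"
    using Z_swap_spectral[OF assms(1,2), of xs ys x a] snoc.prems by simp
  also have "\<dots> = Z (a # xs @ x # ys) ms"
    by (rule snoc.IH) (use snoc.prems in simp)
  finally show ?case by simp
qed simp


subsection \<open>Lagrange interpolation in the last inhomogeneity\<close>

text \<open>Separates the interpolation nodes \<open>a\<close>, \<open>- a - g\<close>,
  \<open>ze\<close> and \<open>- th - ze\<close> modulo the lattice. The case \<open>a = b\<close>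
  of the sum condition also gives the denominator \<open>br (2 * a + g)\<close>.\<close>

definition generic_spectral :: "complex set \<Rightarrow> bool" where
  "generic_spectral A \<longleftrightarrow> (\<forall>a\<in>A. \<forall>b\<in>A. (a \<noteq> b \<longrightarrow> br (a - b) \<noteq> 0) \<and> br (a + b + g) \<noteq> 0)
     \<and> (\<forall>a\<in>A. br (a - ze) \<noteq> 0 \<and> br (a + th + ze) \<noteq> 0 \<and> br (a + g + ze) \<noteq> 0 \<and> br (a + g - th - ze) \<noteq> 0)"

lemma generic_spectral_mono: "generic_spectral A \<Longrightarrow> X \<subseteq> A \<Longrightarrow> generic_spectral X"
  unfolding generic_spectral_def by blast

definition plus_term :: "complex list \<Rightarrow> complex set \<Rightarrow> complex \<Rightarrow> complex" where
  "plus_term ms X z = br (z + ze) * br (th + ze - z) * (\<Prod>j\<leftarrow>ms. br (z - j + g) * br (z + j + g))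
     * (\<Prod>x\<in>X. br (x - z + g) * br (x + z) / (br (x - z) * br (x + z + g)))"

definition minus_term :: "complex list \<Rightarrow> complex set \<Rightarrow> complex \<Rightarrow> complex" where
  "minus_term ms X z = br (z - ze + g) * br (th + ze + z + g) * (\<Prod>j\<leftarrow>ms. br (z - j) * br (z + j))
     * (\<Prod>x\<in>X. br (z - x + g) * br (z + x + 2 * g) / (br (z - x) * br (z + x + g)))"

text \<open>The residue weight of assigning \<open>z\<close> to the last site, whose inhomogeneity
  is \<open>m\<close>, when the values \<open>X\<close> are left for the sites \<open>ms\<close>.
  Depending on \<open>X\<close> only as a set is what turns the sum over orderings into a
  recursion.\<close>

definition step_coeff :: "complex list \<Rightarrow> complex \<Rightarrow> complex set \<Rightarrow> complex \<Rightarrow> complex" where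
  "step_coeff ms m X z = (\<Prod>x\<in>X. br (x - m) * br (x + m + g)) * (br (2 * z) / br (2 * z + g))
     * (br (th + (of_nat (length ms) + 1) * g + z - m) * br (z + m + g) * plus_term ms X z
        - br (th + of_nat (length ms) * g - z - m) * br (z - m) * minus_term ms X z)"

lemma theta_fun_step_coeff:
  assumes "finite X" "card X = length ms"
  shows "theta_fun (2 * length ms + 2) (- th) (\<lambda>m. step_coeff ms m X z)"
proof -
  have 1: "theta_fun (2 * card X) (of_nat (card X) * g) (\<lambda>m. \<Prod>x\<in>X. br (x - m) * br (x + m + g))"
    using assms(1)
  proof (induction X)
    case empty show ?case by (simp add: theta_fun_const)
  next
    case (insert x X)
    have "theta_fun 2 g (\<lambda>m. br (x - m) * br (x + m + g))"
      by (rule theta_fun_eqI[OF theta_fun_mult[OF theta_fun_tf_minus[of x] theta_fun_tf_plus[of "x + g"]]]) (simp_all add: algebra_simps)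
    from theta_fun_mult[OF this insert.IH] show ?case
      by (rule theta_fun_eqI) (use insert in \<open>simp_all add: algebra_simps\<close>)
  qed
  let ?s = "- th - of_nat (length ms) * g"
  have 2: "theta_fun 2 ?s (\<lambda>m. br (th + (of_nat (length ms) + 1) * g + z - m) * br (z + m + g))"
    by (rule theta_fun_eqI[OF theta_fun_mult[OF theta_fun_tf_minus[of "th + (of_nat (length ms) + 1) * g + z"] theta_fun_tf_plus[of "z + g"]]])
       (simp_all add: algebra_simps)
  have 3: "theta_fun 2 ?s (\<lambda>m. br (th + of_nat (length ms) * g - z - m) * br (z - m))"
    by (rule theta_fun_eqI[OF theta_fun_mult[OF theta_fun_tf_minus[of "th + of_nat (length ms) * g - z"] theta_fun_tf_minus[of z]]])
       (simp_all add: algebra_simps)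
  have "theta_fun (2 * card X + 2) (of_nat (card X) * g + ?s) (\<lambda>m. step_coeff ms m X z)"
    unfolding step_coeff_def
    by (intro theta_fun_mult theta_fun_cmult2 1 theta_fun_diff 2 3)
  then show ?thesis by (rule theta_fun_eqI) (simp_all add: assms(2))
qed

text \<open>At each node one of the two terms dies: \<open>br (z - m)\<close> kills the minus term
  at \<open>m = z\<close>, and \<open>br (z + m + g)\<close> the plus term at
  \<open>m = - z - g\<close>. The product over \<open>X\<close> cancels the denominators of the
  survivor.\<close>

lemma step_coeff_at:
  assumes X: "finite X" and ne: "br (2 * z + g) \<noteq> 0" "\<And>x. x \<in> X \<Longrightarrow> br (x - z) \<noteq> 0 \<and> br (x + z + g) \<noteq> 0"
  shows "step_coeff ms z X z = br (th + (of_nat (length ms) + 1) * g) * br (2 * z) * br (z + ze) * br (th + ze - z)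
      * (\<Prod>j\<leftarrow>ms. br (z - j + g) * br (z + j + g)) * (\<Prod>x\<in>X. br (x - z + g) * br (x + z))"
    and "step_coeff ms (- z - g) X z = - br (th + (of_nat (length ms) + 1) * g) * br (2 * z) * br (z - ze + g) * br (th + ze + z + g)
      * (\<Prod>j\<leftarrow>ms. br (z - j) * br (z + j)) * (\<Prod>x\<in>X. br (x - z - g) * br (x + z + 2 * g))"
proof -
  have p1: "(\<Prod>x\<in>X. br (x - z) * br (x + z + g)) * (\<Prod>x\<in>X. br (x - z + g) * br (x + z) / (br (x - z) * br (x + z + g)))
      = (\<Prod>x\<in>X. br (x - z + g) * br (x + z))"
    unfolding prod.distrib[symmetric] by (intro prod.cong refl) (use ne in simp)
  have m: "br (x - (- z - g)) = br (x + z + g)" "br (x + (- z - g) + g) = br (x - z)" for x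
    by (simp_all add: algebra_simps)
  have sw: "br (z - x) = - br (x - z)" "br (z - x + g) = - br (x - z - g)" for x
    using tf_minus[of "x - z"] tf_minus[of "x - z - g"] by (simp_all add: algebra_simps)
  have p2: "(\<Prod>x\<in>X. br (x - (- z - g)) * br (x + (- z - g) + g)) * (\<Prod>x\<in>X. br (z - x + g) * br (z + x + 2 * g) / (br (z - x) * br (z + x + g)))
      = (\<Prod>x\<in>X. br (x - z - g) * br (x + z + 2 * g))"
    unfolding prod.distrib[symmetric] m sw by (intro prod.cong refl) (use ne in \<open>simp add: add.commute[of z]\<close>)
  show "step_coeff ms z X z = br (th + (of_nat (length ms) + 1) * g) * br (2 * z) * br (z + ze) * br (th + ze - z)
      * (\<Prod>j\<leftarrow>ms. br (z - j + g) * br (z + j + g)) * (\<Prod>x\<in>X. br (x - z + g) * br (x + z))"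
    unfolding step_coeff_def plus_term_def p1[symmetric] using ne(1) by (simp add: mult_2[symmetric])
  have "z - (- z - g) = 2 * z + g" "z + (- z - g) + g = 0" "th + of_nat (length ms) * g - z - (- z - g) = th + (of_nat (length ms) + 1) * g"
    by (simp_all add: algebra_simps)
  then show "step_coeff ms (- z - g) X z = - br (th + (of_nat (length ms) + 1) * g) * br (2 * z) * br (z - ze + g) * br (th + ze + z + g)
      * (\<Prod>j\<leftarrow>ms. br (z - j) * br (z + j)) * (\<Prod>x\<in>X. br (x - z - g) * br (x + z + 2 * g))"
    unfolding step_coeff_def minus_term_def p2[symmetric] using ne(1) by simp
qed

text \<open>The Lagrange property: at the nodes of \<open>x\<close> every summand with
  \<open>z \<noteq> x\<close> vanishes, because \<open>x\<close> then belongs to its remaining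
  set.\<close>

lemma step_coeff_zero:
  assumes "finite X" "x \<in> X"
  shows "step_coeff ms x X z = 0" "step_coeff ms (- x - g) X z = 0"
proof -
  have "(\<Prod>y\<in>X. br (y - x) * br (y + x + g)) = 0"
    by (rule prod_zero[OF assms(1)], rule bexI[OF _ assms(2)]) simp
  moreover have "(\<Prod>y\<in>X. br (y - (- x - g)) * br (y + (- x - g) + g)) = 0"
    by (rule prod_zero[OF assms(1)], rule bexI[OF _ assms(2)]) simp
  ultimately show "step_coeff ms x X z = 0" "step_coeff ms (- x - g) X z = 0"
    unfolding step_coeff_def by simp_all
qed

lemma prod_list_distinct: "distinct xs \<Longrightarrow> (\<Prod>x\<leftarrow>xs. F x) = (\<Prod>x\<in>set xs. F x :: complex)"
  by (rule prod.distinct_set_conv_list[symmetric])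

text \<open>The boundary factor of the reduced \<open>Z\<close> is
  \<open>br (ze - m) * br (th + ze + m)\<close> at both kinds of nodes, that of the matching term of
  \<open>step_coeff\<close> is \<open>br (ze + m) * br (th + ze - m)\<close>. Their ratio is thus
  one function of \<open>m\<close>, and clearing it makes both sides entire.\<close>

lemma Z_recursion:
  assumes adm: "admissible (length ms + 2)" and gb: generic_boundary and len: "length ls = Suc (length ms)"
    and dist: "distinct ls" and gs: "generic_spectral (set ls)"
  shows "br (th + (of_nat (length ms) + 1) * g) * (br (ze + m) * br (th + ze - m)) * Z ls (ms @ [m])
    = site_const (length ms) * (br (ze - m) * br (th + ze + m)) * (\<Sum>z\<in>set ls. step_coeff ms m (set ls - {z}) z * Z (remove1 z ls) ms)"
proof -
  let ?n = "length ms" and ?A = "set ls"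
  let ?t = "br (th + (of_nat (length ms) + 1) * g)"
  let ?L = "\<lambda>m. ?t * (br (ze + m) * br (th + ze - m)) * Z ls (m # ms)"
  let ?S = "\<lambda>m. \<Sum>z\<in>?A. step_coeff ms m (?A - {z}) z * Z (remove1 z ls) ms"
  let ?R = "\<lambda>m. site_const ?n * (br (ze - m) * br (th + ze + m)) * ?S m"
  have front: "Z ls (ms @ [m]) = Z ls (m # ms)" for m
    using Z_site_to_front[of ms "[]" ls m] adm by simp
  have card: "card (?A - {z}) = ?n" if "z \<in> ?A" for z
    using that dist len by (simp add: distinct_card)
  have tL: "theta_fun (2 * ?n + 4) 0 ?L"
    by (rule theta_fun_eqI[OF theta_fun_cmult[OF theta_fun_mult[OF theta_fun_mult[OF theta_fun_tf_plus[of ze] theta_fun_tf_minus[of "th + ze"]] theta_fun_Z_site[OF len]], of ?t]])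
       (simp_all add: len add.commute mult.assoc)
  have tS: "theta_fun (2 * ?n + 2) (- th) ?S"
    by (intro theta_fun_sum theta_fun_cmult2 theta_fun_step_coeff) (use card in auto)
  have tR: "theta_fun (2 * ?n + 4) 0 ?R"
    by (rule theta_fun_eqI[OF theta_fun_cmult[OF theta_fun_mult[OF theta_fun_mult[OF theta_fun_tf_minus[of ze] theta_fun_tf_plus[of "th + ze"]] tS], of "site_const ?n"]])
       (simp_all add: add_ac mult.assoc)
  have split: "?L z = ?R z \<and> ?L (- z - g) = ?R (- z - g)" if z: "z \<in> ?A" for z
  proof -
    obtain xs ys where ls: "ls = xs @ z # ys" "z \<notin> set xs" using split_list_first[OF z] by blast
    have rem: "remove1 z ls = xs @ ys" using ls by (simp add: remove1_append)
    have set: "set (xs @ ys) = ?A - {z}" and d: "distinct (xs @ ys)" using dist ls by auto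
    have len': "length (xs @ ys) = ?n" using len ls by simp
    have Zf: "Z ls (m # ms) = Z (z # xs @ ys) (m # ms)" for m
      unfolding ls by (rule Z_spectral_to_front) (use adm gb len ls in simp_all)
    have ne: "br (2 * z + g) \<noteq> 0" using gs z unfolding generic_spectral_def by (metis mult_2)
    have ne': "br (x - z) \<noteq> 0 \<and> br (x + z + g) \<noteq> 0" if "x \<in> ?A - {z}" for x
      using gs z that unfolding generic_spectral_def by blast
    have sc: "?S q = step_coeff ms q (?A - {z}) z * Z (remove1 z ls) ms" if "q = z \<or> q = - z - g" for q
    proof -
      have "?S q = (\<Sum>x\<in>?A. if x = z then step_coeff ms q (?A - {x}) x * Z (remove1 x ls) ms else 0)"
        by (intro sum.cong refl) (use that z step_coeff_zero in auto)
      then show ?thesis using z by (simp add: sum.delta')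
    qed
    have adm': "admissible ?n" using adm admissible_mono by simp
    note at = step_coeff_at[of "?A - {z}" z ms, OF _ ne ne', simplified]
    have sw: "br (ze - z - g) = - br (z - ze + g)" using tf_minus[of "z - ze + g"] by (simp add: algebra_simps)
    have c: "(\<Prod>j\<leftarrow>ms. br (z + j + g) * br (z - j + g)) = (\<Prod>j\<leftarrow>ms. br (z - j + g) * br (z + j + g))"
       "(\<Prod>j\<leftarrow>ms. br (z + j) * br (z - j)) = (\<Prod>j\<leftarrow>ms. br (z - j) * br (z + j))"
       "(\<Prod>x\<in>?A - {z}. br (x + z + 2 * g) * br (x - z - g)) = (\<Prod>x\<in>?A - {z}. br (x - z - g) * br (x + z + 2 * g))"
      by (simp_all add: mult.commute)
    have e: "ze + (- z - g) = ze - z - g" "th + ze - (- z - g) = th + ze + z + g" "ze - (- z - g) = ze + z + g"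
      "th + ze + (- z - g) = th + ze - z - g" by simp_all
    have "?L z = ?R z"
      unfolding sc[OF disjI1[OF refl]] Zf Z_at_site[OF len' adm'] at(1) rem prod_list_distinct[OF d] set c
      by (simp add: mult_ac add.commute)
    moreover have "?L (- z - g) = ?R (- z - g)"
      unfolding sc[OF disjI2[OF refl]] Zf Z_at_reflected_site[OF len' adm'] at(2) rem prod_list_distinct[OF d] set c
      unfolding e sw by (simp add: mult_ac add_ac)
    ultimately show ?thesis by blast
  qed
  have Z0: "Z ls (q # ms) = 0" if "br (ze - q) = 0 \<or> br (th + ze + q) = 0" for q
    using Z_innermost_zero[OF that, of ls ms] front by simp
  let ?ps = "ls @ map (\<lambda>z. - z - g) ls @ [ze, - th - ze]"
  have "?L m - ?R m = 0"
  proof (rule theta_fun_interpolation[OF theta_fun_diff[OF tL tR], of ?ps])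
    show "length ?ps = 2 * ?n + 4" using len by simp
    show "\<forall>p\<in>set ?ps. ?L p - ?R p = 0" using split Z0[of ze] Z0[of "- th - ze"] by auto
    have s: "sum_list (map (\<lambda>m. - m - g) xs) = - sum_list xs - of_nat (length xs) * g" for xs :: "complex list"
      by (induction xs) (simp_all add: algebra_simps)
    have sum: "0 + sum_list ?ps = - (th + (of_nat ?n + 1) * g)"
      using len by (simp add: s algebra_simps)
    show "br (0 + sum_list ?ps) \<noteq> 0"
      unfolding sum tf_minus using adm[unfolded admissible_def, rule_format, of "int ?n + 1"] by simp
    have 1: "sorted_wrt (\<lambda>p q. br (p - q) \<noteq> 0) ls"
      using dist gs unfolding sorted_wrt_iff_nth_less generic_spectral_def by (auto simp: distinct_conv_nth)
    have 2: "sorted_wrt (\<lambda>p q. br (p - q) \<noteq> 0) (map (\<lambda>z. - z - g) ls)"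
      unfolding sorted_wrt_map by (rule sorted_wrt_mono_rel[OF _ 1]) (simp add: br_minus_iff)
    have 3: "br (a - (- b - g)) \<noteq> 0" if "a \<in> ?A" "b \<in> ?A" for a b
      using gs that unfolding generic_spectral_def by (auto simp: algebra_simps)
    have 4: "br (a - ze) \<noteq> 0" "br (a - (- th - ze)) \<noteq> 0" "br (- a - g - ze) \<noteq> 0" "br (- a - g - (- th - ze)) \<noteq> 0" if "a \<in> ?A" for a
    proof -
      have h: "br (a - ze) \<noteq> 0" "br (a + th + ze) \<noteq> 0" "br (- (a + g + ze)) \<noteq> 0" "br (- (a + g - th - ze)) \<noteq> 0"
        using gs that unfolding generic_spectral_def by (simp_all only: tf_minus) auto
      have e: "a - (- th - ze) = a + th + ze" "- a - g - ze = - (a + g + ze)" "- a - g - (- th - ze) = - (a + g - th - ze)" by simp_all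
      show "br (a - ze) \<noteq> 0" "br (a - (- th - ze)) \<noteq> 0" "br (- a - g - ze) \<noteq> 0" "br (- a - g - (- th - ze)) \<noteq> 0"
        unfolding e using h by blast+
    qed
    have "br (2 * ze + th) \<noteq> 0" using gb by (simp add: generic_boundary_def)
    moreover have "ze - (- th - ze) = 2 * ze + th" by simp
    ultimately have 5: "br (ze - (- th - ze)) \<noteq> 0" by (simp only:) blast
    show "sorted_wrt (\<lambda>p q. br (p - q) \<noteq> 0) ?ps"
      unfolding sorted_wrt_append using 1 2 3 4 5 by auto
  qed
  then show ?thesis using front by simp
qed

text \<open>The two divisors are the denominators of \<open>mfun\<close> that
  \<open>step_coeff\<close> leaves out.\<close>

primrec perm_sum :: "(nat \<Rightarrow> complex) \<Rightarrow> nat \<Rightarrow> complex set \<Rightarrow> complex" where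
  "perm_sum mu 0 A = 1"
| "perm_sum mu (Suc n) A = (\<Sum>z\<in>A. step_coeff (map mu [1..<Suc n]) (mu (Suc n)) (A - {z}) z
     / (br (th + ze + z) * br (th + of_nat n * g)) * perm_sum mu n (A - {z}))"

text \<open>Collects everything the recursion produces that is free of spectral parameters;
  \<open>br (th + of_nat n * g)\<close> compensates a divisor in \<open>perm_sum\<close>.\<close>

primrec prefactor :: "(nat \<Rightarrow> complex) \<Rightarrow> nat \<Rightarrow> complex" where
  "prefactor mu 0 = 1"
| "prefactor mu (Suc n) = prefactor mu n * br (th + of_nat n * g) * site_const n / br (th + (of_nat n + 1) * g)
     * (br (ze - mu (Suc n)) * br (th + ze + mu (Suc n))) / (br (ze + mu (Suc n)) * br (th + ze - mu (Suc n)))"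

theorem Z_eq_perm_sum:
  assumes "admissible (n + 1)" generic_boundary "length ls = n" "distinct ls" "generic_spectral (set ls)"
    "\<And>j. j \<in> {1..n} \<Longrightarrow> br (ze + mu j) * br (th + ze - mu j) \<noteq> 0"
  shows "Z ls (map mu [1..<Suc n]) = prefactor mu n * (\<Prod>z\<in>set ls. br (th + ze + z)) * perm_sum mu n (set ls)"
  using assms(1,3-)
proof (induction n arbitrary: ls)
  case 0
  then show ?case by (simp add: Z_def P_def opid_def)
next
  case (Suc n)
  let ?ms = "map mu [1..<Suc n]" and ?m = "mu (Suc n)" and ?A = "set ls"
  have lm: "length ?ms = n" by (simp del: upt_Suc)
  have adm: "admissible (length ?ms + 2)" unfolding lm using Suc.prems(1) by simp
  have t: "br (th + (of_nat n + 1) * g) \<noteq> 0" "br (th + of_nat n * g) \<noteq> 0"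
    using Suc.prems(1)[unfolded admissible_def, rule_format, of "int n + 1"] Suc.prems(1)[unfolded admissible_def, rule_format, of "int n"]
    by simp_all
  have m: "br (ze + ?m) * br (th + ze - ?m) \<noteq> 0" using Suc.prems(5) by simp
  have zt: "br (th + ze + z) \<noteq> 0" if "z \<in> ?A" for z
    using Suc.prems(4) that unfolding generic_spectral_def by (auto simp: algebra_simps)
  let ?P = "\<Prod>z\<in>?A. br (th + ze + z)"
  have IH: "Z (remove1 z ls) ?ms = prefactor mu n * (?P / br (th + ze + z)) * perm_sum mu n (?A - {z})" if z: "z \<in> ?A" for z
  proof -
    have s: "set (remove1 z ls) = ?A - {z}" using Suc.prems(3) by simp
    have "?P = br (th + ze + z) * (\<Prod>z\<in>?A - {z}. br (th + ze + z))"
      using z by (intro prod.remove) auto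
    moreover have "Z (remove1 z ls) ?ms = prefactor mu n * (\<Prod>z\<in>set (remove1 z ls). br (th + ze + z)) * perm_sum mu n (set (remove1 z ls))"
    proof (rule Suc.IH)
      show "admissible (n + 1)" using Suc.prems(1) admissible_mono by simp
      show "generic_spectral (set (remove1 z ls))"
        by (rule generic_spectral_mono[OF Suc.prems(4)]) (auto simp: s)
    qed (use Suc.prems z in \<open>auto simp: length_remove1 distinct_remove1\<close>)
    ultimately show ?thesis using zt[OF z] unfolding s by simp
  qed
  have "map mu [1..<Suc (Suc n)] = ?ms @ [?m]" by simp
  then have "br (th + (of_nat n + 1) * g) * (br (ze + ?m) * br (th + ze - ?m)) * Z ls (map mu [1..<Suc (Suc n)])
    = site_const n * (br (ze - ?m) * br (th + ze + ?m)) * (\<Sum>z\<in>?A. step_coeff ?ms ?m (?A - {z}) z * Z (remove1 z ls) ?ms)"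
    using Z_recursion[OF adm assms(2) _ Suc.prems(3,4), of ?m, unfolded lm] Suc.prems(2) by (simp del: upt_Suc)
  also have "(\<Sum>z\<in>?A. step_coeff ?ms ?m (?A - {z}) z * Z (remove1 z ls) ?ms)
    = prefactor mu n * ?P * br (th + of_nat n * g) * perm_sum mu (Suc n) ?A"
    unfolding perm_sum.simps sum_distrib_left
    by (intro sum.cong refl) (simp add: IH[simplified One_nat_def] t(2) del: upt_Suc)
  finally show ?case using t m by (simp add: field_simps del: upt_Suc perm_sum.simps)
qed

end

section \<open>Matching the operator products with the recursive matrix elements\<close>

lemma nth_two_updates:
  assumes "0 < k" "k < length x"
  shows "x[0 := c, k := t] ! i = (if i = k then t else if i = 0 then c else x ! i)"
proof -
  have "0 < length x" using assms by linarith
  then show ?thesis using assms by (cases "i = k"; cases "i = 0") simp_all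
qed

text \<open>An \<open>R\<close> acting on the auxiliary space and site \<open>k\<close> fixes all
  other spins, so the sum over intermediate configurations has only four terms.\<close>

lemma sum_two_updates:
  fixes F G :: "bool list \<Rightarrow> complex"
  assumes "length x = n" "0 < k" "k < n"
    and G: "\<And>z. length z = n \<Longrightarrow> \<not> (\<forall>i<n. i \<noteq> 0 \<and> i \<noteq> k \<longrightarrow> x ! i = z ! i) \<Longrightarrow> G z = 0"
  shows "(\<Sum>z\<in>{z. length z = n}. G z) = (\<Sum>c\<in>UNIV. \<Sum>t\<in>UNIV. G (x[0 := c, k := t]))"
proof -
  let ?f = "\<lambda>(c, t). x[0 := c, k := t]"
  have inj: "inj ?f"
  proof (rule injI, clarify)
    fix c t c' t' assume e: "x[0 := c, k := t] = x[0 := c', k := t']"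
    have "x[0 := c, k := t] ! 0 = x[0 := c', k := t'] ! 0" "x[0 := c, k := t] ! k = x[0 := c', k := t'] ! k"
      by (simp_all only: e)
    then show "c = c' \<and> t = t'" using assms(1-3) by auto
  qed
  have "(\<Sum>z\<in>{z. length z = n}. G z) = (\<Sum>z\<in>range ?f. G z)"
  proof (rule sum.mono_neutral_right)
    show "range ?f \<subseteq> {z. length z = n}" using assms(1) by auto
    show "\<forall>z\<in>{z. length z = n} - range ?f. G z = 0"
    proof
      fix z assume z: "z \<in> {z. length z = n} - range ?f"
      show "G z = 0"
      proof (rule G)
        show "\<not> (\<forall>i<n. i \<noteq> 0 \<and> i \<noteq> k \<longrightarrow> x ! i = z ! i)"
        proof
          assume "\<forall>i<n. i \<noteq> 0 \<and> i \<noteq> k \<longrightarrow> x ! i = z ! i"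
          then have "z = ?f (z ! 0, z ! k)"
            using z assms(1-3) by (auto intro!: nth_equalityI simp: nth_two_updates split: if_splits)
          then show False using z by blast
        qed
      qed (use z in simp)
    qed
  qed simp
  also have "\<dots> = (\<Sum>p\<in>UNIV. G (?f p))" using inj by (simp add: sum.reindex)
  also have "\<dots> = (\<Sum>c\<in>UNIV. \<Sum>t\<in>UNIV. G (x[0 := c, k := t]))"
    by (subst sum_bool_pair[where F = "\<lambda>c t. G (x[0 := c, k := t])"]) (simp add: case_prod_beta)
  finally show ?thesis .
qed

lemma Rop_update_left:
  assumes "length x = n" "0 < k" "k < n" "S \<subseteq> {k<..<n}"
  shows "Rop tau g n 0 k S l th x (x[0 := c, k := t]) = Rmat tau g l (th - g * (\<Sum>i\<in>S. hval (x ! i))) (x ! 0, x ! k) (c, t)"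
proof -
  have "(\<Sum>i\<in>S. hval (x[0 := c, k := t] ! i)) = (\<Sum>i\<in>S. hval (x ! i))"
    using assms by (intro sum.cong refl) (auto simp: nth_two_updates)
  then show ?thesis using assms by (simp add: Rop_def nth_two_updates)
qed

lemma Rop_update_right:
  assumes "length y = n" "0 < k" "k < n"
  shows "Rop tau g n k 0 S l th (y[0 := d, k := t]) y = Rmat tau g l (th - g * (\<Sum>i\<in>S. hval (y ! i))) (t, d) (y ! k, y ! 0)"
  using assms by (simp add: Rop_def nth_two_updates)

lemma sum_hval_drop:
  assumes "length x = Suc L"
  shows "(\<Sum>i\<in>{k + 1..L}. hval (x ! i)) = hsum (drop (Suc k) x)"
proof -
  have "hsum (drop (Suc k) x) = (\<Sum>i<length (drop (Suc k) x). hval (drop (Suc k) x ! i))"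
    unfolding hsum_def sum_list_sum_nth by (simp add: atLeast0LessThan)
  also have "\<dots> = (\<Sum>i<L - k. hval (x ! (Suc k + i)))"
    using assms by (intro sum.cong) (auto simp: nth_drop)
  also have "\<dots> = (\<Sum>i\<in>{k + 1..L}. hval (x ! i))"
    by (rule sum.reindex_bij_witness[of _ "\<lambda>i. i - Suc k" "\<lambda>i. Suc k + i"]) auto
  finally show ?thesis by simp
qed

context sos
begin

definition Kful :: "complex \<Rightarrow> bool \<Rightarrow> complex" where
  "Kful l a = (if a then br (ze + l) * br (th + ze - l) / br (th + ze + l) else br (ze - l))"

text \<open>The factors of the double-row monodromy matrix that act on the sites \<open>k, \<dots>, L\<close>.\<close>
definition inner_part :: "nat \<Rightarrow> (nat \<Rightarrow> complex) \<Rightarrow> complex \<Rightarrow> nat \<Rightarrow> cop" where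
  "inner_part L mu l k = opmul (L + 1) (opmul (L + 1)
      (opprod (L + 1) (map (\<lambda>k. Rop tau g (L + 1) 0 k {k + 1..L} (l - mu k) th) [k..<L + 1])) (Kop tau ze l th))
      (opprod (L + 1) (map (\<lambda>k. Rop tau g (L + 1) k 0 {k + 1..L} (l + mu k) th) (rev [k..<L + 1])))"

lemma inner_part_step:
  assumes k: "1 \<le> k" "k \<le> L" and len: "length x = L + 1" "length y = L + 1"
  shows "inner_part L mu l k x y = (\<Sum>c\<in>UNIV. \<Sum>t\<in>UNIV. \<Sum>d\<in>UNIV. \<Sum>t'\<in>UNIV.
      R (l - mu k) (th - g * hsum (drop (Suc k) x)) (x ! 0, x ! k) (c, t)
      * inner_part L mu l (Suc k) (x[0 := c, k := t]) (y[0 := d, k := t'])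
      * R (l + mu k) (th - g * hsum (drop (Suc k) y)) (t', d) (y ! k, y ! 0))"
proof -
  let ?n = "L + 1"
  let ?A = "\<lambda>k. Rop tau g ?n 0 k {k + 1..L} (l - mu k) th"
  let ?C = "\<lambda>k. Rop tau g ?n k 0 {k + 1..L} (l + mu k) th"
  let ?G = "inner_part L mu l (Suc k)"
  have up: "[k..<L + 1] = k # [Suc k..<L + 1]" using k by (simp add: upt_conv_Cons)
  have "opprod ?n (map ?C (rev [k..<L + 1])) z y = opmul ?n (opprod ?n (map ?C (rev [Suc k..<L + 1]))) (?C k) z y" if "length z = ?n" for z
  proof -
    have "opprod ?n (map ?C (rev [k..<L + 1])) z y = opmul ?n (opprod ?n (map ?C (rev [Suc k..<L + 1]))) (opmul ?n (?C k) opid) z y"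
      unfolding up using opprod_append[OF that] by simp
    also have "\<dots> = opmul ?n (opprod ?n (map ?C (rev [Suc k..<L + 1]))) (?C k) z y"
      unfolding opmul_def[of _ "opprod ?n _"] using len(2) by (simp add: opmul_id_right)
    finally show ?thesis .
  qed
  then have "inner_part L mu l k x y = opmul ?n (opmul ?n (opprod ?n (map ?A [k..<L + 1])) (Kop tau ze l th))
      (opmul ?n (opprod ?n (map ?C (rev [Suc k..<L + 1]))) (?C k)) x y"
    unfolding inner_part_def opmul_def[of ?n "opmul ?n _ (Kop tau ze l th)"] by simp
  also have "\<dots> = opmul ?n (?A k) (opmul ?n ?G (?C k)) x y"
    unfolding inner_part_def up list.map opprod.simps opmul_assoc ..
  also have "\<dots> = (\<Sum>z\<in>{z. length z = ?n}. ?A k x z * opmul ?n ?G (?C k) z y)"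
    by (simp add: opmul_def)
  also have "\<dots> = (\<Sum>c\<in>UNIV. \<Sum>t\<in>UNIV. ?A k x (x[0 := c, k := t]) * opmul ?n ?G (?C k) (x[0 := c, k := t]) y)"
    by (rule sum_two_updates) (use k len in \<open>auto simp: Rop_def\<close>)
  also have "\<dots> = (\<Sum>c\<in>UNIV. \<Sum>t\<in>UNIV. R (l - mu k) (th - g * hsum (drop (Suc k) x)) (x ! 0, x ! k) (c, t)
      * opmul ?n ?G (?C k) (x[0 := c, k := t]) y)"
    using Rop_update_left[OF len(1), of k "{k + 1..L}"] k sum_hval_drop[of x L k] len by (simp add: atLeastAtMost_iff subset_iff)
  also have "\<dots> = (\<Sum>c\<in>UNIV. \<Sum>t\<in>UNIV. R (l - mu k) (th - g * hsum (drop (Suc k) x)) (x ! 0, x ! k) (c, t)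
      * (\<Sum>d\<in>UNIV. \<Sum>t'\<in>UNIV. ?G (x[0 := c, k := t]) (y[0 := d, k := t']) * ?C k (y[0 := d, k := t']) y))"
  proof -
    have "opmul ?n ?G (?C k) z y = (\<Sum>d\<in>UNIV. \<Sum>t'\<in>UNIV. ?G z (y[0 := d, k := t']) * ?C k (y[0 := d, k := t']) y)" for z
      unfolding opmul_def by (rule sum_two_updates) (use k len in \<open>auto simp: Rop_def\<close>)
    then show ?thesis by simp
  qed
  also have "\<dots> = (\<Sum>c\<in>UNIV. \<Sum>t\<in>UNIV. \<Sum>d\<in>UNIV. \<Sum>t'\<in>UNIV.
      R (l - mu k) (th - g * hsum (drop (Suc k) x)) (x ! 0, x ! k) (c, t)
      * ?G (x[0 := c, k := t]) (y[0 := d, k := t'])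
      * R (l + mu k) (th - g * hsum (drop (Suc k) y)) (t', d) (y ! k, y ! 0))"
  proof -
    have "?C k (y[0 := d, k := t']) y = R (l + mu k) (th - g * hsum (drop (Suc k) y)) (t', d) (y ! k, y ! 0)" for d t'
      using Rop_update_right[OF len(2), of k] k sum_hval_drop[of y L k] len by simp
    then show ?thesis by (simp only: sum_distrib_left mult.assoc)
  qed
  finally show ?thesis .
qed

text \<open>Downward induction on \<open>k\<close> attaches the sites from the boundary outwards. At
  \<open>k = L + 1\<close> both products are empty and only \<open>K\<close> remains; sites before
  \<open>k\<close> are untouched, so their spins must agree.\<close>

lemma inner_part_eq_dbl:
  assumes "1 \<le> k" "k \<le> L + 1" "length x = L + 1" "length y = L + 1"
  shows "inner_part L mu l k x y = (if \<forall>i\<in>{1..<k}. x ! i = y ! i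
     then dbl Kful (map mu [k..<L + 1]) l (x ! 0) (drop k x) (y ! 0) (drop k y) else 0)"
  using assms(2,1,3,4)
proof (induction k arbitrary: x y rule: inc_induct)
  case base
  have "(\<forall>i\<in>{1..<L + 1}. x ! i = y ! i) \<and> x ! 0 = y ! 0 \<longleftrightarrow> x = y"
  proof
    assume a: "(\<forall>i\<in>{1..<L + 1}. x ! i = y ! i) \<and> x ! 0 = y ! 0"
    show "x = y"
    proof (rule nth_equalityI)
      fix i assume "i < length x"
      then show "x ! i = y ! i" using a base by (cases "i = 0") auto
    qed (use base in simp)
  qed simp
  moreover have "inner_part L mu l (L + 1) x y = Kop tau ze l th x y"
    using base by (simp add: inner_part_def opmul_id_right) (simp add: opmul_def[of _ opid] opmul_id_left[unfolded opmul_def])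
  ultimately show ?case using base by (auto simp: Kop_def Kful_def)
next
  case (step k)
  have k: "1 \<le> k" "k \<le> L" using step by auto
  have dx: "drop k x = x ! k # drop (Suc k) x" "drop k y = y ! k # drop (Suc k) y"
    using k step.prems by (simp_all add: Cons_nth_drop_Suc)
  have up: "[k..<L + 1] = k # [Suc k..<L + 1]" using k by (simp add: upt_conv_Cons)
  let ?d = "\<lambda>c d. dbl Kful (map mu [Suc k..<L + 1]) l c (drop (Suc k) x) d (drop (Suc k) y)"
  have IH: "inner_part L mu l (Suc k) (x[0 := c, k := t]) (y[0 := d, k := t'])
      = (if (\<forall>i\<in>{1..<k}. x ! i = y ! i) \<and> t = t' then ?d c d else 0)" for c t d t'
  proof -
    have "(\<forall>i\<in>{1..<Suc k}. x[0 := c, k := t] ! i = y[0 := d, k := t'] ! i) \<longleftrightarrow> (\<forall>i\<in>{1..<k}. x ! i = y ! i) \<and> t = t'"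
      using k step.prems by (auto simp: nth_two_updates atLeastLessThanSuc)
    then show ?thesis using step.IH[of "x[0 := c, k := t]" "y[0 := d, k := t']"] k step.prems by (simp add: nth_two_updates)
  qed
  show ?case
    unfolding inner_part_step[OF k step.prems(2,3)] IH dx up
    by (simp add: UNIV_bool del: upt_Suc)
qed

lemma Tdouble_eq_dbl:
  assumes "length u' = L" "length u = L"
  shows "Tdouble tau g ze th L mu l (a # u') (b # u) = dbl Kful (map mu [1..<L + 1]) l a u' b u"
  using inner_part_eq_dbl[of 1 L "a # u'" "b # u" mu l] assms
  by (simp add: inner_part_def Tdouble_def Tmono_def Tbar_def del: upt_Suc)

lemma dbl_Kful:
  assumes "br (th + ze + l) \<noteq> 0"
  shows "D ms l a u' b u = br (th + ze + l) * dbl Kful ms l a u' b u"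
proof (induction ms arbitrary: a u' b u)
  case Nil
  then show ?case using assms by (simp add: Kred_def Kful_def)
next
  case (Cons m ms)
  then show ?case by (cases u'; cases u) (simp_all add: sum_distrib_left mult_ac)
qed

lemma Zpart_eq_Z:
  assumes "\<And>j. j \<in> {1..L} \<Longrightarrow> br (th + ze + lam j) \<noteq> 0"
  shows "Z (map lam [1..<L + 1]) (map mu [1..<L + 1]) = (\<Prod>j\<in>{1..L}. br (th + ze + lam j)) * Zpart tau g ze th L mu lam"
proof -
  let ?ms = "map mu [1..<L + 1]"
  have "opprod L (map (B ?ms) (map lam js)) u' u = (\<Prod>j\<leftarrow>js. br (th + ze + lam j)) * opprod L (map (\<lambda>j. Bop tau g ze th L mu (lam j)) js) u' u"
    if "set js \<subseteq> {1..L}" "length u' = L" "length u = L" for js u' u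
    using that(1,2)
  proof (induction js arbitrary: u')
    case (Cons j js)
    have "B ?ms (lam j) u' z = br (th + ze + lam j) * Bop tau g ze th L mu (lam j) u' z" if "length z = L" for z
      using Cons.prems that assms by (simp add: B_def Bop_def Tdouble_eq_dbl dbl_Kful del: upt_Suc)
    then show ?case using Cons by (simp add: opmul_def sum_distrib_left mult_ac del: upt_Suc)
  qed simp
  from this[of "[1..<L + 1]" "replicate L False" "replicate L True"]
  show ?thesis
    by (simp add: Z_def P_def Zpart_def prod.distinct_set_conv_list[symmetric] atLeastLessThanSuc_atLeastAtMost del: upt_Suc)
qed

end

section \<open>From iterated contour integrals to sums over orderings\<close>

text \<open>Iterated sums over a finite set of weighted points, the discrete counterpart of \<open>mint\<close>.\<close>
definition point_sum :: "complex set \<Rightarrow> (complex \<Rightarrow> complex) \<Rightarrow> (complex \<Rightarrow> complex) \<Rightarrow> complex" where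
  "point_sum A c h = (\<Sum>a\<in>A. c a * h a)"

lemma mint_point_sum_Suc:
  "mint (point_sum A c) (Suc k) H = (\<Sum>a\<in>A. c a * mint (point_sum A c) k (\<lambda>z. H (z(Suc k := a))))"
  by (simp only: mint.simps) (rule point_sum_def)

declare mint.simps(2) [simp del]

lemma mint_point_sum_divide: "mint (point_sum A c) k (\<lambda>z. H z / d) = mint (point_sum A c) k H / d"
  by (induction k arbitrary: H) (simp_all add: mint_point_sum_Suc sum_divide_distrib)

lemma mint_point_sum_mult: "mint (point_sum A c) k (\<lambda>z. d * H z) = d * mint (point_sum A c) k H"
  by (induction k arbitrary: H) (simp_all add: mint_point_sum_Suc sum_distrib_left mult_ac)

lemma mint_point_sum_zero: "mint (point_sum A c) k (\<lambda>z. 0) = 0"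
  using mint_point_sum_mult[of A c k 0 "\<lambda>_. 0"] by simp

lemma mint_point_sum_cong:
  assumes "\<And>z. (\<forall>i\<in>{1..k}. z i \<in> A) \<Longrightarrow> H z = H' z"
  shows "mint (point_sum A c) k H = mint (point_sum A c) k H'"
  using assms
proof (induction k arbitrary: H H')
  case (Suc k)
  have "mint (point_sum A c) k (\<lambda>z. H (z(Suc k := w))) = mint (point_sum A c) k (\<lambda>z. H' (z(Suc k := w)))" if "w \<in> A" for w
    by (rule Suc.IH) (rule Suc.prems, use that in \<open>auto simp: le_Suc_eq\<close>)
  then show ?case by (simp add: mint_point_sum_Suc)
qed simp

lemma mint_point_sum_holomorphic:
  assumes "\<And>z. (\<forall>i\<in>{1..k}. z i \<in> A) \<Longrightarrow> (\<lambda>w. H w z) holomorphic_on U"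
  shows "(\<lambda>w. mint (point_sum A c) k (H w)) holomorphic_on U"
  using assms
proof (induction k arbitrary: H)
  case (Suc k)
  have "(\<lambda>w. mint (point_sum A c) k (\<lambda>z. H w (z(Suc k := a)))) holomorphic_on U" if "a \<in> A" for a
    by (rule Suc.IH) (rule Suc.prems, use that in \<open>auto simp: le_Suc_eq\<close>)
  then show ?case by (auto simp: mint_point_sum_Suc intro!: holomorphic_intros)
qed simp

text \<open>Moves the residue weights into the summand, where their product will cancel the
  Vandermonde factor.\<close>

lemma mint_point_sum_weights:
  "mint (point_sum A c) k H = mint (point_sum A (\<lambda>_. 1)) k (\<lambda>z. (\<Prod>i\<in>{1..k}. c (z i)) * H z)"
proof (induction k arbitrary: H)
  case (Suc k)
  have "mint (point_sum A (\<lambda>_. 1)) k (\<lambda>z. (\<Prod>i\<in>{1..Suc k}. c ((z(Suc k := a)) i)) * H (z(Suc k := a)))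
      = c a * mint (point_sum A (\<lambda>_. 1)) k (\<lambda>z. (\<Prod>i\<in>{1..k}. c (z i)) * H (z(Suc k := a)))" for a
    unfolding mint_point_sum_mult[symmetric]
    by (rule mint_point_sum_cong) (simp add: prod.atLeast1_atMost_eq lessThan_Suc mult_ac)
  then show ?case unfolding mint_point_sum_Suc Suc.IH by simp
qed simp

lemma mint_point_sum_restrict:
  assumes "finite A" "X \<subseteq> A" "\<And>z. (\<forall>i\<in>{1..k}. z i \<in> A) \<Longrightarrow> \<exists>i\<in>{1..k}. z i \<notin> X \<Longrightarrow> H z = 0"
  shows "mint (point_sum A c) k H = mint (point_sum X c) k H"
  using assms(3)
proof (induction k arbitrary: H)
  case (Suc k)
  have 1: "mint (point_sum A c) k (\<lambda>z. H (z(Suc k := a))) = 0" if "a \<in> A - X" for a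
  proof -
    have "mint (point_sum A c) k (\<lambda>z. H (z(Suc k := a))) = mint (point_sum A c) k (\<lambda>z. 0)"
    proof (rule mint_point_sum_cong)
      fix z :: "nat \<Rightarrow> complex" assume "\<forall>i\<in>{1..k}. z i \<in> A"
      then show "H (z(Suc k := a)) = 0"
        using that by (intro Suc.prems bexI[of _ "Suc k"]) (auto simp: le_Suc_eq)
    qed
    then show ?thesis by (simp add: mint_point_sum_zero)
  qed
  have 2: "mint (point_sum A c) k (\<lambda>z. H (z(Suc k := a))) = mint (point_sum X c) k (\<lambda>z. H (z(Suc k := a)))" if "a \<in> X" for a
  proof (rule Suc.IH)
    fix z :: "nat \<Rightarrow> complex" assume z: "\<forall>i\<in>{1..k}. z i \<in> A" "\<exists>i\<in>{1..k}. z i \<notin> X"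
    then obtain i where "i \<in> {1..k}" "z i \<notin> X" by blast
    then show "H (z(Suc k := a)) = 0"
      using that z assms(2) by (intro Suc.prems bexI[of _ i]) (auto simp: le_Suc_eq)
  qed
  have "mint (point_sum A c) (Suc k) H = (\<Sum>a\<in>X. c a * mint (point_sum A c) k (\<lambda>z. H (z(Suc k := a))))"
    unfolding mint_point_sum_Suc
    by (rule sum.mono_neutral_right) (use assms 1 in auto)
  also have "\<dots> = mint (point_sum X c) (Suc k) H" by (simp add: 2 mint_point_sum_Suc)
  finally show ?case .
qed simp

primrec inj_sum :: "nat \<Rightarrow> complex set \<Rightarrow> ((nat \<Rightarrow> complex) \<Rightarrow> complex) \<Rightarrow> complex" where
  "inj_sum 0 A H = H (\<lambda>_. 0)"
| "inj_sum (Suc k) A H = (\<Sum>a\<in>A. inj_sum k (A - {a}) (\<lambda>z. H (z(Suc k := a))))"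

text \<open>For the actual integrand the Vandermonde factor kills repeated values, so each variable
  may exclude the values already chosen.\<close>

lemma mint_eq_inj_sum:
  assumes "finite A" "\<And>z. (\<forall>i\<in>{1..k}. z i \<in> A) \<Longrightarrow> \<not> inj_on z {1..k} \<Longrightarrow> H z = 0"
  shows "mint (point_sum A (\<lambda>_. 1)) k H = inj_sum k A H"
  using assms
proof (induction k arbitrary: A H)
  case (Suc k)
  have "mint (point_sum A (\<lambda>_. 1)) k (\<lambda>z. H (z(Suc k := a))) = inj_sum k (A - {a}) (\<lambda>z. H (z(Suc k := a)))" if a: "a \<in> A" for a
  proof -
    have "mint (point_sum A (\<lambda>_. 1)) k (\<lambda>z. H (z(Suc k := a))) = mint (point_sum (A - {a}) (\<lambda>_. 1)) k (\<lambda>z. H (z(Suc k := a)))"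
    proof (rule mint_point_sum_restrict)
      fix z :: "nat \<Rightarrow> complex" assume z: "\<forall>i\<in>{1..k}. z i \<in> A" "\<exists>i\<in>{1..k}. z i \<notin> A - {a}"
      then obtain i where i: "i \<in> {1..k}" "z i = a" by auto
      have ni: "\<not> inj_on (z(Suc k := a)) {1..Suc k}"
        using i inj_onD[of "z(Suc k := a)" "{1..Suc k}" i "Suc k"] by auto
      show "H (z(Suc k := a)) = 0" by (rule Suc.prems(2)[OF _ ni]) (use z a in \<open>auto simp: le_Suc_eq\<close>)
    qed (use Suc.prems in auto)
    also have "\<dots> = inj_sum k (A - {a}) (\<lambda>z. H (z(Suc k := a)))"
    proof (rule Suc.IH)
      fix z :: "nat \<Rightarrow> complex" assume z: "\<forall>i\<in>{1..k}. z i \<in> A - {a}" "\<not> inj_on z {1..k}"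
      then obtain i j where "i \<in> {1..k}" "j \<in> {1..k}" "z i = z j" "i \<noteq> j" by (auto simp: inj_on_def)
      then have ni: "\<not> inj_on (z(Suc k := a)) {1..Suc k}"
        using inj_onD[of "z(Suc k := a)" "{1..Suc k}" i j] by auto
      show "H (z(Suc k := a)) = 0" by (rule Suc.prems(2)[OF _ ni]) (use z a in \<open>auto simp: le_Suc_eq\<close>)
    qed (use Suc.prems in auto)
    finally show ?thesis .
  qed
  then show ?case by (simp add: mint_point_sum_Suc)
qed simp

lemma inj_sum_cong:
  assumes "finite A" "card A = k" "\<And>z. bij_betw z {1..k} A \<Longrightarrow> H z = H' z"
  shows "inj_sum k A H = inj_sum k A H'"
  using assms
proof (induction k arbitrary: A H H')
  case 0
  then show ?case by (simp add: bij_betw_def)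
next
  case (Suc k)
  have "inj_sum k (A - {a}) (\<lambda>z. H (z(Suc k := a))) = inj_sum k (A - {a}) (\<lambda>z. H' (z(Suc k := a)))" if a: "a \<in> A" for a
  proof (rule Suc.IH)
    fix z :: "nat \<Rightarrow> complex" assume z: "bij_betw z {1..k} (A - {a})"
    have "bij_betw (z(Suc k := a)) {1..k} (A - {a})"
      by (rule bij_betw_cong[THEN iffD1, OF _ z]) auto
    moreover have "bij_betw (z(Suc k := a)) {Suc k} {a}" by (simp add: bij_betw_def)
    ultimately have "bij_betw (z(Suc k := a)) ({1..k} \<union> {Suc k}) (A - {a} \<union> {a})"
      by (rule bij_betw_combine) auto
    moreover have "{1..k} \<union> {Suc k} = {1..Suc k}" "A - {a} \<union> {a} = A" using a by auto
    ultimately show "H (z(Suc k := a)) = H' (z(Suc k := a))" using Suc.prems(3) by simp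
  qed (use Suc.prems a in auto)
  then show ?case by simp
qed

lemma inj_sum_mult: "inj_sum k A (\<lambda>z. d * H z) = d * inj_sum k A H"
  by (induction k arbitrary: A H) (simp_all add: sum_distrib_left)

context nonzero_theta
begin

lemma tf_holomorphic_on: "h holomorphic_on S \<Longrightarrow> (\<lambda>x. tf tau (h x)) holomorphic_on S"
  using holomorphic_on_compose_gen[of h S "tf tau" UNIV] tf_holomorphic by (simp add: o_def)

text \<open>Writing \<open>tf tau z = z * q z\<close>, with \<open>q 0\<close> the derivative at 0,
  exposes a simple pole at \<open>a\<close>; the hypotheses on the disc keep all other factors
  nonzero, and Cauchy's formula gives the residue.\<close>

lemma contour_integral_simple_poles:
  assumes A: "finite A" "a \<in> A" and r: "0 < r" "r < \<rho>"
    and hol: "G holomorphic_on ball a \<rho>"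
    and iso: "\<And>z b. z \<in> ball a \<rho> \<Longrightarrow> b \<in> A \<Longrightarrow> z \<noteq> b \<Longrightarrow> tf tau (z - b) \<noteq> 0"
    and sep: "\<And>b. b \<in> A \<Longrightarrow> b \<noteq> a \<Longrightarrow> b \<notin> ball a \<rho>"
  shows "contour_integral (circlepath a r) (\<lambda>z. G z / (\<Prod>b\<in>A. tf tau (z - b)))
    = 2 * of_real pi * \<i> / (deriv (tf tau) 0 * (\<Prod>b\<in>A - {a}. tf tau (a - b))) * G a"
proof -
  define q where "q z = (if z = 0 then deriv (tf tau) 0 else tf tau z / z)" for z
  have q: "q holomorphic_on UNIV"
  proof -
    have "(\<lambda>z. if z = 0 then deriv (tf tau) 0 else (tf tau z - tf tau 0) / (z - 0)) = q"
      by (auto simp: q_def fun_eq_iff)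
    then show ?thesis using pole_lemma[OF tf_holomorphic, of 0] by simp
  qed
  have qz: "tf tau z = z * q z" for z by (simp add: q_def)
  define H where "H z = G z / (q (z - a) * (\<Prod>b\<in>A - {a}. tf tau (z - b)))" for z
  have "q (z - a) \<noteq> 0" if "z \<in> ball a \<rho>" for z
    using iso[OF that A(2)] deriv_tf_ne_0 by (auto simp: q_def)
  moreover have "(\<Prod>b\<in>A - {a}. tf tau (z - b)) \<noteq> 0" if "z \<in> ball a \<rho>" for z
    using iso[OF that] sep that A(1) by auto
  moreover have "(\<lambda>z. q (z - a)) holomorphic_on ball a \<rho>"
    using holomorphic_on_compose_gen[of "\<lambda>z. z - a" "ball a \<rho>" q UNIV] q by (force simp: o_def intro: holomorphic_intros)
  ultimately have "H holomorphic_on ball a \<rho>"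
    unfolding H_def by (intro holomorphic_intros hol tf_holomorphic_on) auto
  then have "H holomorphic_on cball a r"
    by (rule holomorphic_on_subset) (use r in auto)
  from Cauchy_integral_circlepath_simple[OF this, of a]
  have 1: "((\<lambda>u. H u / (u - a)) has_contour_integral 2 * of_real pi * \<i> * H a) (circlepath a r)"
    using r by simp
  have 2: "H u / (u - a) = G u / (\<Prod>b\<in>A. tf tau (u - b))" if "u \<in> path_image (circlepath a r)" for u
  proof -
    have "(\<Prod>b\<in>A. tf tau (u - b)) = tf tau (u - a) * (\<Prod>b\<in>A - {a}. tf tau (u - b))"
      using A by (intro prod.remove)
    then show ?thesis unfolding H_def qz[of "u - a"] by simp
  qed
  have "((\<lambda>z. G z / (\<Prod>b\<in>A. tf tau (z - b))) has_contour_integral 2 * of_real pi * \<i> * H a) (circlepath a r)"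
    by (rule has_contour_integral_eq[OF 1 2])
  then have "contour_integral (circlepath a r) (\<lambda>z. G z / (\<Prod>b\<in>A. tf tau (z - b))) = 2 * of_real pi * \<i> * H a"
    by (rule contour_integral_unique)
  then show ?thesis by (simp add: H_def q_def)
qed

text \<open>After the inner integrations, what depends on the outer variable is a holomorphic
  function over the same product of theta factors, so the one-variable residue applies again.
  Holomorphy of \<open>G\<close> in each variable separately is enough.\<close>

lemma mint_residues:
  assumes A: "finite A" and r: "0 < r" "r < \<rho>"
    and iso: "\<And>a z b. a \<in> A \<Longrightarrow> z \<in> ball a \<rho> \<Longrightarrow> b \<in> A \<Longrightarrow> z \<noteq> b \<Longrightarrow> tf tau (z - b) \<noteq> 0"
    and sep: "\<And>a b. a \<in> A \<Longrightarrow> b \<in> A \<Longrightarrow> b \<noteq> a \<Longrightarrow> b \<notin> ball a \<rho>"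
    and F: "\<And>z. (\<forall>i\<in>{1..k}. z i \<in> U) \<Longrightarrow> F z = G z / (\<Prod>i\<in>{1..k}. \<Prod>b\<in>A. tf tau (z i - b))"
    and G: "\<And>z i. (\<forall>j\<in>{1..k}. z j \<in> U) \<Longrightarrow> i \<in> {1..k} \<Longrightarrow> (\<lambda>x. G (z(i := x))) holomorphic_on U"
    and U: "U = (\<Union>a\<in>A. ball a \<rho>)"
  shows "mint (\<lambda>h. \<Sum>a\<in>A. contour_integral (circlepath a r) h) k F
    = mint (point_sum A (\<lambda>a. 2 * of_real pi * \<i> / (deriv (tf tau) 0 * (\<Prod>b\<in>A - {a}. tf tau (a - b))))) k G"
  using F G
proof (induction k arbitrary: F G)
  case 0
  then show ?case by simp
next
  case (Suc k)
  let ?C = "\<lambda>h. \<Sum>a\<in>A. contour_integral (circlepath a r) h"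
  let ?c = "\<lambda>a. 2 * of_real pi * \<i> / (deriv (tf tau) 0 * (\<Prod>b\<in>A - {a}. tf tau (a - b)))"
  let ?W = "\<lambda>w. \<Prod>b\<in>A. tf tau (w - b)"
  let ?M = "\<lambda>w. mint (point_sum A ?c) k (\<lambda>z. G (z(Suc k := w)))"
  have AU: "A \<subseteq> U" using r by (auto simp: U intro!: bexI)
  have inner: "mint ?C k (\<lambda>z. F (z(Suc k := w))) = ?M w / ?W w" if w: "w \<in> U" for w
  proof -
    have "mint ?C k (\<lambda>z. F (z(Suc k := w))) = mint (point_sum A ?c) k (\<lambda>z. G (z(Suc k := w)) / ?W w)"
    proof (rule Suc.IH)
      fix z :: "nat \<Rightarrow> complex" assume "\<forall>i\<in>{1..k}. z i \<in> U"
      then have z': "\<forall>i\<in>{1..Suc k}. (z(Suc k := w)) i \<in> U" using w by (auto simp: le_Suc_eq)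
      have "(\<Prod>i\<in>{1..Suc k}. ?W ((z(Suc k := w)) i)) = (\<Prod>i\<in>{1..k}. ?W (z i)) * ?W w"
        by (simp add: prod.atLeast1_atMost_eq lessThan_Suc)
      then show "F (z(Suc k := w)) = G (z(Suc k := w)) / ?W w / (\<Prod>i\<in>{1..k}. ?W (z i))"
        unfolding Suc.prems(1)[OF z'] by (simp add: mult.commute)
      fix i assume i: "i \<in> {1..k}"
      then have "(\<lambda>x. G ((z(Suc k := w))(i := x))) holomorphic_on U"
        by (intro Suc.prems(2)[OF z']) auto
      moreover have "(z(Suc k := w))(i := x) = (z(i := x))(Suc k := w)" for x using i by (auto simp: fun_upd_twist)
      ultimately show "(\<lambda>x. G ((z(i := x))(Suc k := w)) / ?W w) holomorphic_on U"
        by (cases "?W w = 0") (auto intro!: holomorphic_intros)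
    qed
    then show ?thesis by (simp add: mint_point_sum_divide)
  qed
  have Mhol: "?M holomorphic_on U"
  proof (rule mint_point_sum_holomorphic)
    fix z :: "nat \<Rightarrow> complex" assume z: "\<forall>i\<in>{1..k}. z i \<in> A"
    show "(\<lambda>w. G (z(Suc k := w))) holomorphic_on U"
    proof (cases "A = {}")
      case False
      then obtain a where "a \<in> A" by blast
      then have "\<forall>j\<in>{1..Suc k}. (z(Suc k := a)) j \<in> U" using z AU by (auto simp: le_Suc_eq)
      then have "(\<lambda>x. G ((z(Suc k := a))(Suc k := x))) holomorphic_on U"
        by (rule Suc.prems(2)) simp
      then show ?thesis by (simp only: fun_upd_upd)
    qed (simp add: U holomorphic_on_def)
  qed
  have "contour_integral (circlepath a r) (\<lambda>w. mint ?C k (\<lambda>z. F (z(Suc k := w)))) = ?c a * ?M a" if a: "a \<in> A" for a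
  proof -
    have "path_image (circlepath a r) \<subseteq> U" using a r by (force simp: U path_image_circlepath_nonneg)
    then have "contour_integral (circlepath a r) (\<lambda>w. mint ?C k (\<lambda>z. F (z(Suc k := w))))
        = contour_integral (circlepath a r) (\<lambda>w. ?M w / ?W w)"
      by (intro contour_integral_eq inner) auto
    also have "\<dots> = ?c a * ?M a"
    proof (rule contour_integral_simple_poles[OF A a r])
      show "?M holomorphic_on ball a \<rho>" by (rule holomorphic_on_subset[OF Mhol]) (use a in \<open>auto simp: U\<close>)
    qed (use iso sep a in blast)+
    finally show ?thesis .
  qed
  then show ?case by (simp add: mint.simps(2)[of ?C] mint_point_sum_Suc)
qed

end

section \<open>The integrand level by level\<close>

text \<open>Grouping each pair under its larger index puts the Vandermonde factors beside the
  \<open>mfun\<close> whose poles they cancel.\<close>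

lemma prod_off_diagonal:
  fixes F :: "nat \<Rightarrow> nat \<Rightarrow> complex"
  shows "(\<Prod>i\<in>{1..L}. \<Prod>j\<in>{1..L} - {i}. F i j) = (\<Prod>l\<in>{1..L}. \<Prod>j\<in>{1..<l}. F l j * F j l)"
proof (induction L)
  case (Suc L)
  have "(\<Prod>j\<in>{1..Suc L} - {i}. F i j) = F i (Suc L) * (\<Prod>j\<in>{1..L} - {i}. F i j)" if "i \<in> {1..L}" for i
  proof -
    have "{1..Suc L} - {i} = insert (Suc L) ({1..L} - {i})" using that by auto
    then show ?thesis by simp
  qed
  then have "(\<Prod>i\<in>{1..L}. \<Prod>j\<in>{1..Suc L} - {i}. F i j) = (\<Prod>i\<in>{1..L}. F i (Suc L)) * (\<Prod>i\<in>{1..L}. \<Prod>j\<in>{1..L} - {i}. F i j)"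
    by (simp add: prod.distrib)
  moreover have "{1..Suc L} - {Suc L} = {1..L}" "{1..<Suc L} = {1..L}" by auto
  moreover have "(\<Prod>i\<in>{1..Suc L}. h i) = (\<Prod>i\<in>{1..L}. h i) * h (Suc L)" for h :: "nat \<Rightarrow> complex" by simp
  ultimately show ?case
    by (simp only: Suc.IH prod.distrib) (simp only: mult_ac)
qed simp

lemma prod_upper_triangle:
  fixes F :: "nat \<Rightarrow> nat \<Rightarrow> complex"
  shows "(\<Prod>i\<in>{1..L}. \<Prod>j\<in>{i<..L}. F i j) = (\<Prod>l\<in>{1..L}. \<Prod>i\<in>{1..<l}. F i l)"
proof (induction L)
  case (Suc L)
  have "(\<Prod>j\<in>{i<..Suc L}. F i j) = F i (Suc L) * (\<Prod>j\<in>{i<..L}. F i j)" if "i \<in> {1..L}" for i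
  proof -
    have "{i<..Suc L} = insert (Suc L) {i<..L}" using that by auto
    then show ?thesis by simp
  qed
  then have "(\<Prod>i\<in>{1..L}. \<Prod>j\<in>{i<..Suc L}. F i j) = (\<Prod>i\<in>{1..L}. F i (Suc L)) * (\<Prod>i\<in>{1..L}. \<Prod>j\<in>{i<..L}. F i j)"
    by (simp add: prod.distrib)
  moreover have "{1..<Suc L} = {1..L}" "{Suc L<..Suc L} = {}" by auto
  moreover have "(\<Prod>i\<in>{1..Suc L}. h i) = (\<Prod>i\<in>{1..L}. h i) * h (Suc L)" for h :: "nat \<Rightarrow> complex" by simp
  ultimately show ?case
    by (simp only: Suc.IH prod.empty mult_1_right) (simp only: mult_ac)
qed simp

lemma prod_bij_off_diagonal:
  fixes F :: "complex \<Rightarrow> complex \<Rightarrow> complex"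
  assumes "bij_betw z {1..L} A"
  shows "(\<Prod>i\<in>{1..L}. \<Prod>j\<in>{1..L} - {i}. F (z i) (z j)) = (\<Prod>a\<in>A. \<Prod>b\<in>A - {a}. F a b)"
proof -
  have "(\<Prod>j\<in>{1..L} - {i}. F (z i) (z j)) = (\<Prod>b\<in>A - {z i}. F (z i) b)" if "i \<in> {1..L}" for i
    by (rule prod.reindex_bij_betw) (rule bij_betw_DiffI[OF assms], use that assms in \<open>auto simp: bij_betw_def\<close>)
  then have "(\<Prod>i\<in>{1..L}. \<Prod>j\<in>{1..L} - {i}. F (z i) (z j)) = (\<Prod>i\<in>{1..L}. \<Prod>b\<in>A - {z i}. F (z i) b)" by simp
  also have "\<dots> = (\<Prod>a\<in>A. \<Prod>b\<in>A - {a}. F a b)" by (rule prod.reindex_bij_betw[OF assms])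
  finally show ?thesis .
qed

context sos
begin

text \<open>The part of the integrand that belongs to \<open>z l\<close>. With the double product
  regrouped by the larger index it involves only \<open>z 1\<close> up to \<open>z l\<close>, as the
  recursion requires.\<close>

definition level :: "(nat \<Rightarrow> complex) \<Rightarrow> nat \<Rightarrow> (nat \<Rightarrow> complex) \<Rightarrow> complex" where
  "level mu l z = (\<Prod>i\<in>{1..<l}. br (z i - mu l) * br (z i + mu l + g)) * (br (2 * z l) / br (2 * z l + g) * mfun tau g ze th mu l z)"

definition vandermonde :: "nat \<Rightarrow> (nat \<Rightarrow> complex) \<Rightarrow> complex" where
  "vandermonde L z = (\<Prod>i\<in>{1..L}. \<Prod>j\<in>{1..L} - {i}. br (z i - z j))"

definition numer :: "(nat \<Rightarrow> complex) \<Rightarrow> nat \<Rightarrow> (nat \<Rightarrow> complex) \<Rightarrow> complex" where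
  "numer mu L z = vandermonde L z * (\<Prod>l\<in>{1..L}. level mu l z)"

lemma integrand_eq_numer:
  "integrand tau g ze th L mu lam z = numer mu L z / (\<Prod>i\<in>{1..L}. \<Prod>j\<in>{1..L}. br (z i - lam j))"
proof -
  have "(\<Prod>l\<in>{1..L}. level mu l z) = (\<Prod>l\<in>{1..L}. \<Prod>i\<in>{1..<l}. br (z i - mu l) * br (z i + mu l + g))
      * (\<Prod>l\<in>{1..L}. br (2 * z l) / br (2 * z l + g) * mfun tau g ze th mu l z)"
    unfolding level_def by (rule prod.distrib)
  then show ?thesis
    unfolding integrand_def numer_def vandermonde_def prod_upper_triangle by (simp add: divide_inverse mult_ac)
qed

text \<open>Injectivity turns products over indices into products over the set of values, the form
  used by \<open>step_coeff\<close>.\<close>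

lemma level_Suc:
  assumes "inj_on z {1..n}"
  shows "level mu (Suc n) z = step_coeff (map mu [1..<Suc n]) (mu (Suc n)) (z ` {1..n}) (z (Suc n))
     / (br (th + ze + z (Suc n)) * br (th + of_nat n * g))"
proof -
  have s: "{1..<Suc n} = {1..n}" by auto
  have im: "(\<Prod>x\<in>z ` {1..n}. F x) = (\<Prod>i\<in>{1..n}. F (z i))" for F :: "complex \<Rightarrow> complex"
    using assms by (simp add: prod.reindex)
  have li: "(\<Prod>j\<leftarrow>map mu [1..<Suc n]. F j) = (\<Prod>j\<in>{1..n}. F (mu j))" for F :: "complex \<Rightarrow> complex"
  proof -
    have "(\<Prod>j\<leftarrow>[1..<Suc n]. F (mu j)) = (\<Prod>j\<in>set [1..<Suc n]. F (mu j))"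
      by (rule prod.distinct_set_conv_list[symmetric]) (rule distinct_upt)
    then show ?thesis by (simp only: map_map o_def set_upt s)
  qed
  have len: "length (map mu [1..<Suc n]) = n" by (simp del: upt_Suc)
  have d: "(\<Prod>j\<in>{1..n}. a j * b j * c j / d j) = (\<Prod>j\<in>{1..n}. a j * b j) * (\<Prod>j\<in>{1..n}. c j / d j)" for a b c d :: "nat \<Rightarrow> complex"
    by (simp add: prod.distrib prod_dividef)
  have n: "of_nat (Suc n) * g = (of_nat n + 1) * g" "of_nat (Suc n) - 1 = (of_nat n :: complex)" by (simp_all add: algebra_simps)
  show ?thesis
    unfolding level_def mfun_def step_coeff_def plus_term_def minus_term_def im li len s n d
    by (simp add: divide_inverse algebra_simps)
qed

lemma level_update:
  assumes "l \<le> n"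
  shows "level mu l (z(Suc n := a)) = level mu l z"
proof -
  define z' where "z' = z(Suc n := a)"
  have "z' l = z l" "\<And>j. j \<in> {1..<l} \<Longrightarrow> z' j = z j" using assms by (auto simp: z'_def)
  then show ?thesis
    unfolding z'_def[symmetric] level_def mfun_def by (simp only: cong: prod.cong)
qed

lemma inj_sum_levels:
  assumes "finite A" "card A = n"
  shows "inj_sum n A (\<lambda>z. \<Prod>l\<in>{1..n}. level mu l z) = perm_sum mu n A"
  using assms
proof (induction n arbitrary: A)
  case (Suc n)
  let ?c = "\<lambda>a. step_coeff (map mu [1..<Suc n]) (mu (Suc n)) (A - {a}) a / (br (th + ze + a) * br (th + of_nat n * g))"
  have "inj_sum n (A - {a}) (\<lambda>z. \<Prod>l\<in>{1..Suc n}. level mu l (z(Suc n := a))) = ?c a * perm_sum mu n (A - {a})" if a: "a \<in> A" for a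
  proof -
    have fin: "finite (A - {a})" "card (A - {a}) = n" using Suc.prems a by auto
    have "inj_sum n (A - {a}) (\<lambda>z. \<Prod>l\<in>{1..Suc n}. level mu l (z(Suc n := a))) = inj_sum n (A - {a}) (\<lambda>z. ?c a * (\<Prod>l\<in>{1..n}. level mu l z))"
    proof (rule inj_sum_cong[OF fin])
      fix z assume z: "bij_betw z {1..n} (A - {a})"
      have im: "(z(Suc n := a)) ` {1..n} = A - {a}" "inj_on (z(Suc n := a)) {1..n}"
        using z image_cong[of "{1..n}" "{1..n}" "z(Suc n := a)" z] inj_on_cong[of "{1..n}" "z(Suc n := a)" z]
        by (simp_all add: bij_betw_def)
      have "level mu (Suc n) (z(Suc n := a)) = ?c a"
        unfolding level_Suc[OF im(2)] im(1) by simp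
      moreover have "(\<Prod>l\<in>{1..n}. level mu l (z(Suc n := a))) = (\<Prod>l\<in>{1..n}. level mu l z)"
        by (intro prod.cong refl level_update) auto
      ultimately show "(\<Prod>l\<in>{1..Suc n}. level mu l (z(Suc n := a))) = ?c a * (\<Prod>l\<in>{1..n}. level mu l z)"
        by (simp add: mult.commute del: upt_Suc)
    qed
    then show ?thesis by (simp only: inj_sum_mult Suc.IH[OF fin])
  qed
  then show ?case by (simp only: inj_sum.simps perm_sum.simps cong: sum.cong)
qed simp

text \<open>Repeated values are killed by the Vandermonde factor, so only bijections remain. For
  these the residue weights multiply to \<open>(k / d) ^ L\<close> over that same factor, whatever
  the ordering.\<close>

lemma residue_sum:
  assumes A: "finite A" "card A = L" and ne: "\<And>a b. a \<in> A \<Longrightarrow> b \<in> A \<Longrightarrow> a \<noteq> b \<Longrightarrow> br (a - b) \<noteq> 0"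
  shows "mint (point_sum A (\<lambda>a. k / (d * (\<Prod>b\<in>A - {a}. br (a - b))))) L (numer mu L) = (k / d) ^ L * perm_sum mu L A"
proof -
  let ?c = "\<lambda>a. k / (d * (\<Prod>b\<in>A - {a}. br (a - b)))"
  have "mint (point_sum A ?c) L (numer mu L) = inj_sum L A (\<lambda>z. (\<Prod>i\<in>{1..L}. ?c (z i)) * numer mu L z)"
    unfolding mint_point_sum_weights[of A ?c]
  proof (rule mint_eq_inj_sum[OF A(1)])
    fix z :: "nat \<Rightarrow> complex" assume "\<not> inj_on z {1..L}"
    then obtain i j where ij: "i \<in> {1..L}" "j \<in> {1..L} - {i}" "z i = z j" by (auto simp: inj_on_def)
    then have "(\<Prod>j\<in>{1..L} - {i}. br (z i - z j)) = 0" by (intro prod_zero bexI[of _ j]) auto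
    then have "vandermonde L z = 0" unfolding vandermonde_def
      by (intro prod_zero[OF finite_atLeastAtMost] bexI[OF _ ij(1)])
    then show "(\<Prod>i\<in>{1..L}. ?c (z i)) * numer mu L z = 0" by (simp add: numer_def)
  qed
  also have "\<dots> = inj_sum L A (\<lambda>z. (k / d) ^ L * (\<Prod>l\<in>{1..L}. level mu l z))"
  proof (rule inj_sum_cong[OF A])
    fix z assume z: "bij_betw z {1..L} A"
    let ?V = "\<Prod>a\<in>A. \<Prod>b\<in>A - {a}. br (a - b)"
    have V: "vandermonde L z = ?V" unfolding vandermonde_def by (rule prod_bij_off_diagonal[OF z])
    have V0: "?V \<noteq> 0" using A ne by auto
    have "(\<Prod>i\<in>{1..L}. ?c (z i)) = (\<Prod>a\<in>A. ?c a)" by (rule prod.reindex_bij_betw[OF z])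
    also have "\<dots> = (k / d) ^ L / ?V" using A by (simp add: prod_dividef prod.distrib power_divide)
    finally show "(\<Prod>i\<in>{1..L}. ?c (z i)) * numer mu L z = (k / d) ^ L * (\<Prod>l\<in>{1..L}. level mu l z)"
      using V0 by (simp add: numer_def V)
  qed
  also have "\<dots> = (k / d) ^ L * perm_sum mu L A" by (simp only: inj_sum_mult inj_sum_levels[OF A])
  finally show ?thesis .
qed

text \<open>The product over \<open>j\<close> contains \<open>br (z l - z j) * br (z j - z l)\<close>, which absorbs the apparent poles of
  \<open>mfun\<close>; at coinciding arguments both sides vanish.\<close>
lemma vandermonde_mfun:
  "(\<Prod>j\<in>{1..<l}. br (z l - z j) * br (z j - z l)) * mfun tau g ze th mu l z =
     br (z l + ze) * (br (th + ze - z l) * br (th + of_nat l * g + z l - mu l)) / (br (th + ze + z l) * br (th + (of_nat l - 1) * g)) * br (z l + mu l + g)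
       * (\<Prod>j\<in>{1..<l}. br (z l - mu j + g) * br (z l + mu j + g) * (br (z l - z j) * (br (z j - z l + g) * br (z j + z l)) / br (z j + z l + g)))
   - br (z l - ze + g) * (br (th + ze + z l + g) * br (th + (of_nat l - 1) * g - z l - mu l)) / (br (th + ze + z l) * br (th + (of_nat l - 1) * g)) * br (z l - mu l)
       * (\<Prod>j\<in>{1..<l}. br (z l - mu j) * br (z l + mu j) * (br (z j - z l) * (br (z l - z j + g) * br (z l + z j + 2 * g)) / br (z l + z j + g)))"
proof -
  have v: "br (z l - z j) = - br (z j - z l)" for j using tf_minus[of "z j - z l"] by simp
  have 1: "(\<Prod>j\<in>{1..<l}. br (z l - z j) * br (z j - z l)) * (\<Prod>j\<in>{1..<l}. br (z l - mu j + g) * br (z l + mu j + g) * (br (z j - z l + g) * br (z j + z l)) / (br (z j - z l) * br (z j + z l + g)))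
      = (\<Prod>j\<in>{1..<l}. br (z l - mu j + g) * br (z l + mu j + g) * (br (z l - z j) * (br (z j - z l + g) * br (z j + z l)) / br (z j + z l + g)))"
    unfolding prod.distrib[symmetric] by (intro prod.cong refl) (simp add: v)
  have 2: "(\<Prod>j\<in>{1..<l}. br (z l - z j) * br (z j - z l)) * (\<Prod>j\<in>{1..<l}. br (z l - mu j) * br (z l + mu j) * (br (z l - z j + g) * br (z l + z j + 2 * g)) / (br (z l - z j) * br (z l + z j + g)))
      = (\<Prod>j\<in>{1..<l}. br (z l - mu j) * br (z l + mu j) * (br (z j - z l) * (br (z l - z j + g) * br (z l + z j + 2 * g)) / br (z l + z j + g)))"
    unfolding prod.distrib[symmetric] by (intro prod.cong refl) (simp add: v)
  show ?thesis unfolding mfun_def 1[symmetric] 2[symmetric] by (simp add: right_diff_distrib mult_ac)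
qed

text \<open>Once the differences \<open>z l - z j\<close> have been absorbed, the denominators left
  are sums of two variables shifted by \<open>g\<close>, the boundary factor, and dynamical
  constants; all are nonzero on \<open>U\<close>.\<close>

lemma numer_holomorphic:
  assumes U: "\<And>x y. x \<in> U \<Longrightarrow> y \<in> U \<Longrightarrow> br (x + y + g) \<noteq> 0" "\<And>x. x \<in> U \<Longrightarrow> br (th + ze + x) \<noteq> 0"
    and adm: "admissible L" and z: "\<forall>j\<in>{1..L}. z j \<in> U" and i: "i \<in> {1..L}"
  shows "(\<lambda>x. numer mu L (z(i := x))) holomorphic_on U"
proof -
  define y where "y x = z(i := x)" for x
  have yh: "(\<lambda>x. y x j) holomorphic_on U" for j
    by (cases "j = i") (auto simp: y_def)
  have yU: "y x j \<in> U" if "x \<in> U" "j \<in> {1..L}" for x j using z that by (auto simp: y_def)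
  have t: "br (th + (of_nat l - 1) * g) \<noteq> 0" if "l \<in> {1..L}" for l
  proof -
    have "br (th + of_int (int l - 1) * g) \<noteq> 0" using that adm[unfolded admissible_def, rule_format, of "int l - 1"] by auto
    then show ?thesis by simp
  qed
  have eq: "numer mu L (y x) = (\<Prod>l\<in>{1..L}. ((\<Prod>j\<in>{1..<l}. br (y x l - y x j) * br (y x j - y x l)) * mfun tau g ze th mu l (y x))
      * ((\<Prod>i\<in>{1..<l}. br (y x i - mu l) * br (y x i + mu l + g)) * (br (2 * y x l) / br (2 * y x l + g))))" for x
    unfolding numer_def vandermonde_def prod_off_diagonal level_def prod.distrib[symmetric]
    by (intro prod.cong refl) (simp only: mult_ac)
  have hol: "(\<lambda>x. ((\<Prod>j\<in>{1..<l}. br (y x l - y x j) * br (y x j - y x l)) * mfun tau g ze th mu l (y x))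
      * ((\<Prod>i\<in>{1..<l}. br (y x i - mu l) * br (y x i + mu l + g)) * (br (2 * y x l) / br (2 * y x l + g)))) holomorphic_on U" if l: "l \<in> {1..L}" for l
  proof -
    have n1: "br (y x j + y x l + g) \<noteq> 0" "br (y x l + y x j + g) \<noteq> 0" if "x \<in> U" "j \<in> {1..<l}" for x j
      using U(1) yU[OF that(1), of j] yU[OF that(1) l] that l by auto
    have n2: "br (th + ze + y x l) \<noteq> 0" "br (2 * y x l + g) \<noteq> 0" if "x \<in> U" for x
      using U(2)[OF yU[OF that l]] U(1)[OF yU[OF that l] yU[OF that l]] by (simp_all only: mult_2 not_False_eq_True)
    show ?thesis
      unfolding vandermonde_mfun
      by (intro holomorphic_intros tf_holomorphic_on yh; simp add: n1 n2 t[OF l])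
  qed
  show ?thesis unfolding y_def[symmetric] eq by (rule holomorphic_on_prod) (rule hol)
qed

lemma br_nonzero_near:
  assumes "br c \<noteq> 0"
  obtains \<delta> where "\<delta> > 0" "\<And>x. dist x c < \<delta> \<Longrightarrow> br x \<noteq> 0"
proof -
  have "isCont br c"
    using tf_holomorphic holomorphic_on_imp_continuous_on continuous_on_eq_continuous_at open_UNIV by blast
  then have "eventually (\<lambda>x. br x \<noteq> 0) (nhds c)"
    using assms by (simp add: eventually_nhds_conv_at continuous_at tendsto_imp_eventually_ne)
  then show ?thesis using that by (auto simp: eventually_nhds_metric)
qed

text \<open>Each requirement holds for all sufficiently small radii, and the filter
  \<open>at_right 0\<close> intersects finitely many of them.\<close>

lemma generic_radius:
  assumes A: "finite A" and gs: "generic_spectral A"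
  shows "\<exists>\<rho>>0. (\<forall>a\<in>A. \<forall>b\<in>A. \<forall>x\<in>ball a \<rho>. \<forall>y\<in>ball b \<rho>. br (x + y + g) \<noteq> 0)
     \<and> (\<forall>a\<in>A. \<forall>x\<in>ball a \<rho>. br (th + ze + x) \<noteq> 0)
     \<and> (\<forall>a\<in>A. \<forall>b\<in>A. (\<forall>x\<in>ball a \<rho>. x \<noteq> b \<longrightarrow> br (x - b) \<noteq> 0) \<and> (b \<noteq> a \<longrightarrow> b \<notin> ball a \<rho>))"
proof -
  have ev: "eventually P (at_right 0)" if "\<delta> > 0" "\<And>\<rho>. 0 < \<rho> \<Longrightarrow> \<rho> < \<delta> \<Longrightarrow> P \<rho>" for P and \<delta> :: real
    using that unfolding eventually_at_right_field by blast
  have "eventually (\<lambda>\<rho>. \<forall>a\<in>A. \<forall>b\<in>A. \<forall>x\<in>ball a \<rho>. \<forall>y\<in>ball b \<rho>. br (x + y + g) \<noteq> 0) (at_right 0)"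
  proof (intro eventually_ball_finite ballI A)
    fix a b assume "a \<in> A" "b \<in> A"
    then have "br (a + b + g) \<noteq> 0" using gs by (auto simp: generic_spectral_def)
    then obtain \<delta> where \<delta>: "\<delta> > 0" "\<And>x. dist x (a + b + g) < \<delta> \<Longrightarrow> br x \<noteq> 0" using br_nonzero_near by blast
    show "eventually (\<lambda>\<rho>. \<forall>x\<in>ball a \<rho>. \<forall>y\<in>ball b \<rho>. br (x + y + g) \<noteq> 0) (at_right 0)"
    proof (rule ev[of "\<delta> / 2"], use \<delta> in simp, intro ballI)
      fix \<rho> x y assume r: "\<rho> < \<delta> / 2" "x \<in> ball a \<rho>" "y \<in> ball b \<rho>"
      have "dist (x + y + g) (a + b + g) \<le> dist x a + dist y b"
        by (simp add: dist_triangle_add)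
      then show "br (x + y + g) \<noteq> 0" using r by (intro \<delta>(2)) (simp add: dist_commute)
    qed
  qed
  moreover have "eventually (\<lambda>\<rho>. \<forall>a\<in>A. \<forall>x\<in>ball a \<rho>. br (th + ze + x) \<noteq> 0) (at_right 0)"
  proof (intro eventually_ball_finite ballI A)
    fix a assume "a \<in> A"
    then have "br (th + ze + a) \<noteq> 0" using gs by (auto simp: generic_spectral_def algebra_simps)
    then obtain \<delta> where \<delta>: "\<delta> > 0" "\<And>x. dist x (th + ze + a) < \<delta> \<Longrightarrow> br x \<noteq> 0" using br_nonzero_near by blast
    show "eventually (\<lambda>\<rho>. \<forall>x\<in>ball a \<rho>. br (th + ze + x) \<noteq> 0) (at_right 0)"
      by (rule ev[OF \<delta>(1)]) (auto intro!: \<delta>(2) simp: dist_commute)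
  qed
  moreover have "eventually (\<lambda>\<rho>. \<forall>a\<in>A. \<forall>b\<in>A. (\<forall>x\<in>ball a \<rho>. x \<noteq> b \<longrightarrow> br (x - b) \<noteq> 0) \<and> (b \<noteq> a \<longrightarrow> b \<notin> ball a \<rho>)) (at_right 0)"
  proof (intro eventually_ball_finite ballI A)
    fix a b assume ab: "a \<in> A" "b \<in> A"
    show "eventually (\<lambda>\<rho>. (\<forall>x\<in>ball a \<rho>. x \<noteq> b \<longrightarrow> br (x - b) \<noteq> 0) \<and> (b \<noteq> a \<longrightarrow> b \<notin> ball a \<rho>)) (at_right 0)"
    proof (cases "a = b")
      \<comment> \<open>For equal points the difference may reach 0; the zero of \<open>tf\<close>
        at 0 is isolated, which suffices away from the centre.\<close>
      case True
      obtain \<delta> where \<delta>: "\<delta> > 0" "\<And>x. x \<noteq> 0 \<Longrightarrow> dist x 0 < \<delta> \<Longrightarrow> br x \<noteq> 0"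
        using tf_affine_nonzero[OF one_neq_zero, of 0 0] by (auto simp: eventually_at)
      have "br (x - b) \<noteq> 0" if "x \<in> ball a \<rho>" "x \<noteq> b" "\<rho> < \<delta>" for x \<rho>
        by (rule \<delta>(2)) (use that True in \<open>auto simp: dist_norm norm_minus_commute\<close>)
      then show ?thesis by (intro ev[OF \<delta>(1)]) (use True in auto)
    next
      case False
      then have "br (a - b) \<noteq> 0" using gs ab by (auto simp: generic_spectral_def)
      then obtain \<delta> where \<delta>: "\<delta> > 0" "\<And>x. dist x (a - b) < \<delta> \<Longrightarrow> br x \<noteq> 0" using br_nonzero_near by blast
      have "br (x - b) \<noteq> 0" if "x \<in> ball a \<rho>" "\<rho> < \<delta>" for x \<rho>
        by (rule \<delta>(2)) (use that in \<open>auto simp: dist_norm norm_minus_commute\<close>)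
      then show ?thesis by (intro ev[of "min \<delta> (dist a b)"]) (use \<delta>(1) False in auto)
    qed
  qed
  moreover have "eventually (\<lambda>\<rho>. 0 < \<rho>) (at_right (0 :: real))" by (rule eventually_at_right_less)
  ultimately have "eventually (\<lambda>\<rho>. (\<forall>a\<in>A. \<forall>b\<in>A. \<forall>x\<in>ball a \<rho>. \<forall>y\<in>ball b \<rho>. br (x + y + g) \<noteq> 0)
     \<and> (\<forall>a\<in>A. \<forall>x\<in>ball a \<rho>. br (th + ze + x) \<noteq> 0)
     \<and> (\<forall>a\<in>A. \<forall>b\<in>A. (\<forall>x\<in>ball a \<rho>. x \<noteq> b \<longrightarrow> br (x - b) \<noteq> 0) \<and> (b \<noteq> a \<longrightarrow> b \<notin> ball a \<rho>)) \<and> 0 < \<rho>) (at_right 0)"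
    by (intro eventually_conj)
  from eventually_happens'[OF trivial_limit_at_right_real this] show ?thesis by blast
qed

lemma Zint_eq_perm_sum:
  assumes inj: "inj_on lam {1..L}" and gs: "generic_spectral (lam ` {1..L})" and adm: "admissible L"
  shows "eventually (\<lambda>r. Zint tau g ze th L mu lam r = perm_sum mu L (lam ` {1..L}) / deriv br 0 ^ L) (at_right 0)"
proof -
  let ?A = "lam ` {1..L}"
  obtain \<rho> where \<rho>: "\<rho> > 0" "\<forall>a\<in>?A. \<forall>b\<in>?A. \<forall>x\<in>ball a \<rho>. \<forall>y\<in>ball b \<rho>. br (x + y + g) \<noteq> 0"
    "\<forall>a\<in>?A. \<forall>x\<in>ball a \<rho>. br (th + ze + x) \<noteq> 0"
    "\<forall>a\<in>?A. \<forall>b\<in>?A. (\<forall>x\<in>ball a \<rho>. x \<noteq> b \<longrightarrow> br (x - b) \<noteq> 0) \<and> (b \<noteq> a \<longrightarrow> b \<notin> ball a \<rho>)"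
    using generic_radius[OF finite_imageI[OF finite_atLeastAtMost] gs] by blast
  define U where "U = (\<Union>a\<in>?A. ball a \<rho>)"
  have U: "br (x + y + g) \<noteq> 0" "br (th + ze + x) \<noteq> 0" if "x \<in> U" "y \<in> U" for x y
    using that \<rho>(2,3) unfolding U_def by blast+
  have card: "card ?A = L" using inj by (simp add: card_image)
  have "Zint tau g ze th L mu lam r = perm_sum mu L ?A / deriv br 0 ^ L" if r: "0 < r" "r < \<rho>" for r
  proof -
    let ?c = "\<lambda>a. 2 * of_real pi * \<i> / (deriv br 0 * (\<Prod>b\<in>?A - {a}. br (a - b)))"
    have C: "Gamma_int L lam r = (\<lambda>h. \<Sum>a\<in>?A. contour_integral (circlepath a r) h)"
      unfolding Gamma_int_def[abs_def] using inj by (simp add: sum.reindex)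
    have "mint (Gamma_int L lam r) L (integrand tau g ze th L mu lam) = mint (point_sum ?A ?c) L (numer mu L)"
      unfolding C
    proof (rule mint_residues[where U = U and \<rho> = \<rho>])
      show "integrand tau g ze th L mu lam z = numer mu L z / (\<Prod>i\<in>{1..L}. \<Prod>b\<in>?A. br (z i - b))" for z
        unfolding integrand_eq_numer using inj by (simp add: prod.reindex)
      show "(\<lambda>x. numer mu L (z(i := x))) holomorphic_on U" if "\<forall>j\<in>{1..L}. z j \<in> U" "i \<in> {1..L}" for z i
        by (rule numer_holomorphic[OF U adm that])
    qed (use r \<rho>(4) U_def in auto)
    also have "\<dots> = (2 * of_real pi * \<i> / deriv br 0) ^ L * perm_sum mu L ?A"
      by (rule residue_sum) (use card gs in \<open>auto simp: generic_spectral_def\<close>)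
    finally show ?thesis by (simp add: Zint_def power_divide)
  qed
  then show ?thesis using \<rho>(1) unfolding eventually_at_right_field by blast
qed


text \<open>The constant is \<open>prefactor mu L / br g ^ L\<close>: each residue costs a
  derivative of \<open>tf\<close> at 0, and each spin flip contributes one \<open>br g\<close>,
  which the stated normalisation displays separately.\<close>

lemma Zpart_eq_integral:
  assumes "admissible (L + 1)" generic_boundary "br g \<noteq> 0" "\<And>j. j \<in> {1..L} \<Longrightarrow> br (ze + mu j) * br (th + ze - mu j) \<noteq> 0"
    and inj: "inj_on lam {1..L}" and gs: "generic_spectral (lam ` {1..L})"
  shows "eventually (\<lambda>r. Zpart tau g ze th L mu lam =
     prefactor mu L / br g ^ L * br g ^ L * deriv br 0 ^ L * Zint tau g ze th L mu lam r) (at_right 0)"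
proof -
  let ?ls = "map lam [1..<L + 1]"
  have set: "set ?ls = lam ` {1..L}" by (auto simp: image_iff)
  have t: "br (th + ze + lam j) \<noteq> 0" if "j \<in> {1..L}" for j
    using gs that by (auto simp: generic_spectral_def algebra_simps)
  let ?P = "\<Prod>j\<in>{1..L}. br (th + ze + lam j)"
  have "?P * Zpart tau g ze th L mu lam = Z ?ls (map mu [1..<L + 1])"
    using Zpart_eq_Z[of L lam mu] t by simp
  also have "\<dots> = prefactor mu L * (\<Prod>z\<in>lam ` {1..L}. br (th + ze + z)) * perm_sum mu L (lam ` {1..L})"
  proof -
    have "distinct ?ls" using inj by (simp add: distinct_map atLeastLessThanSuc_atLeastAtMost del: upt_Suc)
    then show ?thesis
      using Z_eq_perm_sum[of L ?ls mu] assms set by (simp del: upt_Suc)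
  qed
  also have "(\<Prod>z\<in>lam ` {1..L}. br (th + ze + z)) = ?P" using inj by (simp add: prod.reindex)
  finally have "?P * Zpart tau g ze th L mu lam = ?P * (prefactor mu L * perm_sum mu L (lam ` {1..L}))" by simp
  moreover have "?P \<noteq> 0" using t by simp
  ultimately have Z: "Zpart tau g ze th L mu lam = prefactor mu L * perm_sum mu L (lam ` {1..L})" by simp
  have "admissible L" using assms(1) admissible_mono by simp
  from Zint_eq_perm_sum[OF inj gs this, of mu] show ?thesis
    by (rule eventually_mono) (use assms(3) deriv_tf_ne_0 Z in simp)
qed

end

section \<open>Closed nowhere dense exceptional sets\<close>

lemma closed_nowhere_dense_Union:
  assumes "finite \<F>" "\<And>X. X \<in> \<F> \<Longrightarrow> closed X \<and> interior X = {}"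
  shows "closed (\<Union>\<F>) \<and> interior (\<Union>\<F>) = {}"
  using assms
proof (induction \<F>)
  case (insert X \<F>)
  then show ?case using interior_closed_Un_empty_interior[of X "\<Union>\<F>"] by (simp add: closed_Un)
qed simp

text \<open>An interior point would make \<open>tf\<close> vanish on an open piece of a complex
  line, against the isolation of its zeros. Only one good line through each point is required, so
  the argument covers function spaces with the product topology.\<close>

lemma (in nonzero_theta) zero_set_nowhere_dense:
  fixes \<phi> :: "'a :: topological_space \<Rightarrow> complex"
  assumes cont: "continuous_on UNIV \<phi>"
    and line: "\<And>p. \<exists>\<gamma> c. continuous_on UNIV \<gamma> \<and> \<gamma> 0 = p \<and> c \<noteq> 0 \<and> (\<forall>t. \<phi> (\<gamma> t) = c * t + \<phi> p)"
  shows "closed {p. tf tau (\<phi> p) = 0} \<and> interior {p. tf tau (\<phi> p) = 0} = {}"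
proof
  have "continuous_on UNIV (\<lambda>p. tf tau (\<phi> p))"
    using continuous_on_compose2[OF holomorphic_on_imp_continuous_on[OF tf_holomorphic] cont] by simp
  then show "closed {p. tf tau (\<phi> p) = 0}" by (intro closed_Collect_eq continuous_on_const)
  show "interior {p. tf tau (\<phi> p) = 0} = {}"
  proof (rule ccontr)
    assume "interior {p. tf tau (\<phi> p) = 0} \<noteq> {}"
    then obtain p where p: "p \<in> interior {p. tf tau (\<phi> p) = 0}" by blast
    obtain \<gamma> c where \<gamma>: "continuous_on UNIV \<gamma>" "\<gamma> 0 = p" "c \<noteq> 0" "\<And>t. \<phi> (\<gamma> t) = c * t + \<phi> p"
      using line by blast
    have "open (\<gamma> -` interior {p. tf tau (\<phi> p) = 0})"
      using \<gamma>(1) by (simp add: continuous_on_open_vimage)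
    then have "eventually (\<lambda>t. t \<in> \<gamma> -` interior {p. tf tau (\<phi> p) = 0}) (nhds 0)"
      using p \<gamma>(2) by (intro eventually_nhds_in_open) auto
    then have "eventually (\<lambda>t. tf tau (c * t + \<phi> p) = 0) (nhds 0)"
      by (rule eventually_mono) (use interior_subset[of "{p. tf tau (\<phi> p) = 0}"] \<gamma>(4) in auto)
    then have "eventually (\<lambda>t. tf tau (c * t + \<phi> p) = 0) (at 0)" by (simp add: eventually_nhds_conv_at)
    with tf_affine_nonzero[OF \<gamma>(3), of "\<phi> p" 0] have "eventually (\<lambda>t. False) (at (0 :: complex))"
      by eventually_elim simp
    then show False by simp
  qed
qed

type_synonym params = "complex \<times> complex \<times> complex \<times> (nat \<Rightarrow> complex)"

text \<open>The arguments at which \<open>tf\<close> must not vanish: those of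
  \<open>admissible (L + 1)\<close>, the divisors in \<open>prefactor\<close> involving
  \<open>mu\<close>, those of \<open>generic_boundary\<close>, and \<open>g\<close> itself.\<close>

definition param_forms :: "nat \<Rightarrow> (params \<Rightarrow> complex) set" where
  "param_forms L = (\<lambda>k (g, th, ze, mu). th + of_int k * g) ` {- int (L + 1)..int (L + 1)}
     \<union> (\<lambda>j (g, th, ze, mu). ze + mu j) ` {1..L} \<union> (\<lambda>j (g, th, ze, mu). th + ze - mu j) ` {1..L}
     \<union> {\<lambda>(g, th, ze, mu). 2 * ze, \<lambda>(g, th, ze, mu). 2 * ze + th, \<lambda>(g, th, ze, mu). ze,
        \<lambda>(g, th, ze, mu). ze - \<i> * pi / 2, \<lambda>(g, th, ze, mu). 2 * (th + ze), \<lambda>(g, th, ze, mu). th + ze,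
        \<lambda>(g, th, ze, mu). th + ze - \<i> * pi / 2, \<lambda>(g, th, ze, mu). \<i> * pi / 2 - g, \<lambda>(g, th, ze, mu). g}"

definition spectral_forms :: "nat \<Rightarrow> complex \<Rightarrow> complex \<Rightarrow> complex \<Rightarrow> ((nat \<Rightarrow> complex) \<Rightarrow> complex) set" where
  "spectral_forms L g th ze = (\<lambda>(i, j) lam. lam i - lam j) ` {(i, j). i \<in> {1..L} \<and> j \<in> {1..L} \<and> i \<noteq> j}
     \<union> (\<lambda>(i, j) lam. lam i + lam j + g) ` ({1..L} \<times> {1..L})
     \<union> (\<lambda>(i, c) lam. lam i + c) ` ({1..L} \<times> {- ze, th + ze, g + ze, g - th - ze})"

lemma finite_forms: "finite (param_forms L)" "finite (spectral_forms L g th ze)"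
proof -
  have "finite {(i, j). i \<in> {1..L} \<and> j \<in> {1..L} \<and> i \<noteq> j}"
    by (rule finite_subset[of _ "{1..L} \<times> {1..L}"]) auto
  then show "finite (param_forms L)" "finite (spectral_forms L g th ze)"
    unfolding param_forms_def spectral_forms_def by auto
qed

lemma param_forms_line:
  assumes "\<phi> \<in> param_forms L"
  shows "continuous_on UNIV \<phi>"
    and "\<exists>\<gamma> c. continuous_on UNIV \<gamma> \<and> \<gamma> 0 = p \<and> c \<noteq> 0 \<and> (\<forall>t. \<phi> (\<gamma> t) = c * t + \<phi> p)"
proof -
  have coord: "continuous_on UNIV (\<lambda>p :: params. snd (snd (snd p)) j)" for j
    by (intro continuous_on_compose2[OF continuous_on_product_coordinates[of j] , of UNIV "\<lambda>p. snd (snd (snd p))"] continuous_intros) auto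
  show "continuous_on UNIV \<phi>"
    using assms unfolding param_forms_def
    by (auto simp: case_prod_beta intro!: continuous_intros coord)
  obtain g th ze mu where p: "p = (g, th, ze, mu)" by (cases p)
  have G: "\<exists>\<gamma> c. continuous_on UNIV \<gamma> \<and> \<gamma> 0 = p \<and> c \<noteq> 0 \<and> (\<forall>t. \<phi> (\<gamma> t) = c * t + \<phi> p)"
    if "\<And>t. \<phi> (g + t, th, ze, mu) = c * t + \<phi> p" "c \<noteq> 0" for c
    using that by (intro exI[of _ "\<lambda>t. (g + t, th, ze, mu)"] exI[of _ c]) (auto simp: p intro!: continuous_intros)
  have T: "\<exists>\<gamma> c. continuous_on UNIV \<gamma> \<and> \<gamma> 0 = p \<and> c \<noteq> 0 \<and> (\<forall>t. \<phi> (\<gamma> t) = c * t + \<phi> p)"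
    if "\<And>t. \<phi> (g, th + t, ze, mu) = c * t + \<phi> p" "c \<noteq> 0" for c
    using that by (intro exI[of _ "\<lambda>t. (g, th + t, ze, mu)"] exI[of _ c]) (auto simp: p intro!: continuous_intros)
  have Z: "\<exists>\<gamma> c. continuous_on UNIV \<gamma> \<and> \<gamma> 0 = p \<and> c \<noteq> 0 \<and> (\<forall>t. \<phi> (\<gamma> t) = c * t + \<phi> p)"
    if "\<And>t. \<phi> (g, th, ze + t, mu) = c * t + \<phi> p" "c \<noteq> 0" for c
    using that by (intro exI[of _ "\<lambda>t. (g, th, ze + t, mu)"] exI[of _ c]) (auto simp: p intro!: continuous_intros)
  show "\<exists>\<gamma> c. continuous_on UNIV \<gamma> \<and> \<gamma> 0 = p \<and> c \<noteq> 0 \<and> (\<forall>t. \<phi> (\<gamma> t) = c * t + \<phi> p)"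
    using assms unfolding param_forms_def
  proof (elim UnE insertE emptyE imageE)
    fix k assume "\<phi> = (\<lambda>(g, th, ze, mu). th + of_int k * g)" then show ?thesis by (intro T[of 1]) (simp_all add: p)
  next
    fix j assume "\<phi> = (\<lambda>(g, th, ze, mu). ze + mu j)" then show ?thesis by (intro Z[of 1]) (simp_all add: p)
  next
    fix j assume "\<phi> = (\<lambda>(g, th, ze, mu). th + ze - mu j)" then show ?thesis by (intro Z[of 1]) (simp_all add: p)
  next
    assume "\<phi> = (\<lambda>(g, th, ze, mu). 2 * ze)" then show ?thesis by (intro Z[of 2]) (simp_all add: p)
  next
    assume "\<phi> = (\<lambda>(g, th, ze, mu). 2 * ze + th)" then show ?thesis by (intro T[of 1]) (simp_all add: p)
  next
    assume "\<phi> = (\<lambda>(g, th, ze, mu). ze)" then show ?thesis by (intro Z[of 1]) (simp_all add: p)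
  next
    assume "\<phi> = (\<lambda>(g, th, ze, mu). ze - \<i> * pi / 2)" then show ?thesis by (intro Z[of 1]) (simp_all add: p)
  next
    assume "\<phi> = (\<lambda>(g, th, ze, mu). 2 * (th + ze))" then show ?thesis by (intro Z[of 2]) (simp_all add: p)
  next
    assume "\<phi> = (\<lambda>(g, th, ze, mu). th + ze)" then show ?thesis by (intro Z[of 1]) (simp_all add: p)
  next
    assume "\<phi> = (\<lambda>(g, th, ze, mu). th + ze - \<i> * pi / 2)" then show ?thesis by (intro Z[of 1]) (simp_all add: p)
  next
    assume "\<phi> = (\<lambda>(g, th, ze, mu). \<i> * pi / 2 - g)" then show ?thesis by (intro G[of "-1"]) (simp_all add: p)
  next
    assume "\<phi> = (\<lambda>(g, th, ze, mu). g)" then show ?thesis by (intro G[of 1]) (simp_all add: p)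
  qed
qed

lemma spectral_forms_line:
  assumes "\<phi> \<in> spectral_forms L g th ze"
  shows "continuous_on UNIV \<phi>"
    and "\<exists>\<gamma> c. continuous_on UNIV \<gamma> \<and> \<gamma> 0 = p \<and> c \<noteq> 0 \<and> (\<forall>t. \<phi> (\<gamma> t) = c * t + \<phi> p)"
proof -
  show "continuous_on UNIV \<phi>"
    using assms unfolding spectral_forms_def
    by (auto intro!: continuous_intros continuous_on_product_coordinates)
  have L: "\<exists>\<gamma> c. continuous_on UNIV \<gamma> \<and> \<gamma> 0 = p \<and> c \<noteq> 0 \<and> (\<forall>t. \<phi> (\<gamma> t) = c * t + \<phi> p)"
    if "\<And>t. \<phi> (p(i := p i + t)) = c * t + \<phi> p" "c \<noteq> 0" for c i
  proof (intro exI[of _ "\<lambda>t. p(i := p i + t)"] exI[of _ c] conjI allI that)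
    show "continuous_on UNIV (\<lambda>t. p(i := p i + t))"
    proof (rule continuous_on_coordinatewise_then_product)
      show "continuous_on UNIV (\<lambda>t. (p(i := p i + t)) j)" for j
        by (cases "j = i") (auto intro!: continuous_intros)
    qed
  qed simp
  show "\<exists>\<gamma> c. continuous_on UNIV \<gamma> \<and> \<gamma> 0 = p \<and> c \<noteq> 0 \<and> (\<forall>t. \<phi> (\<gamma> t) = c * t + \<phi> p)"
    using assms unfolding spectral_forms_def
  proof (elim UnE imageE)
    fix x assume "\<phi> = (\<lambda>(i, j) lam. lam i - lam j) x" "x \<in> {(i, j). i \<in> {1..L} \<and> j \<in> {1..L} \<and> i \<noteq> j}"
    then obtain i j where "\<phi> = (\<lambda>lam. lam i - lam j)" "i \<noteq> j" by auto
    then show ?thesis by (intro L[of i 1]) simp_all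
  next
    fix x assume "\<phi> = (\<lambda>(i, j) lam. lam i + lam j + g) x"
    then obtain i j where "\<phi> = (\<lambda>lam. lam i + lam j + g)" by (cases x) auto
    \<comment> \<open>For \<open>i = j\<close> the form moves at double speed when
      \<open>lam i\<close> moves.\<close>
    then show ?thesis by (intro L[of i "if i = j then 2 else 1"]) (auto simp: algebra_simps)
  next
    fix x assume "\<phi> = (\<lambda>(i, c) lam. lam i + c) x"
    then obtain i c where "\<phi> = (\<lambda>lam. lam i + c)" by (cases x) auto
    then show ?thesis by (intro L[of i 1]) simp_all
  qed
qed

section \<open>The integral formula outside the exceptional sets\<close>

theorem theorem3p3:
  fixes tau :: complex and L :: nat
  assumes "Im tau > 0" and "L \<ge> 1"
  shows "\<exists>S :: (complex \<times> complex \<times> complex \<times> (nat \<Rightarrow> complex)) set.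
           closed S \<and> interior S = {} \<and>
           (\<forall>g th ze mu. (g, th, ze, mu) \<notin> S \<longrightarrow>
              (\<exists>Omega :: complex. \<exists>T :: (nat \<Rightarrow> complex) set. closed T \<and> interior T = {} \<and>
                 (\<forall>lam. lam \<notin> T \<longrightarrow>
                    (\<forall>\<^sub>F r in at_right 0.
                       Zpart tau g ze th L mu lam =
                         Omega * tf tau g ^ L * deriv (tf tau) 0 ^ L * Zint tau g ze th L mu lam r))))"
proof (cases "\<exists>b. tf tau b \<noteq> 0")
  \<comment> \<open>If \<open>tf\<close> vanished identically so would every \<open>R\<close>, and
    since \<open>L \<ge> 1\<close> the partition function contains at least one of them;
    \<open>Omega = 0\<close> then works.\<close>
  case False
  then have tf0: "tf tau x = 0" for x by blast
  have "Zpart tau g ze th L mu lam = 0" for g th ze mu lam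
  proof -
    have zero: "opmul n (\<lambda>_ _. 0) A = (\<lambda>_ _. 0)" for n A by (simp add: opmul_def)
    have upt: "[1..<L + 1] = 1 # [2..<L + 1]" using assms(2) by (simp add: upt_conv_Cons numeral_2_eq_2)
    have "Rop tau g n i j X l t = (\<lambda>_ _. 0)" for n i j X l t
      by (simp add: Rop_def Rmat_def tf0 fun_eq_iff)
    then have "Tdouble tau g ze th L mu l = (\<lambda>_ _. 0)" for l
      unfolding Tdouble_def Tmono_def upt by (simp add: zero)
    then have "Bop tau g ze th L mu l = (\<lambda>_ _. 0)" for l by (simp add: Bop_def)
    then show ?thesis unfolding Zpart_def upt by (simp add: zero)
  qed
  then show ?thesis
    using assms(2) by (intro exI[of _ "{}"] conjI allI impI exI[of _ 0]) (auto intro!: exI[of _ "{}"])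
next
  case True
  interpret nonzero_theta tau by unfold_locales (use assms True in auto)
  let ?V = "\<lambda>\<phi> :: params \<Rightarrow> complex. {p. tf tau (\<phi> p) = 0}"
  let ?W = "\<lambda>\<phi> :: (nat \<Rightarrow> complex) \<Rightarrow> complex. {p. tf tau (\<phi> p) = 0}"
  have S: "closed (\<Union>(?V ` param_forms L)) \<and> interior (\<Union>(?V ` param_forms L)) = {}"
    by (rule closed_nowhere_dense_Union)
       (use finite_forms in simp, use zero_set_nowhere_dense param_forms_line in blast)
  have main: "\<exists>Omega. \<exists>T. closed T \<and> interior T = {} \<and> (\<forall>lam. lam \<notin> T \<longrightarrow>
      (\<forall>\<^sub>F r in at_right 0. Zpart tau g ze th L mu lam = Omega * tf tau g ^ L * deriv (tf tau) 0 ^ L * Zint tau g ze th L mu lam r))"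
    if p: "(g, th, ze, mu) \<notin> \<Union>(?V ` param_forms L)" for g th ze mu
  proof -
    interpret sos tau g th ze ..
    have "\<forall>\<phi>\<in>param_forms L. tf tau (\<phi> (g, th, ze, mu)) \<noteq> 0" using p by blast
    note pf = this[unfolded param_forms_def ball_Un ball_simps prod.case]
    have "k \<in> {- int (L + 1)..int (L + 1)}" if "\<bar>k\<bar> \<le> int (L + 1)" for k using that by auto
    then have adm: "admissible (L + 1)" using pf unfolding admissible_def by blast
    have gb: generic_boundary using pf unfolding generic_boundary_def ball_simps by blast
    have g0: "br g \<noteq> 0" using pf by blast
    have mu: "br (ze + mu j) * br (th + ze - mu j) \<noteq> 0" if "j \<in> {1..L}" for j
      using pf that by simp
    let ?T = "\<Union>(?W ` spectral_forms L g th ze)"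
    have T: "closed ?T \<and> interior ?T = {}"
      by (rule closed_nowhere_dense_Union)
         (use finite_forms in simp, use zero_set_nowhere_dense spectral_forms_line in blast)
    have "\<forall>\<^sub>F r in at_right 0. Zpart tau g ze th L mu lam = prefactor mu L / br g ^ L * br g ^ L * deriv br 0 ^ L * Zint tau g ze th L mu lam r"
      if lam: "lam \<notin> ?T" for lam
    proof -
      have sf: "br (\<phi> lam) \<noteq> 0" if "\<phi> \<in> spectral_forms L g th ze" for \<phi> using lam that by blast
      have 1: "br (lam i - lam j) \<noteq> 0" if "i \<in> {1..L}" "j \<in> {1..L}" "i \<noteq> j" for i j
        by (rule sf[of "\<lambda>lam. lam i - lam j"]) (use that in \<open>force simp: spectral_forms_def\<close>)
      have 2: "br (lam i + lam j + g) \<noteq> 0" if "i \<in> {1..L}" "j \<in> {1..L}" for i j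
        by (rule sf[of "\<lambda>lam. lam i + lam j + g"]) (use that in \<open>force simp: spectral_forms_def\<close>)
      have 3: "br (lam i + c) \<noteq> 0" if "i \<in> {1..L}" "c \<in> {- ze, th + ze, g + ze, g - th - ze}" for i c
        by (rule sf[of "\<lambda>lam. lam i + c"]) (use that in \<open>force simp: spectral_forms_def\<close>)
      have inj: "inj_on lam {1..L}"
        using 1 by (force simp: inj_on_def)
      have "generic_spectral (lam ` {1..L})"
        unfolding generic_spectral_def
      proof (intro conjI ballI)
        fix a assume "a \<in> lam ` {1..L}"
        then obtain i where i: "i \<in> {1..L}" "a = lam i" by blast
        show "br (a - ze) \<noteq> 0" "br (a + th + ze) \<noteq> 0" "br (a + g + ze) \<noteq> 0" "br (a + g - th - ze) \<noteq> 0"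
          using 3[OF i(1), of "- ze"] 3[OF i(1), of "th + ze"] 3[OF i(1), of "g + ze"] 3[OF i(1), of "g - th - ze"] i(2)
          by (simp_all add: algebra_simps)
        fix b assume "b \<in> lam ` {1..L}"
        then obtain k where k: "k \<in> {1..L}" "b = lam k" by blast
        show "a \<noteq> b \<longrightarrow> br (a - b) \<noteq> 0" "br (a + b + g) \<noteq> 0"
          using 1[OF i(1) k(1)] 2[OF i(1) k(1)] i(2) k(2) by auto
      qed
      from Zpart_eq_integral[OF adm gb g0 mu inj this] show ?thesis .
    qed
    then show ?thesis using T by blast
  qed
  show ?thesis using S main by blast
qed

end
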